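(* Let $(Q,\tilde g,\tilde J)$ be (a representative of the homothety class of) an almost para-Kähler $4$-manifold, $\hat Q\to Q$ the $\mathbb{P}^1$-bundle of $\alpha$-planes and $\tilde\Pi^2,\tilde\Pi^3,\tilde\Pi^4\subset T\hat Q$ the distributions of ranks $2,3,4$ defined in the context. Frobenius integrability of $\tilde\Pi^2$ is equivalent to the self-duality of $\tilde g$. Assuming self-duality, $\tilde\Pi^3$ is integrable if and only if $\tau_-=0$ and $S=0$. Assuming the integrability of $\tilde\Pi^2$ and $\tilde\Pi^3$, the distribution $\tilde\Pi^4$ is integrable if and only if the Ricci curvature of $\tilde g$ vanishes.
   Context: An almost para-Kähler structure on a $4$-manifold $Q$ is a neutral signature metric $\tilde g$ and a closed nondegenerate $2$-form $\tilde\Omega$ such that $\tilde J=\tilde g^{-1}\tilde\Omega$ satisfies $\tilde J^2=\mathrm{Id}$. Then $TQ=\tilde L_-\oplus\tilde L_+$ (eigenspaces of $\tilde J$, both $\tilde g$-null and $\tilde\Omega$-Lagrangian), and there are local adapted coframes with $\tilde g=\tilde\omega^1\tilde\omega^3+\tilde\omega^2\tilde\omega^4$, $\tilde\Omega=\tilde\omega^1\wedge\tilde\omega^3+\tilde\omega^2\wedge\tilde\omega^4$ and dual frame $e_1,\dots,e_4$, $\tilde L_-=\langle e_1,e_2\rangle$, $\tilde L_+=\langle e_3,e_4\rangle$. $\alpha$-planes are the $\tilde g$-null planes $\tilde l_-\oplus\tilde l_+$ with $\tilde l_-=\langle e_1+\lambda e_2\rangle\subset\tilde L_-$, $\tilde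 l_+=\langle\lambda e_3-e_4\rangle\subset\tilde L_+$ (so $\tilde l_-\perp\tilde l_+$), $\lambda\in\mathbb{R}\cup\{\infty\}=\mathbb{P}^1$. Self-duality means that the half of the Weyl tensor (the anti-self-dual part) obstructing the existence of $\alpha$-surfaces tangent to every $\alpha$-plane vanishes. The Levi-Civita connection of $\tilde g$ induces a connection on $\hat Q\to Q$. At the point of $\hat Q$ given by the $\alpha$-plane $\tilde l_-\oplus\tilde l_+$, $\tilde\Pi^2$ is the horizontal lift of $\tilde l_-\oplus\tilde l_+$, $\tilde\Pi^3$ is the horizontal lift of $\tilde l_-\oplus\tilde L_+$, and $\tilde\Pi^4$ is the horizontal lift of $TQ$. Invariants. $\tau_-\in\Gamma(\Lambda^2\tilde L_+^*\otimes\tilde L_-)$ is the obstruction to Frobenius integrability of $\tilde L_+$: $\tau_-=(t_-^1e_1+t_-^2e_2)\otimes(\tilde\omega^3\wedge\tilde\omega^4)$, where $t_-^i$ is the coefficient of $\tilde\omega^3\wedge\tilde\omega^4$ in $d\tilde\omega^i$, $i=1,2$. If $P_{ij}$ are the components of the Schouten tensor of $\tilde g$ in the adapted coframe, $S$ is the component of the Ricci curvature given by $$S=(s_0(\tilde\omega^2)^2+2s_1\tilde\omega^1\tilde\omega^2-s_2(\tilde\omega^1)^2)\otimes(\tilde\omega^1\wedge\tilde\omega^2)^{1/2}\otimes(\tilde\omega^3\wedge\tilde\omega^4)^{-1/2},$$ $s_0=P_{23}$, $s_1=\tfrac12(P_{13}-P_{24})$, $s_2=P_{14}$. Thus $S=0$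 iff $P_{23}=P_{14}=0$ and $P_{13}=P_{24}$, i.e. the restriction of the Ricci tensor to $\tilde L_-\times\tilde L_+$ is proportional to that of $\tilde g$. *)

theory Defs
  imports "HOL-Analysis.Analysis"
begin

section \<open>Smooth maps, involutive distributions, smooth 4-manifolds\<close>

type_synonym vec4 = "real^4"
type_synonym mat4 = "real^4^4"

text \<open>These are meant for open \<open>S\<close>, where \<open>frechet_derivative f (at x)\<close> is the
  total derivative of \<open>f\<close>.\<close>

primrec Ck_on :: "nat \<Rightarrow> 'a::real_normed_vector set \<Rightarrow> ('a \<Rightarrow> 'b::real_normed_vector) \<Rightarrow> bool" where
  "Ck_on 0 S f \<longleftrightarrow> continuous_on S f"
| "Ck_on (Suc k) S f \<longleftrightarrow>
     f differentiable_on S \<and> (\<forall>v. Ck_on k S (\<lambda>x. frechet_derivative f (at x) v))"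

definition smooth_on :: "'a::real_normed_vector set \<Rightarrow> ('a \<Rightarrow> 'b::real_normed_vector) \<Rightarrow> bool" where
  "smooth_on S f \<longleftrightarrow> (\<forall>k. Ck_on k S f)"

definition lie_bracket :: "('e::real_normed_vector \<Rightarrow> 'e) \<Rightarrow> ('e \<Rightarrow> 'e) \<Rightarrow> 'e \<Rightarrow> 'e" where
  "lie_bracket X Y p = frechet_derivative Y (at p) (X p) - frechet_derivative X (at p) (Y p)"

definition frobenius_integrable_on ::
    "'e::real_normed_vector set \<Rightarrow> ('e \<Rightarrow> 'e set) \<Rightarrow> bool" where
  "frobenius_integrable_on W D \<longleftrightarrow>
     (\<forall>U X Y. open U \<and> U \<subseteq> W \<and> smooth_on U X \<and> smooth_on U Y \<and>
        (\<forall>p\<in>U. X p \<in> D p \<and> Y p \<in> D p) \<longrightarrow> (\<forall>p\<in>U. lie_bracket X Y p \<in> D p))"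

type_synonym 'q chart = "'q set \<times> ('q \<Rightarrow> vec4)"

definition chart_image :: "'q chart \<Rightarrow> vec4 set" where
  "chart_image c = snd c ` fst c"

definition transition :: "'q chart \<Rightarrow> 'q chart \<Rightarrow> vec4 \<Rightarrow> vec4" where
  "transition c c' = snd c' \<circ> inv_into (fst c) (snd c)"

text \<open>The underlying manifold is the union of the chart domains; the separation and
  countability axioms are imposed on the ambient type.\<close>

definition smooth_atlas :: "'q::{second_countable_topology, t2_space} chart set \<Rightarrow> bool" where
  "smooth_atlas A \<longleftrightarrow>
     (\<forall>c\<in>A. open (fst c) \<and> open (chart_image c) \<and>
        homeomorphism (fst c) (chart_image c) (snd c) (inv_into (fst c) (snd c))) \<and>
     (\<forall>c\<in>A. \<forall>c'\<in>A. smooth_on (snd c ` (fst c \<inter> fst c')) (transition c c'))"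

definition bil :: "mat4 \<Rightarrow> vec4 \<Rightarrow> vec4 \<Rightarrow> real" where
  "bil M u v = u \<bullet> (M *v v)"

text \<open>A covariant 2-tensor field is given by its matrix of components in every chart of
  the atlas, subject to the transformation law.\<close>

type_synonym 'q tensor2 = "'q chart \<Rightarrow> vec4 \<Rightarrow> mat4"

definition tensor2_field :: "'q chart set \<Rightarrow> 'q tensor2 \<Rightarrow> bool" where
  "tensor2_field A T \<longleftrightarrow>
     (\<forall>c\<in>A. smooth_on (chart_image c) (T c)) \<and>
     (\<forall>c\<in>A. \<forall>c'\<in>A. \<forall>x \<in> snd c ` (fst c \<inter> fst c'). \<forall>u v.
        bil (T c x) u v =
        bil (T c' (transition c c' x))
            (frechet_derivative (transition c c') (at x) u)
            (frechet_derivative (transition c c') (at x) v))"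

section \<open>Almost para-Kaehler structures\<close>

definition neutral_signature :: "mat4 \<Rightarrow> bool" where
  "neutral_signature M \<longleftrightarrow> transpose M = M \<and>
     (\<exists>B :: mat4. invertible B \<and> transpose B ** M ** B =
        (\<chi> i j. if i \<noteq> j then 0 else if i = 1 \<or> i = 2 then 1 else - 1))"

definition closed_form2 :: "vec4 set \<Rightarrow> (vec4 \<Rightarrow> mat4) \<Rightarrow> bool" where
  "closed_form2 S F \<longleftrightarrow> (\<forall>x\<in>S. \<forall>u v w.
     bil (frechet_derivative F (at x) u) v w +
     bil (frechet_derivative F (at x) v) w u +
     bil (frechet_derivative F (at x) w) u v = 0)"

text \<open>\<open>J = g\<^sup>-\<^sup>1 \<Omega>\<close> has components \<open>J\<^sup>a\<^sub>b = g\<^sup>a\<^sup>c \<Omega>\<^sub>c\<^sub>b\<close>, that is \<open>g(u, J v) = \<Omega>(u, v)\<close>.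
  With this contraction the span of \<open>e\<^sub>1, e\<^sub>2\<close> of an adapted frame is the \<open>-1\<close> eigenspace
  and the span of \<open>e\<^sub>3, e\<^sub>4\<close> the \<open>+1\<close> eigenspace.\<close>

definition J_of :: "mat4 \<Rightarrow> mat4 \<Rightarrow> mat4" where
  "J_of G Om = matrix_inv G ** Om"

definition L_minus :: "mat4 \<Rightarrow> mat4 \<Rightarrow> vec4 set" where
  "L_minus G Om = {v. J_of G Om *v v = - v}"

definition L_plus :: "mat4 \<Rightarrow> mat4 \<Rightarrow> vec4 set" where
  "L_plus G Om = {v. J_of G Om *v v = v}"

definition almost_para_kahler ::
    "'q::{second_countable_topology, t2_space} chart set \<Rightarrow> 'q tensor2 \<Rightarrow> 'q tensor2 \<Rightarrow> bool" where
  "almost_para_kahler A g \<Omega> \<longleftrightarrow>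
     smooth_atlas A \<and> tensor2_field A g \<and> tensor2_field A \<Omega> \<and>
     (\<forall>c\<in>A. closed_form2 (chart_image c) (\<Omega> c) \<and>
        (\<forall>x\<in>chart_image c.
           neutral_signature (g c x) \<and>
           transpose (\<Omega> c x) = - \<Omega> c x \<and> invertible (\<Omega> c x) \<and>
           J_of (g c x) (\<Omega> c x) ** J_of (g c x) (\<Omega> c x) = mat 1))"

text \<open>A local frame is \<open>e x $ i = e\<^sub>i(x)\<close>; row \<open>i\<close> of \<open>coframe e x\<close> is the dual 1-form \<open>\<omega>\<^sup>i\<close>.\<close>

definition coframe :: "(vec4 \<Rightarrow> mat4) \<Rightarrow> vec4 \<Rightarrow> mat4" where
  "coframe e x = matrix_inv (transpose (e x))"

definition om :: "(vec4 \<Rightarrow> mat4) \<Rightarrow> vec4 \<Rightarrow> 4 \<Rightarrow> vec4 \<Rightarrow> real" where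
  "om e x i u = (coframe e x *v u) $ i"

text \<open>The products in \<open>g = \<omega>\<^sup>1\<omega>\<^sup>3 + \<omega>\<^sup>2\<omega>\<^sup>4\<close> and \<open>\<Omega> = \<omega>\<^sup>1\<and>\<omega>\<^sup>3 + \<omega>\<^sup>2\<and>\<omega>\<^sup>4\<close> are
  \<open>\<alpha>\<beta> = \<alpha>\<otimes>\<beta> + \<beta>\<otimes>\<alpha>\<close> and \<open>\<alpha>\<and>\<beta> = \<alpha>\<otimes>\<beta> - \<beta>\<otimes>\<alpha>\<close>; equal normalisations of the two are
  forced by \<open>J\<^sup>2 = Id\<close>, and the common factor is a homothety.\<close>

definition adapted_frame ::
    "(vec4 \<Rightarrow> mat4) \<Rightarrow> (vec4 \<Rightarrow> mat4) \<Rightarrow> vec4 set \<Rightarrow> (vec4 \<Rightarrow> mat4) \<Rightarrow> bool" where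
  "adapted_frame G Om V e \<longleftrightarrow>
     open V \<and> smooth_on V e \<and>
     (\<forall>x\<in>V. invertible (e x) \<and>
        (\<forall>u v.
           bil (G x) u v = om e x 1 u * om e x 3 v + om e x 3 u * om e x 1 v
                         + om e x 2 u * om e x 4 v + om e x 4 u * om e x 2 v \<and>
           bil (Om x) u v = om e x 1 u * om e x 3 v - om e x 3 u * om e x 1 v
                          + om e x 2 u * om e x 4 v - om e x 4 u * om e x 2 v))"

section \<open>Levi-Civita connection and curvature in a chart\<close>

definition partial :: "4 \<Rightarrow> (vec4 \<Rightarrow> real) \<Rightarrow> vec4 \<Rightarrow> real" where
  "partial i f x = frechet_derivative f (at x) (axis i 1)"

definition christoffel :: "(vec4 \<Rightarrow> mat4) \<Rightarrow> vec4 \<Rightarrow> 4 \<Rightarrow> 4 \<Rightarrow> 4 \<Rightarrow> real" where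
  "christoffel G x k i j = (1/2) * (\<Sum>l\<in>UNIV. matrix_inv (G x) $ k $ l *
     (partial i (\<lambda>y. G y $ j $ l) x + partial j (\<lambda>y. G y $ i $ l) x
      - partial l (\<lambda>y. G y $ i $ j) x))"

definition gamma_op :: "(vec4 \<Rightarrow> mat4) \<Rightarrow> vec4 \<Rightarrow> vec4 \<Rightarrow> vec4 \<Rightarrow> vec4" where
  "gamma_op G x u v = (\<chi> k. \<Sum>i\<in>UNIV. \<Sum>j\<in>UNIV. christoffel G x k i j * u $ i * v $ j)"

text \<open>\<open>R(\<partial>\<^sub>c, \<partial>\<^sub>d) \<partial>\<^sub>b = R\<^sup>a\<^sub>b\<^sub>c\<^sub>d \<partial>\<^sub>a\<close>.\<close>

definition riemann_up :: "(vec4 \<Rightarrow> mat4) \<Rightarrow> vec4 \<Rightarrow> 4 \<Rightarrow> 4 \<Rightarrow> 4 \<Rightarrow> 4 \<Rightarrow> real" where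
  "riemann_up G x a b c d =
     partial c (\<lambda>y. christoffel G y a d b) x - partial d (\<lambda>y. christoffel G y a c b) x
     + (\<Sum>m\<in>UNIV. christoffel G x a c m * christoffel G x m d b
                - christoffel G x a d m * christoffel G x m c b)"

definition riemann :: "(vec4 \<Rightarrow> mat4) \<Rightarrow> vec4 \<Rightarrow> 4 \<Rightarrow> 4 \<Rightarrow> 4 \<Rightarrow> 4 \<Rightarrow> real" where
  "riemann G x a b c d = (\<Sum>m\<in>UNIV. G x $ a $ m * riemann_up G x m b c d)"

definition ricci :: "(vec4 \<Rightarrow> mat4) \<Rightarrow> vec4 \<Rightarrow> mat4" where
  "ricci G x = (\<chi> b d. \<Sum>a\<in>UNIV. riemann_up G x a b a d)"

definition scalar_curv :: "(vec4 \<Rightarrow> mat4) \<Rightarrow> vec4 \<Rightarrow> real" where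
  "scalar_curv G x = (\<Sum>b\<in>UNIV. \<Sum>d\<in>UNIV. matrix_inv (G x) $ b $ d * ricci G x $ b $ d)"

definition schouten :: "(vec4 \<Rightarrow> mat4) \<Rightarrow> vec4 \<Rightarrow> mat4" where
  "schouten G x = (1/2) *\<^sub>R (ricci G x - (scalar_curv G x / 6) *\<^sub>R G x)"

definition weyl :: "(vec4 \<Rightarrow> mat4) \<Rightarrow> vec4 \<Rightarrow> 4 \<Rightarrow> 4 \<Rightarrow> 4 \<Rightarrow> 4 \<Rightarrow> real" where
  "weyl G x a b c d = riemann G x a b c d
     - (G x $ a $ c * schouten G x $ b $ d - G x $ a $ d * schouten G x $ b $ c
      + G x $ b $ d * schouten G x $ a $ c - G x $ b $ c * schouten G x $ a $ d)"

text \<open>The volume form \<open>-\<Omega>\<and>\<Omega>/2 = \<omega>\<^sup>1\<and>\<omega>\<^sup>2\<and>\<omega>\<^sup>3\<and>\<omega>\<^sup>4\<close> of an adapted coframe. For the orientation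
  it defines, \<open>\<Omega>\<close> is self-dual and the bivectors of \<open>\<alpha>\<close>-planes are anti-self-dual, so the
  part of the Weyl tensor obstructing \<open>\<alpha>\<close>-surfaces is the anti-self-dual one.\<close>

definition vol :: "mat4 \<Rightarrow> 4 \<Rightarrow> 4 \<Rightarrow> 4 \<Rightarrow> 4 \<Rightarrow> real" where
  "vol Om a b c d =
     - (Om $ a $ b * Om $ c $ d - Om $ a $ c * Om $ b $ d + Om $ a $ d * Om $ b $ c)"

definition hodge :: "mat4 \<Rightarrow> mat4 \<Rightarrow> (4 \<Rightarrow> 4 \<Rightarrow> real) \<Rightarrow> 4 \<Rightarrow> 4 \<Rightarrow> real" where
  "hodge G Om F a b = (1/2) * (\<Sum>p\<in>UNIV. \<Sum>q\<in>UNIV. \<Sum>r\<in>UNIV. \<Sum>s\<in>UNIV.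
     vol Om a b p q * matrix_inv G $ p $ r * matrix_inv G $ q $ s * F r s)"

text \<open>The Weyl tensor commutes with the Hodge star, so projecting one pair of indices to
  the \<open>-1\<close> eigenspace gives its anti-self-dual part.\<close>

definition weyl_asd ::
    "(vec4 \<Rightarrow> mat4) \<Rightarrow> (vec4 \<Rightarrow> mat4) \<Rightarrow> vec4 \<Rightarrow> 4 \<Rightarrow> 4 \<Rightarrow> 4 \<Rightarrow> 4 \<Rightarrow> real" where
  "weyl_asd G Om x a b c d =
     (1/2) * (weyl G x a b c d - hodge (G x) (Om x) (\<lambda>r s. weyl G x r s c d) a b)"

definition self_dual :: "'q chart set \<Rightarrow> 'q tensor2 \<Rightarrow> 'q tensor2 \<Rightarrow> bool" where
  "self_dual A g \<Omega> \<longleftrightarrow>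
     (\<forall>k\<in>A. \<forall>x\<in>chart_image k. \<forall>a b c d. weyl_asd (g k) (\<Omega> k) x a b c d = 0)"

definition ricci_flat :: "'q chart set \<Rightarrow> 'q tensor2 \<Rightarrow> bool" where
  "ricci_flat A g \<longleftrightarrow> (\<forall>k\<in>A. \<forall>x\<in>chart_image k. ricci (g k) x = 0)"

section \<open>The invariants \<open>\<tau>\<^sub>-\<close> and \<open>S\<close>\<close>

definition d_om :: "(vec4 \<Rightarrow> mat4) \<Rightarrow> vec4 \<Rightarrow> 4 \<Rightarrow> vec4 \<Rightarrow> vec4 \<Rightarrow> real" where
  "d_om e x i u v = frechet_derivative (\<lambda>y. om e y i v) (at x) u
                  - frechet_derivative (\<lambda>y. om e y i u) (at x) v"

definition t_minus :: "(vec4 \<Rightarrow> mat4) \<Rightarrow> vec4 \<Rightarrow> 4 \<Rightarrow> real" where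
  "t_minus e x i = d_om e x i (e x $ 3) (e x $ 4)"

definition tau_minus :: "(vec4 \<Rightarrow> mat4) \<Rightarrow> vec4 \<Rightarrow> vec4 \<Rightarrow> vec4 \<Rightarrow> vec4" where
  "tau_minus e x u v = (om e x 3 u * om e x 4 v - om e x 4 u * om e x 3 v) *\<^sub>R
     (t_minus e x 1 *\<^sub>R e x $ 1 + t_minus e x 2 *\<^sub>R e x $ 2)"

definition tau_minus_vanishes :: "'q chart set \<Rightarrow> 'q tensor2 \<Rightarrow> 'q tensor2 \<Rightarrow> bool" where
  "tau_minus_vanishes A g \<Omega> \<longleftrightarrow>
     (\<forall>k\<in>A. \<forall>V e. V \<subseteq> chart_image k \<and> adapted_frame (g k) (\<Omega> k) V e \<longrightarrow>
        (\<forall>x\<in>V. \<forall>u v. tau_minus e x u v = 0))"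

definition schouten_comp :: "(vec4 \<Rightarrow> mat4) \<Rightarrow> (vec4 \<Rightarrow> mat4) \<Rightarrow> vec4 \<Rightarrow> 4 \<Rightarrow> 4 \<Rightarrow> real" where
  "schouten_comp G e x i j = bil (schouten G x) (e x $ i) (e x $ j)"

text \<open>The coefficient of \<open>S\<close> with respect to the nowhere vanishing section
  \<open>(\<omega>\<^sup>1\<and>\<omega>\<^sup>2)\<^bsup>1/2\<^esup> \<otimes> (\<omega>\<^sup>3\<and>\<omega>\<^sup>4)\<^bsup>-1/2\<^esup>\<close> of the weight line bundle, as a quadratic form.\<close>

definition S_form :: "(vec4 \<Rightarrow> mat4) \<Rightarrow> (vec4 \<Rightarrow> mat4) \<Rightarrow> vec4 \<Rightarrow> vec4 \<Rightarrow> real" where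
  "S_form G e x u =
     (let s0 = schouten_comp G e x 2 3;
          s1 = (schouten_comp G e x 1 3 - schouten_comp G e x 2 4) / 2;
          s2 = schouten_comp G e x 1 4
      in s0 * (om e x 2 u)\<^sup>2 + 2 * s1 * om e x 1 u * om e x 2 u - s2 * (om e x 1 u)\<^sup>2)"

definition S_vanishes :: "'q chart set \<Rightarrow> 'q tensor2 \<Rightarrow> 'q tensor2 \<Rightarrow> bool" where
  "S_vanishes A g \<Omega> \<longleftrightarrow>
     (\<forall>k\<in>A. \<forall>V e. V \<subseteq> chart_image k \<and> adapted_frame (g k) (\<Omega> k) V e \<longrightarrow>
        (\<forall>x\<in>V. \<forall>u. S_form (g k) e x u = 0))"

section \<open>The bundle of \<open>\<alpha>\<close>-planes and its distributions\<close>

definition alpha_planes :: "mat4 \<Rightarrow> mat4 \<Rightarrow> vec4 set set" where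
  "alpha_planes G Om = {span {a, b} | a b.
     a \<in> L_minus G Om \<and> a \<noteq> 0 \<and> b \<in> L_plus G Om \<and> b \<noteq> 0 \<and> bil G a b = 0}"

text \<open>Over a chart of the base, a point of the bundle is a pair \<open>(x, P)\<close> with
  \<open>P \<in> alpha_planes (g x) (\<Omega> x)\<close>. An adapted frame \<open>e\<close> on \<open>V\<close> gives the local
  parametrisation \<open>alpha_param e\<close>, defined on \<open>V \<times> UNIV\<close>. It omits only \<open>\<lambda> = \<infinity>\<close>, which is
  \<open>\<lambda> = 0\<close> for the adapted frame \<open>e\<^sub>2, e\<^sub>1, e\<^sub>4, e\<^sub>3\<close> (see \<open>alpha_planes_covered\<close> below), so
  the parametrisations of all adapted frames form an atlas of the whole bundle.\<close>

definition alpha_param :: "(vec4 \<Rightarrow> mat4) \<Rightarrow> vec4 \<times> real \<Rightarrow> vec4 \<times> vec4 set" where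
  "alpha_param e = (\<lambda>(x, l).
     (x, span {e x $ 1 + l *\<^sub>R e x $ 2, l *\<^sub>R e x $ 3 - e x $ 4}))"

definition swap_frame :: "(vec4 \<Rightarrow> mat4) \<Rightarrow> vec4 \<Rightarrow> mat4" where
  "swap_frame e x =
     (\<chi> i. e x $ (if i = 1 then 2 else if i = 2 then 1 else if i = 3 then 4 else 3))"

lemma matrix_inv_inverse:
  fixes M :: mat4
  assumes "invertible M"
  shows "matrix_inv M ** M = mat 1" "M ** matrix_inv M = mat 1"
  using assms someI_ex[of "\<lambda>N. M ** N = mat 1 \<and> N ** M = mat 1"]
  unfolding invertible_def matrix_inv_def by blast+

lemma Ck_on_cong:
  assumes "open S" "\<And>x. x \<in> S \<Longrightarrow> f x = h x"
  shows "Ck_on k S f \<longleftrightarrow> Ck_on k S h"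
  using assms(2)
proof (induction k arbitrary: f h)
  case 0
  then show ?case by (simp cong: continuous_on_cong)
next
  case (Suc k)
  have D: "(f has_derivative L) (at x) \<longleftrightarrow> (h has_derivative L) (at x)" if "x \<in> S" for x L
    using has_derivative_transform_within_open[OF _ assms(1) that, of f L UNIV h]
      has_derivative_transform_within_open[OF _ assms(1) that, of h L UNIV f] Suc.prems by auto
  then have F: "frechet_derivative f (at x) = frechet_derivative h (at x)" if "x \<in> S" for x
    using that by (simp add: frechet_derivative_def)
  have "f differentiable_on S \<longleftrightarrow> h differentiable_on S"
    using D assms(1) by (simp add: differentiable_on_eq_differentiable_at differentiable_def)
  moreover have "Ck_on k S (\<lambda>x. frechet_derivative f (at x) v) \<longleftrightarrow>
      Ck_on k S (\<lambda>x. frechet_derivative h (at x) v)" for v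
    by (rule Suc.IH) (simp add: F)
  ultimately show ?case by simp
qed

lemma Ck_on_linear:
  assumes "open S" "bounded_linear L" "Ck_on k S f"
  shows "Ck_on k S (\<lambda>x. L (f x))"
  using assms(3)
proof (induction k arbitrary: f)
  case 0
  then show ?case
    using bounded_linear.continuous_on[OF assms(2)] by simp
next
  case (Suc k)
  have f: "f differentiable (at x)" if "x \<in> S" for x
    using Suc.prems that assms(1) by (simp add: differentiable_on_eq_differentiable_at)
  have d: "((\<lambda>x. L (f x)) has_derivative (\<lambda>v. L (frechet_derivative f (at x) v))) (at x)"
    if "x \<in> S" for x
    using bounded_linear.has_derivative[OF assms(2)] f[OF that] frechet_derivative_works by blast
  have "Ck_on k S (\<lambda>x. frechet_derivative (\<lambda>x. L (f x)) (at x) v) \<longleftrightarrow>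
      Ck_on k S (\<lambda>x. L (frechet_derivative f (at x) v))" for v
    by (rule Ck_on_cong[OF assms(1)]) (simp add: frechet_derivative_at[OF d, symmetric])
  moreover have "(\<lambda>x. L (f x)) differentiable_on S"
    using d assms(1) by (auto simp: differentiable_on_eq_differentiable_at differentiable_def)
  ultimately show ?case using Suc.IH Suc.prems by simp
qed

lemma om_frame:
  assumes "invertible (e x)"
  shows "om e x i (e x $ j) = (if i = j then 1 else 0)"
    and "(\<Sum>i\<in>UNIV. om e x i u *\<^sub>R e x $ i) = u"
proof -
  have inv: "coframe e x ** transpose (e x) = mat 1" "transpose (e x) ** coframe e x = mat 1"
    using matrix_inv_inverse[OF transpose_invertible[OF assms]] by (simp_all add: coframe_def)
  have "e x $ j = transpose (e x) *v axis j 1"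
    by (simp add: matrix_vector_mult_basis column_def transpose_def vec_eq_iff)
  then have "coframe e x *v (e x $ j) = axis j 1"
    by (simp add: matrix_vector_mul_assoc inv del: transpose_matrix_vector)
  then show "om e x i (e x $ j) = (if i = j then 1 else 0)"
    by (simp add: om_def axis_def)
  have "transpose (e x) *v (coframe e x *v u) = u"
    by (simp add: matrix_vector_mul_assoc inv del: transpose_matrix_vector)
  then show "(\<Sum>i\<in>UNIV. om e x i u *\<^sub>R e x $ i) = u"
    by (simp add: matrix_vector_mult_def om_def transpose_def vec_eq_iff mult.commute)
qed

lemma vec4_expand:
  "invertible (e x) \<Longrightarrow>
   u = om e x 1 u *\<^sub>R e x $ 1 + om e x 2 u *\<^sub>R e x $ 2 + om e x 3 u *\<^sub>R e x $ 3 + om e x 4 u *\<^sub>R e x $ 4"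
  using om_frame(2)[of e x u] by (simp add: sum_4)

lemma om_linear:
  "om e x i (u + v) = om e x i u + om e x i v"
  "om e x i (u - v) = om e x i u - om e x i v"
  "om e x i (r *\<^sub>R u) = r * om e x i u"
  "om e x i 0 = 0"
  by (simp_all add: om_def matrix_vector_right_distrib matrix_vector_mult_diff_distrib
      matrix_vector_mult_scaleR)

lemma om_swap:
  assumes "invertible (e x)"
  shows "invertible (swap_frame e x)"
    and "om (swap_frame e) x 1 u = om e x 2 u" "om (swap_frame e) x 2 u = om e x 1 u"
    and "om (swap_frame e) x 3 u = om e x 4 u" "om (swap_frame e) x 4 u = om e x 3 u"
proof -
  define P :: mat4 where
    "P = (\<chi> i j. if j = (if i = 1 then 2 else if i = 2 then 1 else if i = 3 then 4 else 3)
       then 1 else 0)"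
  have sw: "swap_frame e x = P ** e x"
    by (simp add: swap_frame_def P_def vec_eq_iff matrix_matrix_mult_def forall_4 sum_4)
  have PP: "P ** P = mat 1"
    by (simp add: P_def vec_eq_iff matrix_matrix_mult_def forall_4 sum_4 mat_def)
  have "invertible P" using PP invertible_def by blast
  then show inv: "invertible (swap_frame e x)"
    using assms sw invertible_mult by metis
  have row: "swap_frame e x $ 1 = e x $ 2" "swap_frame e x $ 2 = e x $ 1"
    "swap_frame e x $ 3 = e x $ 4" "swap_frame e x $ 4 = e x $ 3"
    by (simp_all add: swap_frame_def)
  have "om (swap_frame e) x i u = om (swap_frame e) x i (om e x 1 u *\<^sub>R e x $ 1
      + om e x 2 u *\<^sub>R e x $ 2 + om e x 3 u *\<^sub>R e x $ 3 + om e x 4 u *\<^sub>R e x $ 4)" for i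
    using vec4_expand[where e = e, OF assms] by metis
  then have "om (swap_frame e) x i u = om e x 1 u * (if i = 2 then 1 else 0)
      + om e x 2 u * (if i = 1 then 1 else 0) + om e x 3 u * (if i = 4 then 1 else 0)
      + om e x 4 u * (if i = 3 then 1 else 0)" for i
    unfolding om_linear row[symmetric] om_frame(1)[where e="swap_frame e", OF inv] by simp
  then show "om (swap_frame e) x 1 u = om e x 2 u" "om (swap_frame e) x 2 u = om e x 1 u"
    "om (swap_frame e) x 3 u = om e x 4 u" "om (swap_frame e) x 4 u = om e x 3 u"
    by simp_all
qed

lemma adapted_swap:
  assumes "adapted_frame G Om V e"
  shows "adapted_frame G Om V (swap_frame e)"
proof -
  have V: "open V" "smooth_on V e" using assms by (auto simp: adapted_frame_def)
  have "linear (\<lambda>M::mat4. (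
      \<chi> i. M $ (if i = 1 then 2 else if i = 2 then 1 else if i = 3 then 4 else 3)) :: mat4)"
    by (rule linearI) (simp_all add: vec_eq_iff forall_4)
  then have "bounded_linear (\<lambda>M::mat4. (
      \<chi> i. M $ (if i = 1 then 2 else if i = 2 then 1 else if i = 3 then 4 else 3)) :: mat4)"
    by (rule linear_conv_bounded_linear[THEN iffD1])
  from Ck_on_linear[OF V(1) this] V(2) have "smooth_on V (swap_frame e)"
    by (simp add: smooth_on_def swap_frame_def[abs_def])
  then show ?thesis
    using assms om_swap[of e] unfolding adapted_frame_def by auto
qed

lemma L_adapted:
  assumes "adapted_frame G Om V e" "x \<in> V"
  shows "v \<in> L_minus (G x) (Om x) \<longleftrightarrow> om e x 3 v = 0 \<and> om e x 4 v = 0"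
    and "v \<in> L_plus (G x) (Om x) \<longleftrightarrow> om e x 1 v = 0 \<and> om e x 2 v = 0"
proof -
  note inv = assms(1)[unfolded adapted_frame_def, THEN conjunct2, THEN conjunct2, rule_format,
      OF assms(2)]
  have e: "invertible (e x)" using inv by blast
  have g: "bil (G x) u v = om e x 1 u * om e x 3 v + om e x 3 u * om e x 1 v
                         + om e x 2 u * om e x 4 v + om e x 4 u * om e x 2 v" for u v
    using inv by blast
  have O: "bil (Om x) u v = om e x 1 u * om e x 3 v - om e x 3 u * om e x 1 v
                          + om e x 2 u * om e x 4 v - om e x 4 u * om e x 2 v" for u v
    using inv by blast
  have "v = 0" if "G x *v v = 0" for v
  proof -
    have b: "bil (G x) u v = 0" for u using that by (simp add: bil_def)
    have "om e x 1 v = 0" "om e x 2 v = 0" "om e x 3 v = 0" "om e x 4 v = 0"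
      using b[of "e x $ 3"] b[of "e x $ 4"] b[of "e x $ 1"] b[of "e x $ 2"]
      by (simp_all add: g om_frame(1)[where e = e, OF e])
    then show ?thesis using vec4_expand[where e = e, OF e, of v] by simp
  qed
  then have "invertible (G x)"
    by (simp add: invertible_left_inverse matrix_left_invertible_ker)
  then have i: "matrix_inv (G x) ** G x = mat 1" "G x ** matrix_inv (G x) = mat 1"
    by (simp_all add: matrix_inv_inverse)
  have J: "J_of (G x) (Om x) *v v = w \<longleftrightarrow> Om x *v v = G x *v w" for v w
  proof
    assume "J_of (G x) (Om x) *v v = w"
    then have "G x *v w = (G x ** matrix_inv (G x)) *v (Om x *v v)"
      unfolding J_of_def matrix_vector_mul_assoc[symmetric] by simp
    then show "Om x *v v = G x *v w" unfolding i by simp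
  next
    assume "Om x *v v = G x *v w"
    then have "J_of (G x) (Om x) *v v = (matrix_inv (G x) ** G x) *v w"
      unfolding J_of_def matrix_vector_mul_assoc[symmetric] by simp
    then show "J_of (G x) (Om x) *v v = w" unfolding i by simp
  qed
  have m: "Om x *v v = G x *v w \<longleftrightarrow> (\<forall>u. bil (Om x) u v = bil (G x) u w)" for v w
    unfolding bil_def by (rule vector_eq_ldot[symmetric])
  have n: "om e x i (- v) = - om e x i v" for i v
    using om_linear(3)[of e x i "-1" v] by simp
  have LM: "v \<in> L_minus (G x) (Om x) \<longleftrightarrow> (\<forall>u. bil (Om x) u v = bil (G x) u (- v))" for v
    unfolding L_minus_def mem_Collect_eq J m by (rule refl)
  have LP: "v \<in> L_plus (G x) (Om x) \<longleftrightarrow> (\<forall>u. bil (Om x) u v = bil (G x) u v)" for v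
    unfolding L_plus_def mem_Collect_eq J m by (rule refl)
  show "v \<in> L_minus (G x) (Om x) \<longleftrightarrow> om e x 3 v = 0 \<and> om e x 4 v = 0"
  proof
    assume "v \<in> L_minus (G x) (Om x)"
    then have "bil (Om x) u v = bil (G x) u (- v)" for u
      unfolding LM by blast
    from this[of "e x $ 1"] this[of "e x $ 2"]
    show "om e x 3 v = 0 \<and> om e x 4 v = 0"
      by (simp add: g O n om_frame(1)[where e = e, OF e])
  qed (simp add: LM g O n)
  show "v \<in> L_plus (G x) (Om x) \<longleftrightarrow> om e x 1 v = 0 \<and> om e x 2 v = 0"
  proof
    assume "v \<in> L_plus (G x) (Om x)"
    then have "bil (Om x) u v = bil (G x) u v" for u
      unfolding LP by blast
    from this[of "e x $ 3"] this[of "e x $ 4"]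
    show "om e x 1 v = 0 \<and> om e x 2 v = 0"
      by (simp add: g O n om_frame(1)[where e = e, OF e])
  qed (simp add: LP g O n)
qed

lemma span_scaled_pair:
  fixes a b :: "'a::real_vector"
  assumes "r \<noteq> 0" "t \<noteq> 0"
  shows "span {r *\<^sub>R a, t *\<^sub>R b} = span {a, b}"
proof -
  have "span {r *\<^sub>R a, t *\<^sub>R b} \<subseteq> span {a, b}"
    by (rule span_minimal) (auto intro: span_base span_scale)
  moreover have "a = (1/r) *\<^sub>R (r *\<^sub>R a)" "b = (1/t) *\<^sub>R (t *\<^sub>R b)"
    using assms by simp_all
  then have "{a, b} \<subseteq> span {r *\<^sub>R a, t *\<^sub>R b}"
    by (metis empty_subsetI insert_subset insertI1 insert_commute span_base span_scale)
  then have "span {a, b} \<subseteq> span {r *\<^sub>R a, t *\<^sub>R b}"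
    by (rule span_minimal) simp
  ultimately show ?thesis by blast
qed

lemma alpha_planes_covered:
  assumes "adapted_frame G Om V e" "x \<in> V"
  shows "alpha_planes (G x) (Om x) =
    range (\<lambda>l. snd (alpha_param e (x, l))) \<union> {snd (alpha_param (swap_frame e) (x, 0))}"
proof -
  note inv = assms(1)[unfolded adapted_frame_def, THEN conjunct2, THEN conjunct2, rule_format,
      OF assms(2)]
  have e: "invertible (e x)" using inv by blast
  have g: "bil (G x) u v = om e x 1 u * om e x 3 v + om e x 3 u * om e x 1 v
                         + om e x 2 u * om e x 4 v + om e x 4 u * om e x 2 v" for u v
    using inv by blast
  note L = L_adapted[OF assms]
  note fr = om_frame(1)[where e = e, OF e]
  note ex = vec4_expand[where e = e, OF e]
  have sw: "snd (alpha_param (swap_frame e) (x, 0)) = span {e x $ 2, - e x $ 3}"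
    by (simp add: alpha_param_def swap_frame_def)
  show ?thesis (is "?L = ?R")
  proof
    show "?R \<subseteq> ?L"
    proof
      fix P assume "P \<in> ?R"
      then consider l where "P = span {e x $ 1 + l *\<^sub>R e x $ 2, l *\<^sub>R e x $ 3 - e x $ 4}"
        | "P = span {e x $ 2, - e x $ 3}"
        unfolding Un_iff sw by (auto simp: alpha_param_def)
      then show "P \<in> ?L"
      proof cases
        case 1
        let ?a = "e x $ 1 + l *\<^sub>R e x $ 2" and ?b = "l *\<^sub>R e x $ 3 - e x $ 4"
        have "om e x 1 ?a = 1" "om e x 4 ?b = -1" by (simp_all add: om_linear fr)
        then have "?a \<noteq> 0" "?b \<noteq> 0" by (metis om_linear(4) zero_neq_one, metis om_linear(4) neg_equal_0_iff_equal zero_neq_one)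
        moreover have "?a \<in> L_minus (G x) (Om x)" "?b \<in> L_plus (G x) (Om x)" "bil (G x) ?a ?b = 0"
          by (simp_all add: L g om_linear fr)
        ultimately show ?thesis unfolding alpha_planes_def 1 by blast
      next
        case 2
        let ?a = "e x $ 2" and ?b = "(-1) *\<^sub>R e x $ 3"
        have "om e x 2 ?a = 1" "om e x 3 ?b = -1" by (simp_all only: om_linear fr) simp_all
        then have "?a \<noteq> 0" "?b \<noteq> 0" by (metis om_linear(4) zero_neq_one, metis om_linear(4) neg_equal_0_iff_equal zero_neq_one)
        moreover have "?a \<in> L_minus (G x) (Om x)" "?b \<in> L_plus (G x) (Om x)" "bil (G x) ?a ?b = 0"
          by (simp_all only: L g om_linear fr) simp_all
        moreover have "P = span {?a, ?b}" using 2 by simp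
        ultimately show ?thesis unfolding alpha_planes_def by blast
      qed
    qed
    show "?L \<subseteq> ?R"
    proof
      fix P assume "P \<in> ?L"
      then obtain a b where P: "P = span {a, b}" and ab: "a \<noteq> 0" "b \<noteq> 0"
        "a \<in> L_minus (G x) (Om x)" "b \<in> L_plus (G x) (Om x)" "bil (G x) a b = 0"
        unfolding alpha_planes_def by blast
      define p q r t where "p = om e x 1 a" "q = om e x 2 a" "r = om e x 3 b" "t = om e x 4 b"
      have a: "a = p *\<^sub>R e x $ 1 + q *\<^sub>R e x $ 2" and b: "b = r *\<^sub>R e x $ 3 + t *\<^sub>R e x $ 4"
        using ex[of a] ex[of b] ab(3,4) by (simp_all add: L p_q_r_t_def)
      have pr: "p * r + q * t = 0"
        using ab(3-5) by (simp add: L g p_q_r_t_def)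
      show "P \<in> ?R"
      proof (cases "p = 0")
        case True
        then have q: "q \<noteq> 0" using ab a by auto
        then have t: "t = 0" using pr True by simp
        then have r: "- r \<noteq> 0" using ab b by auto
        have "P = span {q *\<^sub>R e x $ 2, (- r) *\<^sub>R (- e x $ 3)}"
          unfolding P a b by (simp add: True t)
        also have "\<dots> = span {e x $ 2, - e x $ 3}" by (rule span_scaled_pair[OF q r])
        finally show ?thesis by (simp add: sw)
      next
        case False
        have rr: "r = - t * (q / p)" using pr False by (simp add: field_simps)
        then have t: "- t \<noteq> 0" using ab b by auto
        have "a = p *\<^sub>R (e x $ 1 + (q / p) *\<^sub>R e x $ 2)"
          using False by (simp add: a algebra_simps)
        moreover have "b = (- t) *\<^sub>R ((q / p) *\<^sub>R e x $ 3 - e x $ 4)"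
          by (simp add: b rr algebra_simps)
        ultimately have "P = span {e x $ 1 + (q / p) *\<^sub>R e x $ 2, (q / p) *\<^sub>R e x $ 3 - e x $ 4}"
          unfolding P using span_scaled_pair[OF False t] by metis
        then show ?thesis by (auto simp: alpha_param_def)
      qed
    qed
  qed
qed

text \<open>For a parametrisation \<open>\<psi>\<close> on \<open>W\<close>, the tangent vector \<open>\<xi>\<close> at \<open>z\<close> is horizontal for the
  connection induced by \<open>\<nabla>\<close> iff along \<open>\<xi>\<close> the plane is parallel to first order: covariant
  derivatives of sections of the tautological plane bundle \<open>z \<mapsto> snd (\<psi> z)\<close> stay in the
  plane. The first component of \<open>\<xi>\<close> is its projection to the base.\<close>

definition horizontal_vec ::
    "(vec4 \<Rightarrow> mat4) \<Rightarrow> (vec4 \<times> real) set \<Rightarrow> (vec4 \<times> real \<Rightarrow> vec4 \<times> vec4 set) \<Rightarrow>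
     vec4 \<times> real \<Rightarrow> vec4 \<times> real \<Rightarrow> bool" where
  "horizontal_vec G W \<psi> z \<xi> \<longleftrightarrow>
     (\<forall>s. (\<forall>y\<in>W. s y \<in> snd (\<psi> y)) \<and> s differentiable (at z) \<longrightarrow>
        frechet_derivative s (at z) \<xi> + gamma_op G (fst (\<psi> z)) (fst \<xi>) (s z) \<in> snd (\<psi> z))"

definition horizontal_lift ::
    "(vec4 \<Rightarrow> mat4) \<Rightarrow> (vec4 \<times> real) set \<Rightarrow> (vec4 \<times> real \<Rightarrow> vec4 \<times> vec4 set) \<Rightarrow>
     (vec4 \<times> vec4 set \<Rightarrow> vec4 set) \<Rightarrow> vec4 \<times> real \<Rightarrow> (vec4 \<times> real) set" where
  "horizontal_lift G W \<psi> E z = {\<xi>. horizontal_vec G W \<psi> z \<xi> \<and> fst \<xi> \<in> E (\<psi> z)}"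

text \<open>The subspaces of the tangent space of the base to be lifted at a point \<open>(x, P)\<close> of the
  bundle. If \<open>P = l\<^sub>- \<oplus> l\<^sub>+\<close> then \<open>l\<^sub>- = P \<inter> L\<^sub>-\<close>.\<close>

definition Pi2_base :: "(vec4 \<Rightarrow> mat4) \<Rightarrow> (vec4 \<Rightarrow> mat4) \<Rightarrow> vec4 \<times> vec4 set \<Rightarrow> vec4 set" where
  "Pi2_base G Om = (\<lambda>(x, P). P)"

definition Pi3_base :: "(vec4 \<Rightarrow> mat4) \<Rightarrow> (vec4 \<Rightarrow> mat4) \<Rightarrow> vec4 \<times> vec4 set \<Rightarrow> vec4 set" where
  "Pi3_base G Om = (\<lambda>(x, P).
     {u + w | u w. u \<in> P \<inter> L_minus (G x) (Om x) \<and> w \<in> L_plus (G x) (Om x)})"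

definition Pi4_base :: "(vec4 \<Rightarrow> mat4) \<Rightarrow> (vec4 \<Rightarrow> mat4) \<Rightarrow> vec4 \<times> vec4 set \<Rightarrow> vec4 set" where
  "Pi4_base G Om = (\<lambda>(x, P). UNIV)"

text \<open>Integrability of the horizontal lift of \<open>E\<close>, tested in the above atlas of the bundle.\<close>

definition integrable_lift ::
    "'q chart set \<Rightarrow> 'q tensor2 \<Rightarrow> 'q tensor2 \<Rightarrow>
     ((vec4 \<Rightarrow> mat4) \<Rightarrow> (vec4 \<Rightarrow> mat4) \<Rightarrow> vec4 \<times> vec4 set \<Rightarrow> vec4 set) \<Rightarrow> bool" where
  "integrable_lift A g \<Omega> E \<longleftrightarrow>
     (\<forall>k\<in>A. \<forall>V e. V \<subseteq> chart_image k \<and> adapted_frame (g k) (\<Omega> k) V e \<longrightarrow>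
        frobenius_integrable_on (V \<times> UNIV)
          (horizontal_lift (g k) (V \<times> UNIV) (alpha_param e) (E (g k) (\<Omega> k))))"

abbreviation "Pi2_integrable A g \<Omega> \<equiv> integrable_lift A g \<Omega> Pi2_base"
abbreviation "Pi3_integrable A g \<Omega> \<equiv> integrable_lift A g \<Omega> Pi3_base"
abbreviation "Pi4_integrable A g \<Omega> \<equiv> integrable_lift A g \<Omega> Pi4_base"

end

theory Submission
  imports Defs
begin

text \<open>
  Everything is local in a chart with an adapted frame. Write \<open>m = e\<^sub>1 + \<lambda> e\<^sub>2\<close>, \<open>n = \<lambda> e\<^sub>3 - e\<^sub>4\<close> for
  the spanning sections of the tautological \<open>\<alpha>\<close>-plane bundle and \<open>\<nabla>\<close> for the pulled back
  Levi-Civita connection. A vector \<open>\<xi>\<close> is horizontal iff \<open>\<beta>(\<xi>) = g(\<nabla>\<^sub>\<xi> m, n)\<close> vanishes, and then \<open>\<nabla>\<^sub>\<xi>\<close> preserves the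
  null plane \<open>\<langle>m, n\<rangle>\<close>. Differentiating \<open>\<beta>(X) = \<beta>(Y) = 0\<close> gives \<open>\<beta>([X, Y]) = - g(R(X, Y) m, n)\<close>, while the
  base component of \<open>[X, Y]\<close> is controlled by \<open>\<nabla>m\<close> and \<open>\<nabla>n\<close>.

  For \<open>\<Pi>\<^sup>2\<close> only \<open>g(R(m, n) m, n) = 0\<close> remains; this is a quartic in \<open>\<lambda>\<close> whose five coefficients are the
  components of the anti-self-dual Weyl tensor. For \<open>\<Pi>\<^sup>3\<close> the base component contributes the form
  \<open>u \<mapsto> g(\<nabla>\<^sub>u e\<^sub>3, e\<^sub>4)\<close>, which vanishes on \<open>L\<^sub>-\<close> because \<open>d\<Omega> = 0\<close> and equals \<open>\<tau>\<^sub>-\<close> on \<open>L\<^sub>+\<close>. If it is zero then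
  \<open>L\<^sub>+\<close> is parallel, so \<open>R(e\<^sub>3, e\<^sub>4)\<close> vanishes by pair symmetry, and the remaining curvature condition is
  \<open>P(m, n) = 0\<close> for all \<open>\<lambda>\<close>, that is \<open>S = 0\<close>. For \<open>\<Pi>\<^sup>4\<close> the condition is that the curvature operator
  annihilates \<open>m \<and> n\<close> for all \<open>\<lambda>\<close>, which in the self-dual case is Ricci-flatness.
\<close>

section \<open>Calculus of smooth maps\<close>

text \<open>An \<alpha>-plane is its own \<open>g\<close>-orthogonal complement, and the base of
  \<open>\<Pi>\<^sup>3\<close> is the complement of the single vector \<open>n\<close>. Membership
  of a bracket in a distribution therefore amounts to scalar equations, pairings with
  \<open>m\<close> and \<open>n\<close>, which can be differentiated without choosing coefficients.
  Integrability is tested against all smooth fields on all open subsets of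
  \<open>V \<times> UNIV\<close>. Sufficiency is thus an identity for arbitrary \<open>X\<close>,
  \<open>Y\<close>, while necessity uses a few explicit fields: \<open>lift\<close> produces a
  smooth horizontal field over any smooth section of the pulled-back tangent bundle. The fibre point
  \<lambda> = \<infinity> adds no condition: the curvature conditions are polynomial in \<lambda>,
  and finitely many finite values force all coefficients to vanish. Self-duality and Ricci-flatness
  are pointwise and free of the frame, so they hold on a whole chart once every point has an adapted
  frame near it. Such a frame comes from the spectral projections of \<open>J\<close> and a local
  inversion of the pairing between \<open>L\<^sub>-\<close> and \<open>L\<^sub>+\<close>.\<close>

lemma Ck_on_subset:
  assumes "Ck_on k S f" "T \<subseteq> S"
  shows "Ck_on k T f"
  using assms(1)
  by (induction k arbitrary: f) (use assms(2) in \<open>auto intro: continuous_on_subset differentiable_on_subset\<close>)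

lemma Ck_on_SucD:
  assumes "Ck_on (Suc k) S f"
  shows "Ck_on k S f"
  using assms
  by (induction k arbitrary: f) (auto intro: differentiable_imp_continuous_on)

lemma Ck_on_const: "Ck_on k S (\<lambda>x. c)"
  by (induction k arbitrary: c) (auto simp: frechet_derivative_const)

lemma Ck_on_bounded_linear:
  assumes "bounded_linear L"
  shows "Ck_on k S L"
proof (cases k)
  case 0
  then show ?thesis using assms by (simp add: linear_continuous_on)
next
  case (Suc n)
  have "frechet_derivative L (at x) = L" for x
    using frechet_derivative_at[OF bounded_linear_imp_has_derivative[OF assms]] by simp
  then show ?thesis
    using Suc assms by (simp add: Ck_on_const bounded_linear_imp_differentiable_on)
qed

lemma frechet_derivative_eqI: "(f has_derivative D) (at x) \<Longrightarrow> frechet_derivative f (at x) = D"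
  by (rule frechet_derivative_at[symmetric])

lemma Ck_on_add:
  assumes "open S" "Ck_on k S f" "Ck_on k S h"
  shows "Ck_on k S (\<lambda>x. f x + h x)"
  using assms(2,3)
proof (induction k arbitrary: f h)
  case 0
  then show ?case by (simp add: continuous_on_add)
next
  case (Suc k)
  have d: "((\<lambda>x. f x + h x) has_derivative
      (\<lambda>v. frechet_derivative f (at x) v + frechet_derivative h (at x) v)) (at x)" if "x \<in> S" for x
    using Suc.prems that assms(1)
    by (auto intro!: has_derivative_add simp: differentiable_on_eq_differentiable_at
        simp flip: frechet_derivative_works)
  have "Ck_on k S (\<lambda>x. frechet_derivative (\<lambda>x. f x + h x) (at x) v) \<longleftrightarrow>
      Ck_on k S (\<lambda>x. frechet_derivative f (at x) v + frechet_derivative h (at x) v)" for v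
    by (rule Ck_on_cong[OF assms(1)]) (simp add: frechet_derivative_eqI[OF d])
  moreover have "(\<lambda>x. f x + h x) differentiable_on S"
    using d assms(1) by (auto simp: differentiable_on_eq_differentiable_at differentiable_def)
  ultimately show ?case using Suc by simp
qed

text \<open>By the Leibniz rule the derivative is a sum of two terms of the same form, so the
  induction generalises over both factors. Products, scalings and inner products are
  instances.\<close>

lemma Ck_on_bilinear:
  assumes "open S" "bounded_bilinear B" "Ck_on k S f" "Ck_on k S h"
  shows "Ck_on k S (\<lambda>x. B (f x) (h x))"
  using assms(3,4)
proof (induction k arbitrary: f h)
  case 0
  then show ?case by (simp add: bounded_bilinear.continuous_on[OF assms(2)])
next
  case (Suc k)
  have d: "((\<lambda>x. B (f x) (h x)) has_derivative
      (\<lambda>v. B (f x) (frechet_derivative h (at x) v) + B (frechet_derivative f (at x) v) (h x))) (at x)"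
    if "x \<in> S" for x
    using Suc.prems that assms(1)
    by (auto intro!: bounded_bilinear.FDERIV[OF assms(2)] simp: differentiable_on_eq_differentiable_at
        simp flip: frechet_derivative_works)
  have "Ck_on k S (\<lambda>x. frechet_derivative (\<lambda>x. B (f x) (h x)) (at x) v) \<longleftrightarrow>
      Ck_on k S (\<lambda>x. B (f x) (frechet_derivative h (at x) v)
        + B (frechet_derivative f (at x) v) (h x))" for v
    by (rule Ck_on_cong[OF assms(1)]) (simp add: frechet_derivative_eqI[OF d])
  moreover have "(\<lambda>x. B (f x) (h x)) differentiable_on S"
    using d assms(1) by (auto simp: differentiable_on_eq_differentiable_at differentiable_def)
  moreover have "Ck_on k S f" "Ck_on k S h"
    using Suc.prems by (auto intro: Ck_on_SucD)
  ultimately show ?case using Suc by (auto intro!: Ck_on_add[OF assms(1)])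
qed

text \<open>The derivative -(1/f) f' (1/f) involves 1/f itself, which the induction hypothesis
  controls at the lower order; hence \<open>f\<close> stays fixed in the induction.\<close>

lemma Ck_on_inverse:
  fixes f :: "'a::real_normed_vector \<Rightarrow> real"
  assumes "open S" "Ck_on k S f" "\<And>x. x \<in> S \<Longrightarrow> f x \<noteq> 0"
  shows "Ck_on k S (\<lambda>x. inverse (f x))"
  using assms(2)
proof (induction k)
  case 0
  then show ?case using assms by (simp add: continuous_on_inverse)
next
  case (Suc k)
  have d: "((\<lambda>x. inverse (f x)) has_derivative
      (\<lambda>v. - (inverse (f x) * frechet_derivative f (at x) v * inverse (f x)))) (at x)"
    if "x \<in> S" for x
    using Suc.prems that assms(1,3)
    by (auto intro!: has_derivative_inverse simp: differentiable_on_eq_differentiable_at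
        simp flip: frechet_derivative_works)
  have "Ck_on k S (\<lambda>x. frechet_derivative (\<lambda>x. inverse (f x)) (at x) v) \<longleftrightarrow>
      Ck_on k S (\<lambda>x. - (inverse (f x) * frechet_derivative f (at x) v * inverse (f x)))" for v
    by (rule Ck_on_cong[OF assms(1)]) (simp add: frechet_derivative_eqI[OF d])
  moreover have "(\<lambda>x. inverse (f x)) differentiable_on S"
    using d assms(1) by (auto simp: differentiable_on_eq_differentiable_at differentiable_def)
  moreover have "Ck_on k S (\<lambda>x. inverse (f x))"
    using Suc.IH Ck_on_SucD[OF Suc.prems] by blast
  ultimately show ?case using Suc.prems
    by (auto intro!: Ck_on_bilinear[OF assms(1) bounded_bilinear_mult]
        Ck_on_linear[OF assms(1) bounded_linear_minus[OF bounded_linear_ident]])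
qed

text \<open>Differentiating \<open>f \<circ> L\<close> in direction \<open>v\<close> gives the
  derivative of \<open>f\<close> in the fixed direction \<open>L v\<close>, again composed with
  \<open>L\<close>. The inner map used below is the projection of \<open>V \<times> UNIV\<close> to
  \<open>V\<close>.\<close>

lemma Ck_on_compose_linear:
  assumes "open S" "open T" "bounded_linear L" "L ` T \<subseteq> S" "Ck_on k S f"
  shows "Ck_on k T (\<lambda>x. f (L x))"
  using assms(5)
proof (induction k arbitrary: f)
  case 0
  then show ?case
    using continuous_on_compose2[OF _ linear_continuous_on[OF assms(3)] assms(4)] by auto
next
  case (Suc k)
  have d: "((\<lambda>x. f (L x)) has_derivative (\<lambda>v. frechet_derivative f (at (L x)) (L v))) (at x)"
    if "x \<in> T" for x
  proof -
    have "(f has_derivative frechet_derivative f (at (L x))) (at (L x))"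
      using Suc.prems that assms(1,4)
      by (auto simp: differentiable_on_eq_differentiable_at simp flip: frechet_derivative_works)
    from has_derivative_compose[OF bounded_linear_imp_has_derivative[OF assms(3)] this]
    show ?thesis .
  qed
  have "Ck_on k T (\<lambda>x. frechet_derivative (\<lambda>x. f (L x)) (at x) v) \<longleftrightarrow>
      Ck_on k T (\<lambda>x. frechet_derivative f (at (L x)) (L v))" for v
    by (rule Ck_on_cong[OF assms(2)]) (simp add: frechet_derivative_eqI[OF d])
  moreover have "(\<lambda>x. f (L x)) differentiable_on T"
    using d assms(2) by (auto simp: differentiable_on_eq_differentiable_at differentiable_def)
  ultimately show ?case using Suc by auto
qed

named_theorems smooth_intros

lemma smooth_on_subset: "smooth_on S f \<Longrightarrow> T \<subseteq> S \<Longrightarrow> smooth_on T f"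
  by (auto simp: smooth_on_def intro: Ck_on_subset)

lemma smooth_on_cong:
  assumes "open S" "\<And>x. x \<in> S \<Longrightarrow> f x = h x"
  shows "smooth_on S f \<longleftrightarrow> smooth_on S h"
  using Ck_on_cong[OF assms] by (simp add: smooth_on_def)

lemma smooth_on_const [smooth_intros]: "smooth_on S (\<lambda>x. c)"
  by (simp add: smooth_on_def Ck_on_const)

lemma smooth_on_bounded_linear: "bounded_linear L \<Longrightarrow> smooth_on S L"
  by (simp add: smooth_on_def Ck_on_bounded_linear)

lemma smooth_on_add [smooth_intros]:
  "open S \<Longrightarrow> smooth_on S f \<Longrightarrow> smooth_on S h \<Longrightarrow> smooth_on S (\<lambda>x. f x + h x)"
  by (simp add: smooth_on_def Ck_on_add)

lemma smooth_on_linear: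
  "open S \<Longrightarrow> bounded_linear L \<Longrightarrow> smooth_on S f \<Longrightarrow> smooth_on S (\<lambda>x. L (f x))"
  by (simp add: smooth_on_def Ck_on_linear)

lemma smooth_on_bilinear:
  "open S \<Longrightarrow> bounded_bilinear B \<Longrightarrow> smooth_on S f \<Longrightarrow> smooth_on S h \<Longrightarrow>
    smooth_on S (\<lambda>x. B (f x) (h x))"
  by (simp add: smooth_on_def Ck_on_bilinear)

lemma smooth_on_compose_linear:
  "open S \<Longrightarrow> open T \<Longrightarrow> bounded_linear L \<Longrightarrow> L ` T \<subseteq> S \<Longrightarrow> smooth_on S f \<Longrightarrow>
    smooth_on T (\<lambda>x. f (L x))"
  using Ck_on_compose_linear[of S T L _ f] by (simp add: smooth_on_def)

lemma smooth_on_inverse [smooth_intros]: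
  fixes f :: "'a::real_normed_vector \<Rightarrow> real"
  shows "open S \<Longrightarrow> smooth_on S f \<Longrightarrow> (\<And>x. x \<in> S \<Longrightarrow> f x \<noteq> 0) \<Longrightarrow> smooth_on S (\<lambda>x. inverse (f x))"
  by (simp add: smooth_on_def Ck_on_inverse)

lemma smooth_on_minus [smooth_intros]:
  "open S \<Longrightarrow> smooth_on S f \<Longrightarrow> smooth_on S (\<lambda>x. - f x)"
  by (rule smooth_on_linear[OF _ bounded_linear_minus[OF bounded_linear_ident]])

lemma smooth_on_diff [smooth_intros]:
  assumes "open S" "smooth_on S f" "smooth_on S h"
  shows "smooth_on S (\<lambda>x. f x - h x)"
  using smooth_on_add[OF assms(1,2) smooth_on_minus[OF assms(1,3)]] by simp

lemma smooth_on_scaleR [smooth_intros]: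
  "open S \<Longrightarrow> smooth_on S f \<Longrightarrow> smooth_on S h \<Longrightarrow> smooth_on S (\<lambda>x. f x *\<^sub>R h x)"
  by (rule smooth_on_bilinear[OF _ bounded_bilinear_scaleR])

lemma smooth_on_mult [smooth_intros]:
  fixes f h :: "'a::real_normed_vector \<Rightarrow> real"
  shows "open S \<Longrightarrow> smooth_on S f \<Longrightarrow> smooth_on S h \<Longrightarrow> smooth_on S (\<lambda>x. f x * h x)"
  by (rule smooth_on_bilinear[OF _ bounded_bilinear_mult])

lemma smooth_on_divide [smooth_intros]:
  fixes f h :: "'a::real_normed_vector \<Rightarrow> real"
  assumes "open S" "smooth_on S f" "smooth_on S h" "\<And>x. x \<in> S \<Longrightarrow> h x \<noteq> 0"
  shows "smooth_on S (\<lambda>x. f x / h x)"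
  unfolding divide_inverse using assms by (intro smooth_intros)

lemma smooth_on_inner [smooth_intros]:
  "open S \<Longrightarrow> smooth_on S f \<Longrightarrow> smooth_on S h \<Longrightarrow> smooth_on S (\<lambda>x. f x \<bullet> h x)"
  by (rule smooth_on_bilinear[OF _ bounded_bilinear_inner])

lemma smooth_on_sum [smooth_intros]:
  assumes "open S" "\<And>i. i \<in> I \<Longrightarrow> smooth_on S (f i)"
  shows "smooth_on S (\<lambda>x. \<Sum>i\<in>I. f i x)"
  using assms(2) by (induction I rule: infinite_finite_induct) (auto intro!: smooth_intros assms(1))

lemma smooth_on_prod:
  fixes f :: "'i \<Rightarrow> 'a::real_normed_vector \<Rightarrow> real"
  assumes "open S" "\<And>i. i \<in> I \<Longrightarrow> smooth_on S (f i)"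
  shows "smooth_on S (\<lambda>x. \<Prod>i\<in>I. f i x)"
  using assms(2) by (induction I rule: infinite_finite_induct) (auto intro!: smooth_intros assms(1))

lemma smooth_on_nth [smooth_intros]:
  "open S \<Longrightarrow> smooth_on S f \<Longrightarrow> smooth_on S (\<lambda>x. f x $ i)"
  by (rule smooth_on_linear[OF _ bounded_linear_vec_nth])

lemma bounded_linear_axis: "bounded_linear (\<lambda>y::'b::euclidean_space. axis i y :: 'b^'n)"
  by (rule linear_conv_bounded_linear[THEN iffD1], rule linearI) (auto simp: axis_def vec_eq_iff)

lemma smooth_on_vec_lambda [smooth_intros]:
  fixes f :: "'a::real_normed_vector \<Rightarrow> 'n::finite \<Rightarrow> 'b::euclidean_space"
  assumes "open S" "\<And>i. smooth_on S (\<lambda>x. f x i)"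
  shows "smooth_on S (\<lambda>x. \<chi> i. f x i)"
proof -
  have "(\<chi> i. f x i) = (\<Sum>i\<in>UNIV. axis i (f x i))" for x
    by (simp add: vec_eq_iff axis_def if_distrib [of "\<lambda>z. z $ _"] cong: if_cong)
  moreover have "smooth_on S (\<lambda>x. \<Sum>i\<in>UNIV. axis i (f x i))"
    by (intro smooth_on_sum assms(1) smooth_on_linear[OF assms(1) bounded_linear_axis assms(2)])
  ultimately show ?thesis by (simp only:)
qed

lemma smooth_on_Pair [smooth_intros]:
  assumes "open S" "smooth_on S f" "smooth_on S h"
  shows "smooth_on S (\<lambda>x. (f x, h x))"
proof -
  have "smooth_on S (\<lambda>x. (f x, 0) + (0, h x))"
    by (intro smooth_intros assms smooth_on_linear[OF assms(1) _ assms(2)]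
        smooth_on_linear[OF assms(1) _ assms(3)] bounded_linear_Pair bounded_linear_ident bounded_linear_zero)
  then show ?thesis by simp
qed

section \<open>Derivatives of smooth maps, also along a moving direction\<close>

lemma smooth_on_deriv:
  "smooth_on S f \<Longrightarrow> smooth_on S (\<lambda>x. frechet_derivative f (at x) v)"
  unfolding smooth_on_def by (metis Ck_on.simps(2))

lemma smooth_on_imp_continuous_on: "smooth_on S f \<Longrightarrow> continuous_on S f"
  unfolding smooth_on_def by (metis Ck_on.simps(1))

lemma smooth_on_imp_differentiable:
  "open S \<Longrightarrow> smooth_on S f \<Longrightarrow> x \<in> S \<Longrightarrow> f differentiable (at x)"
  unfolding smooth_on_def by (metis Ck_on.simps(2) differentiable_on_eq_differentiable_at)

lemma smooth_on_has_derivative: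
  "open S \<Longrightarrow> smooth_on S f \<Longrightarrow> x \<in> S \<Longrightarrow> (f has_derivative frechet_derivative f (at x)) (at x)"
  using smooth_on_imp_differentiable frechet_derivative_works by blast

lemma frechet_derivative_expand:
  fixes f :: "'a::euclidean_space \<Rightarrow> 'b::real_normed_vector"
  assumes "f differentiable (at x)"
  shows "frechet_derivative f (at x) v = (\<Sum>b\<in>Basis. (v \<bullet> b) *\<^sub>R frechet_derivative f (at x) b)"
proof -
  interpret linear "frechet_derivative f (at x)"
    using linear_frechet_derivative[OF assms] .
  show ?thesis
    using euclidean_representation[of v] by (metis (no_types, lifting) scale sum sum.cong)
qed

text \<open>\<open>smooth_on\<close> speaks of derivatives in fixed directions; expanding the moving
  direction in the standard basis puts its variation into scalar coefficients.\<close>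

lemma smooth_on_deriv_along:
  fixes f :: "'a::euclidean_space \<Rightarrow> 'b::real_normed_vector"
  assumes "open S" "smooth_on S f" "smooth_on S v"
  shows "smooth_on S (\<lambda>x. frechet_derivative f (at x) (v x))"
proof -
  have "smooth_on S (\<lambda>x. \<Sum>b\<in>Basis. (v x \<bullet> b) *\<^sub>R frechet_derivative f (at x) b)"
    by (intro smooth_intros assms smooth_on_deriv)
  then show ?thesis
    by (subst smooth_on_cong[OF assms(1) frechet_derivative_expand])
      (auto intro: smooth_on_imp_differentiable assms)
qed

text \<open>Product rule for a derivative in a moving direction: one term differentiates the
  direction, the other is a second derivative of \<open>f\<close> with the direction frozen at
  \<open>v z\<close>.\<close>

lemma has_derivative_deriv_along:
  fixes f :: "'a::euclidean_space \<Rightarrow> 'b::real_normed_vector"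
  assumes "open S" "smooth_on S f" "z \<in> S" "(v has_derivative v') (at z)"
  shows "((\<lambda>x. frechet_derivative f (at x) (v x)) has_derivative
    (\<lambda>h. frechet_derivative f (at z) (v' h)
       + frechet_derivative (\<lambda>x. frechet_derivative f (at x) (v z)) (at z) h)) (at z)"
proof -
  let ?D = "\<lambda>b x. frechet_derivative f (at x) b"
  let ?DD = "\<lambda>b h. frechet_derivative (?D b) (at z) h"
  have D: "(?D b has_derivative ?DD b) (at z)" for b
    using smooth_on_has_derivative[OF assms(1) smooth_on_deriv[OF assms(2)] assms(3)] .
  have ex: "?D w x = (\<Sum>b\<in>Basis. (w \<bullet> b) *\<^sub>R ?D b x)" if "x \<in> S" for x w
    using smooth_on_imp_differentiable[OF assms(1,2) that] by (rule frechet_derivative_expand)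
  have "((\<lambda>x. \<Sum>b\<in>Basis. (v x \<bullet> b) *\<^sub>R ?D b x) has_derivative
      (\<lambda>h. \<Sum>b\<in>Basis. (v z \<bullet> b) *\<^sub>R ?DD b h + (v' h \<bullet> b) *\<^sub>R ?D b z)) (at z)"
    by (auto intro!: derivative_eq_intros assms(4) D)
  from has_derivative_transform_within_open[OF this assms(1,3)]
  have 1: "((\<lambda>x. ?D (v x) x) has_derivative
      (\<lambda>h. \<Sum>b\<in>Basis. (v z \<bullet> b) *\<^sub>R ?DD b h + (v' h \<bullet> b) *\<^sub>R ?D b z)) (at z)"
    using ex by simp
  have "((\<lambda>x. \<Sum>b\<in>Basis. (v z \<bullet> b) *\<^sub>R ?D b x) has_derivative
      (\<lambda>h. \<Sum>b\<in>Basis. (v z \<bullet> b) *\<^sub>R ?DD b h)) (at z)"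
    by (auto intro!: derivative_eq_intros D)
  from has_derivative_transform_within_open[OF this assms(1,3)]
  have "?DD (v z) = (\<lambda>h. \<Sum>b\<in>Basis. (v z \<bullet> b) *\<^sub>R ?DD b h)"
    using ex by (intro frechet_derivative_eqI) simp
  then have "?DD (v z) h = (\<Sum>b\<in>Basis. (v z \<bullet> b) *\<^sub>R ?DD b h)" for h by (rule fun_cong)
  then have "(\<lambda>h. \<Sum>b\<in>Basis. (v z \<bullet> b) *\<^sub>R ?DD b h + (v' h \<bullet> b) *\<^sub>R ?D b z)
      = (\<lambda>h. ?D (v' h) z + ?DD (v z) h)"
    unfolding ex[OF assms(3), of "v' _"] by (simp add: sum.distrib add.commute)
  then show ?thesis
    using 1 by simp
qed

text \<open>The mixed second difference of \<open>f\<close> over a small parallelogram is symmetric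
  in \<open>u\<close> and \<open>v\<close>. Two applications of the mean value theorem write it as
  \<open>h\<^sup>2\<close> times either mixed derivative at a nearby point, and continuity forces
  the two to agree at \<open>z\<close>.\<close>

lemma Schwarz_real:
  fixes f :: "'a::euclidean_space \<Rightarrow> real"
  assumes S: "open S" "smooth_on S f" "z \<in> S"
  shows "frechet_derivative (\<lambda>y. frechet_derivative f (at y) u) (at z) v
       = frechet_derivative (\<lambda>y. frechet_derivative f (at y) v) (at z) u"
proof (rule ccontr)
  let ?D = "\<lambda>u y. frechet_derivative f (at y) u"
  let ?DD = "\<lambda>u v y. frechet_derivative (?D u) (at y) v"
  assume ne: "?DD u v z \<noteq> ?DD v u z"
  \<comment> \<open>Half the gap: no number lies within less than this distance of both
    derivatives.\<close>
  define \<epsilon> where "\<epsilon> = \<bar>?DD u v z - ?DD v u z\<bar> / 2"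
  have \<epsilon>: "\<epsilon> > 0" using ne by (simp add: \<epsilon>_def)
  have cont: "isCont (?DD u v) z" for u v
    using smooth_on_imp_continuous_on[OF smooth_on_deriv[OF smooth_on_deriv[OF S(2)]]] S(1,3)
    by (simp add: continuous_on_eq_continuous_at)
  have ev: "\<forall>\<^sub>F y in nhds z. y \<in> S \<and> \<bar>?DD u v y - ?DD u v z\<bar> < \<epsilon> \<and> \<bar>?DD v u y - ?DD v u z\<bar> < \<epsilon>"
  proof (intro eventually_conj)
    show "\<forall>\<^sub>F y in nhds z. y \<in> S" using S by (simp add: eventually_nhds_in_open)
    have "\<forall>\<^sub>F y in nhds z. \<bar>?DD u v y - ?DD u v z\<bar> < \<epsilon>" for u v
      using tendstoD[OF cont[of u v, unfolded isCont_def] \<epsilon>] \<epsilon>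
      by (simp add: dist_real_def eventually_nhds_conv_at)
    then show "\<forall>\<^sub>F y in nhds z. \<bar>?DD u v y - ?DD u v z\<bar> < \<epsilon>"
      "\<forall>\<^sub>F y in nhds z. \<bar>?DD v u y - ?DD v u z\<bar> < \<epsilon>" by blast+
  qed
  have lim: "((\<lambda>p::real \<times> real. z + fst p *\<^sub>R u + snd p *\<^sub>R v) \<longlongrightarrow> z) (nhds 0)"
  proof -
    have "continuous_on UNIV (\<lambda>p::real \<times> real. z + fst p *\<^sub>R u + snd p *\<^sub>R v)"
      by (intro continuous_intros)
    then have "isCont (\<lambda>p::real \<times> real. z + fst p *\<^sub>R u + snd p *\<^sub>R v) 0"
      by (simp add: continuous_on_eq_continuous_at)
    then show ?thesis
      using tendsto_at_iff_tendsto_nhds[of "\<lambda>p::real \<times> real. z + fst p *\<^sub>R u + snd p *\<^sub>R v" 0]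
      by (simp add: isCont_def)
  qed
  have "\<forall>\<^sub>F p in nhds (0::real \<times> real). z + fst p *\<^sub>R u + snd p *\<^sub>R v \<in>
      {y. y \<in> S \<and> \<bar>?DD u v y - ?DD u v z\<bar> < \<epsilon> \<and> \<bar>?DD v u y - ?DD v u z\<bar> < \<epsilon>}"
    using filterlim_iff[THEN iffD1, OF lim, rule_format, OF ev] by simp
  then obtain d where d: "d > 0" and dd: "\<And>p::real \<times> real. dist p 0 < d \<Longrightarrow>
      z + fst p *\<^sub>R u + snd p *\<^sub>R v \<in>
      {y. y \<in> S \<and> \<bar>?DD u v y - ?DD u v z\<bar> < \<epsilon> \<and> \<bar>?DD v u y - ?DD v u z\<bar> < \<epsilon>}"
    unfolding eventually_nhds_metric by blast
  \<comment> \<open>Then \<open>(s, t)\<close> has norm at most \<open>d / 2\<close>, so the whole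
    parallelogram stays in the neighbourhood.\<close>
  define h where "h = d / 4"
  have h: "h > 0" using d by (simp add: h_def)
  have near: "z + s *\<^sub>R u + t *\<^sub>R v \<in>
      {y. y \<in> S \<and> \<bar>?DD u v y - ?DD u v z\<bar> < \<epsilon> \<and> \<bar>?DD v u y - ?DD v u z\<bar> < \<epsilon>}"
    if "0 \<le> s" "s \<le> h" "0 \<le> t" "t \<le> h" for s t
  proof -
    have "norm (s, t) \<le> norm s + norm t" by (rule norm_Pair_le)
    also have "\<dots> < d" using that d by (simp add: h_def)
    finally show ?thesis using dd[of "(s, t)"] by simp
  qed
  have key: "\<exists>s t. 0 \<le> s \<and> s \<le> h \<and> 0 \<le> t \<and> t \<le> h \<and>
      f (z + h *\<^sub>R p + h *\<^sub>R q) - f (z + h *\<^sub>R p) - f (z + h *\<^sub>R q) + f z = h\<^sup>2 * ?DD p q (z + s *\<^sub>R p + t *\<^sub>R q)"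
    if inS: "\<And>s t. 0 \<le> s \<Longrightarrow> s \<le> h \<Longrightarrow> 0 \<le> t \<Longrightarrow> t \<le> h \<Longrightarrow> z + s *\<^sub>R p + t *\<^sub>R q \<in> S" for p q
  proof -
    have line: "((\<lambda>s. F (a + s *\<^sub>R p)) has_real_derivative frechet_derivative F (at (a + s *\<^sub>R p)) p) (at s)"
      if "smooth_on S F" "a + s *\<^sub>R p \<in> S" for F :: "'a \<Rightarrow> real" and a p s
    proof -
      have "((\<lambda>s. a + s *\<^sub>R p) has_derivative (\<lambda>s. s *\<^sub>R p)) (at s)"
        by (auto intro!: derivative_eq_intros)
      from has_derivative_compose[OF this smooth_on_has_derivative[OF S(1) that]]
      have "((\<lambda>s. F (a + s *\<^sub>R p)) has_derivative (\<lambda>t. frechet_derivative F (at (a + s *\<^sub>R p)) (t *\<^sub>R p))) (at s)" .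
      moreover have "(\<lambda>t. frechet_derivative F (at (a + s *\<^sub>R p)) (t *\<^sub>R p))
          = (*) (frechet_derivative F (at (a + s *\<^sub>R p)) p)"
        using linear_cmul[OF linear_frechet_derivative[OF smooth_on_imp_differentiable[OF S(1) that]]]
        by (auto simp: mult.commute)
      ultimately show ?thesis by (simp add: has_field_derivative_def)
    qed
    \<comment> \<open>The second difference is \<open>\<phi> h - \<phi> 0\<close>. The mean value
      theorem is applied along \<open>p\<close>, and then along \<open>q\<close> to the resulting
      difference of first derivatives.\<close>
    define \<phi> where "\<phi> = (\<lambda>s. f ((z + h *\<^sub>R q) + s *\<^sub>R p) - f (z + s *\<^sub>R p))"
    have i1: "(z + h *\<^sub>R q) + s *\<^sub>R p \<in> S" "z + s *\<^sub>R p \<in> S" if "0 \<le> s" "s \<le> h" for s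
      using inS[of s h] inS[of s 0] that h by (simp_all add: algebra_simps)
    have "(\<phi> has_real_derivative (?D p ((z + h *\<^sub>R q) + s *\<^sub>R p) - ?D p (z + s *\<^sub>R p))) (at s)"
      if "0 \<le> s" "s \<le> h" for s
      unfolding \<phi>_def using i1[OF that] by (intro DERIV_diff line S(2))
    from MVT2[OF h this] obtain s where s: "0 < s" "s < h"
      "\<phi> h - \<phi> 0 = (h - 0) * (?D p ((z + h *\<^sub>R q) + s *\<^sub>R p) - ?D p (z + s *\<^sub>R p))" by blast
    have "((\<lambda>t. ?D p ((z + s *\<^sub>R p) + t *\<^sub>R q)) has_real_derivative
        ?DD p q ((z + s *\<^sub>R p) + t *\<^sub>R q)) (at t)" if "0 \<le> t" "t \<le> h" for t
      using inS[of s t] s that by (intro line smooth_on_deriv S(2)) auto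
    from MVT2[OF h this] obtain t where t: "0 < t" "t < h"
      "?D p ((z + s *\<^sub>R p) + h *\<^sub>R q) - ?D p ((z + s *\<^sub>R p) + 0 *\<^sub>R q) = (h - 0) * ?DD p q ((z + s *\<^sub>R p) + t *\<^sub>R q)"
      by blast
    have comm: "(z + h *\<^sub>R q) + s *\<^sub>R p = (z + s *\<^sub>R p) + h *\<^sub>R q" by simp
    have "\<phi> h - \<phi> 0 = h * (h * ?DD p q ((z + s *\<^sub>R p) + t *\<^sub>R q))"
      using s(3) t(3) unfolding comm by simp
    then have "f (z + h *\<^sub>R p + h *\<^sub>R q) - f (z + h *\<^sub>R p) - f (z + h *\<^sub>R q) + f z = h\<^sup>2 * ?DD p q (z + s *\<^sub>R p + t *\<^sub>R q)"
      by (simp add: \<phi>_def power2_eq_square algebra_simps)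
    then show ?thesis using s t by (intro exI[of _ s] exI[of _ t]) auto
  qed
  obtain s t where dual_index: "0 \<le> s" "s \<le> h" "0 \<le> t" "t \<le> h"
    "f (z + h *\<^sub>R u + h *\<^sub>R v) - f (z + h *\<^sub>R u) - f (z + h *\<^sub>R v) + f z = h\<^sup>2 * ?DD u v (z + s *\<^sub>R u + t *\<^sub>R v)"
    using key[of u v] near by blast
  have "z + s *\<^sub>R v + t *\<^sub>R u = z + t *\<^sub>R u + s *\<^sub>R v" for s t by simp
  then obtain s' t' where st': "0 \<le> s'" "s' \<le> h" "0 \<le> t'" "t' \<le> h"
    "f (z + h *\<^sub>R v + h *\<^sub>R u) - f (z + h *\<^sub>R v) - f (z + h *\<^sub>R u) + f z = h\<^sup>2 * ?DD v u (z + t' *\<^sub>R u + s' *\<^sub>R v)"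
    using key[of v u] near by (smt (verit) mem_Collect_eq)
  have comm: "z + h *\<^sub>R v + h *\<^sub>R u = z + h *\<^sub>R u + h *\<^sub>R v" by simp
  have "h\<^sup>2 * ?DD u v (z + s *\<^sub>R u + t *\<^sub>R v) = h\<^sup>2 * ?DD v u (z + t' *\<^sub>R u + s' *\<^sub>R v)"
    using dual_index(5) st'(5) unfolding comm by linarith
  then have "?DD u v (z + s *\<^sub>R u + t *\<^sub>R v) = ?DD v u (z + t' *\<^sub>R u + s' *\<^sub>R v)"
    using h by simp
  moreover have "\<bar>?DD u v (z + s *\<^sub>R u + t *\<^sub>R v) - ?DD u v z\<bar> < \<epsilon>"
    "\<bar>?DD v u (z + t' *\<^sub>R u + s' *\<^sub>R v) - ?DD v u z\<bar> < \<epsilon>"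
    using near dual_index(1-4) st'(1-4) by auto
  moreover have "\<bar>a - b\<bar> \<le> \<bar>c - a\<bar> + \<bar>c - b\<bar>" for a b c :: real by arith
  note this[of "?DD u v z" "?DD v u z" "?DD u v (z + s *\<^sub>R u + t *\<^sub>R v)"]
  ultimately show False using \<epsilon>_def by simp
qed

lemma Schwarz:
  fixes f :: "'a::euclidean_space \<Rightarrow> 'b::euclidean_space"
  assumes S: "open S" "smooth_on S f" "z \<in> S"
  shows "frechet_derivative (\<lambda>y. frechet_derivative f (at y) u) (at z) v
       = frechet_derivative (\<lambda>y. frechet_derivative f (at y) v) (at z) u"
proof (rule euclidean_eqI)
  fix b :: 'b
  have d: "frechet_derivative (\<lambda>y. h y \<bullet> b) (at y) u = frechet_derivative h (at y) u \<bullet> b"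
    if "smooth_on S h" "y \<in> S" for h :: "'a \<Rightarrow> 'b" and y u
    using frechet_derivative_eqI[OF has_derivative_inner_left[OF smooth_on_has_derivative[OF S(1) that]]]
    by simp
  have "frechet_derivative (\<lambda>y. frechet_derivative f (at y) u) (at z) v \<bullet> b
      = frechet_derivative (\<lambda>y. frechet_derivative (\<lambda>y. f y \<bullet> b) (at y) u) (at z) v" for u v
  proof -
    have "((\<lambda>y. frechet_derivative f (at y) u \<bullet> b) has_derivative
        (\<lambda>v. frechet_derivative (\<lambda>y. frechet_derivative f (at y) u) (at z) v \<bullet> b)) (at z)"
      by (intro has_derivative_inner_left smooth_on_has_derivative[OF S(1) _ S(3)] smooth_on_deriv S(2))
    from has_derivative_transform_within_open[OF this S(1,3)]
    have "((\<lambda>y. frechet_derivative (\<lambda>y. f y \<bullet> b) (at y) u) has_derivative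
        (\<lambda>v. frechet_derivative (\<lambda>y. frechet_derivative f (at y) u) (at z) v \<bullet> b)) (at z)"
      using d[OF S(2)] by simp
    then show ?thesis by (simp add: frechet_derivative_eqI)
  qed
  moreover have "smooth_on S (\<lambda>y. f y \<bullet> b)"
    by (intro smooth_intros S)
  ultimately show "frechet_derivative (\<lambda>y. frechet_derivative f (at y) u) (at z) v \<bullet> b
      = frechet_derivative (\<lambda>y. frechet_derivative f (at y) v) (at z) u \<bullet> b"
    using Schwarz_real[OF S(1) _ S(3), of "\<lambda>y. f y \<bullet> b" u v] by simp
qed

section \<open>Smoothness of matrix operations\<close>

lemma smooth_on_mult_vec [smooth_intros]:
  fixes M :: "'a::real_normed_vector \<Rightarrow> real^'n^'m"
  shows "open S \<Longrightarrow> smooth_on S M \<Longrightarrow> smooth_on S u \<Longrightarrow> smooth_on S (\<lambda>x. M x *v u x)"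
  unfolding matrix_vector_mult_def by (intro smooth_intros)

lemma smooth_on_mult_matrix [smooth_intros]:
  fixes M :: "'a::real_normed_vector \<Rightarrow> real^'n^'m" and N :: "'a \<Rightarrow> real^'k^'n"
  shows "open S \<Longrightarrow> smooth_on S M \<Longrightarrow> smooth_on S N \<Longrightarrow> smooth_on S (\<lambda>x. M x ** N x)"
  unfolding matrix_matrix_mult_def by (intro smooth_intros)

lemma smooth_on_det [smooth_intros]:
  fixes M :: "'a::real_normed_vector \<Rightarrow> real^'n^'n"
  shows "open S \<Longrightarrow> smooth_on S M \<Longrightarrow> smooth_on S (\<lambda>x. det (M x))"
  unfolding det_def by (intro smooth_intros smooth_on_prod)

text \<open>Cramer's rule makes every entry of the inverse a quotient of determinants, hence a
  rational function of the entries with nonvanishing denominator.\<close>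

lemma smooth_on_matrix_inv:
  fixes M :: "'a::real_normed_vector \<Rightarrow> mat4"
  assumes S: "open S" "smooth_on S M" and inv: "\<And>x. x \<in> S \<Longrightarrow> invertible (M x)"
  shows "smooth_on S (\<lambda>x. matrix_inv (M x))"
proof -
  have "matrix_inv (M x) $ k $ l
      = det (\<chi> i j. if j = k then axis l 1 $ i else M x $ i $ j) / det (M x)"
    if "x \<in> S" for x k l
  proof -
    have "M x *v (matrix_inv (M x) *v axis l 1) = axis l 1"
      by (simp add: matrix_vector_mul_assoc matrix_inv_inverse(2)[OF inv[OF that]])
    then have "matrix_inv (M x) *v axis l 1
        = (\<chi> k. det (\<chi> i j. if j = k then axis l 1 $ i else M x $ i $ j) / det (M x))"
      using cramer[of "M x"] inv[OF that] by (simp add: invertible_det_nz)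
    then show ?thesis
      by (simp add: matrix_vector_mult_basis column_def vec_eq_iff)
  qed
  then have "matrix_inv (M x)
      = (\<chi> k l. det (\<chi> i j. if j = k then axis l 1 $ i else M x $ i $ j) / det (M x))"
    if "x \<in> S" for x
    using that by (simp add: vec_eq_iff)
  moreover have "smooth_on S (\<lambda>x. if j = k then c else M x $ i $ j)" for i j k :: 4 and c :: real
    using S by (cases "j = k") (auto intro!: smooth_intros)
  then have "smooth_on S (\<lambda>x. \<chi> k l. det (\<chi> i j. if j = k then axis l 1 $ i else M x $ i $ j) / det (M x))"
    using inv by (intro smooth_intros S) (auto simp: invertible_det_nz)
  ultimately show ?thesis
    by (subst smooth_on_cong[OF S(1)]) auto
qed

lemma smooth_on_bil [smooth_intros]:
  "open S \<Longrightarrow> smooth_on S M \<Longrightarrow> smooth_on S u \<Longrightarrow> smooth_on S v \<Longrightarrow> smooth_on S (\<lambda>x. bil (M x) (u x) (v x))"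
  unfolding bil_def by (intro smooth_intros)

section \<open>The Levi-Civita connection of an adapted frame\<close>

lemma bil_linear:
  "bil M (u + v) w = bil M u w + bil M v w" "bil M u (v + w) = bil M u v + bil M u w"
  "bil M (u - v) w = bil M u w - bil M v w" "bil M u (v - w) = bil M u v - bil M u w"
  "bil M (r *\<^sub>R u) w = r * bil M u w" "bil M u (r *\<^sub>R w) = r * bil M u w"
  "bil M 0 w = 0" "bil M u 0 = 0" "bil M (- u) w = - bil M u w" "bil M u (- w) = - bil M u w"
  by (simp_all add: bil_def inner_simps matrix_vector_right_distrib matrix_vector_mult_diff_distrib
      matrix_vector_mult_scaleR linear_neg[OF matrix_vector_mul_linear])

lemma bil_sum: "bil M u w = (\<Sum>i\<in>UNIV. \<Sum>j\<in>UNIV. u $ i * M $ i $ j * w $ j)"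
  by (simp add: bil_def inner_vec_def matrix_vector_mult_def sum_distrib_left mult.assoc)

lemma vec_axis_sum: "(u::vec4) = (\<Sum>i\<in>UNIV. u $ i *\<^sub>R axis i 1)"
  by (simp add: vec_eq_iff forall_4 sum_4 axis_def)

lemma has_derivative_bil:
  assumes "(M has_derivative M') (at z)" "(u has_derivative u') (at z)" "(v has_derivative v') (at z)"
  shows "((\<lambda>z. bil (M z) (u z) (v z)) has_derivative
    (\<lambda>h. bil (M' h) (u z) (v z) + bil (M z) (u' h) (v z) + bil (M z) (u z) (v' h))) (at z)"
proof -
  have nth: "((\<lambda>z. f z $ i) has_derivative (\<lambda>h. f' h $ i)) (at z)"
    if "(f has_derivative f') (at z)" for f :: "'a \<Rightarrow> 'b::real_normed_vector^4" and f' i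
    using bounded_linear.has_derivative[OF bounded_linear_vec_nth that] .
  have "((\<lambda>z. \<Sum>i\<in>UNIV. \<Sum>j\<in>UNIV. u z $ i * M z $ i $ j * v z $ j) has_derivative
    (\<lambda>h. \<Sum>i\<in>UNIV. \<Sum>j\<in>UNIV. u z $ i * M z $ i $ j * v' h $ j
       + (u z $ i * M' h $ i $ j + u' h $ i * M z $ i $ j) * v z $ j)) (at z)"
    by (intro has_derivative_sum has_derivative_mult nth assms)
  then show ?thesis
    by (simp add: bil_sum sum.distrib algebra_simps)
qed

text \<open>The pointwise algebra of the structure is carried by the frame; beyond smoothness, the
  closedness of \<open>Om\<close> is the only condition involving derivatives.\<close>

locale adapted_chart =
  fixes G Om :: "vec4 \<Rightarrow> mat4" and V :: "vec4 set" and e :: "vec4 \<Rightarrow> mat4"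
  assumes smooth_G: "smooth_on V G" and smooth_Om: "smooth_on V Om"
    and closed_Om: "closed_form2 V Om" and adapted: "adapted_frame G Om V e"
begin

section \<open>Metric algebra of an adapted frame\<close>

lemma open_V: "open V" and smooth_e: "smooth_on V e"
  using adapted by (auto simp: adapted_frame_def)

lemma invertible_e: "x \<in> V \<Longrightarrow> invertible (e x)"
  and g_om: "x \<in> V \<Longrightarrow> bil (G x) u v = om e x 1 u * om e x 3 v + om e x 3 u * om e x 1 v
                         + om e x 2 u * om e x 4 v + om e x 4 u * om e x 2 v"
  and Om_om: "x \<in> V \<Longrightarrow> bil (Om x) u v = om e x 1 u * om e x 3 v - om e x 3 u * om e x 1 v
                         + om e x 2 u * om e x 4 v - om e x 4 u * om e x 2 v"
  using adapted unfolding adapted_frame_def by blast+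

lemma om_e: "x \<in> V \<Longrightarrow> om e x i (e x $ j) = (if i = j then 1 else 0)"
  by (rule om_frame(1)) (rule invertible_e)

lemma g_sym: "x \<in> V \<Longrightarrow> bil (G x) u v = bil (G x) v u"
  by (simp add: g_om)

lemma Om_antisym: "x \<in> V \<Longrightarrow> bil (Om x) u v = - bil (Om x) v u"
  by (simp add: Om_om)

lemma g_frame:
  assumes "x \<in> V"
  shows "bil (G x) (e x $ 1) (e x $ 1) = 0" "bil (G x) (e x $ 1) (e x $ 2) = 0"
    "bil (G x) (e x $ 1) (e x $ 3) = 1" "bil (G x) (e x $ 1) (e x $ 4) = 0"
    "bil (G x) (e x $ 2) (e x $ 1) = 0" "bil (G x) (e x $ 2) (e x $ 2) = 0"
    "bil (G x) (e x $ 2) (e x $ 3) = 0" "bil (G x) (e x $ 2) (e x $ 4) = 1"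
    "bil (G x) (e x $ 3) (e x $ 1) = 1" "bil (G x) (e x $ 3) (e x $ 2) = 0"
    "bil (G x) (e x $ 3) (e x $ 3) = 0" "bil (G x) (e x $ 3) (e x $ 4) = 0"
    "bil (G x) (e x $ 4) (e x $ 1) = 0" "bil (G x) (e x $ 4) (e x $ 2) = 1"
    "bil (G x) (e x $ 4) (e x $ 3) = 0" "bil (G x) (e x $ 4) (e x $ 4) = 0"
  by (simp_all add: g_om om_e assms)

text \<open>The coframe is metrically dual to the frame, with partners 1, 3 and 2, 4 interchanged.
  This allows \<open>om\<close> to be replaced by pairings with \<open>g\<close>, to which metric
  compatibility applies.\<close>

lemma om_g:
  assumes "x \<in> V"
  shows "om e x 1 u = bil (G x) u (e x $ 3)" "om e x 2 u = bil (G x) u (e x $ 4)"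
    "om e x 3 u = bil (G x) u (e x $ 1)" "om e x 4 u = bil (G x) u (e x $ 2)"
  by (simp_all add: g_om om_e assms)

lemma expand:
  assumes "x \<in> V"
  shows "u = bil (G x) u (e x $ 3) *\<^sub>R e x $ 1 + bil (G x) u (e x $ 4) *\<^sub>R e x $ 2
    + bil (G x) u (e x $ 1) *\<^sub>R e x $ 3 + bil (G x) u (e x $ 2) *\<^sub>R e x $ 4"
  using vec4_expand[where e = e, OF invertible_e[OF assms], of u] by (simp only: om_g[OF assms])

lemma g_nondegenerate:
  assumes "x \<in> V" "\<And>w. bil (G x) w u = bil (G x) w v"
  shows "u = v"
  using expand[OF assms(1), of u] expand[OF assms(1), of v] assms(2) g_sym[OF assms(1)] by metis

text \<open>The inverse metric is the same symmetric product of frame vectors as \<open>g\<close> is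
  of the coframe. The explicit formula gives smooth Christoffel symbols and turns index raising into
  frame contractions.\<close>

lemma G_inverse:
  assumes "x \<in> V"
  shows "matrix_inv (G x) = (\<chi> i j. e x $ 1 $ i * e x $ 3 $ j + e x $ 3 $ i * e x $ 1 $ j
      + e x $ 2 $ i * e x $ 4 $ j + e x $ 4 $ i * e x $ 2 $ j)" (is "_ = ?H")
    and "matrix_inv (G x) ** G x = mat 1" "G x ** matrix_inv (G x) = mat 1"
proof -
  have H: "?H *v p = (e x $ 3 \<bullet> p) *\<^sub>R e x $ 1 + (e x $ 4 \<bullet> p) *\<^sub>R e x $ 2
      + (e x $ 1 \<bullet> p) *\<^sub>R e x $ 3 + (e x $ 2 \<bullet> p) *\<^sub>R e x $ 4" for p
    by (simp add: vec_eq_iff matrix_vector_mult_def inner_vec_def sum_4 algebra_simps)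
  have "?H *v (G x *v u) = u" for u
    using expand[OF assms, of u] g_sym[OF assms, of u] unfolding H by (simp add: bil_def)
  then have "(?H ** G x) *v u = mat 1 *v u" for u
    by (simp add: matrix_vector_mul_assoc[symmetric])
  then have HG: "?H ** G x = mat 1" by (simp add: matrix_eq)
  then have "invertible (G x)" by (simp add: invertible_left_inverse) blast
  note i = matrix_inv_inverse[OF this]
  show "matrix_inv (G x) ** G x = mat 1" "G x ** matrix_inv (G x) = mat 1" by (fact i)+
  have "?H = ?H ** (G x ** matrix_inv (G x))" by (simp add: i)
  also have "\<dots> = matrix_inv (G x)" by (simp add: matrix_mul_assoc HG)
  finally show "matrix_inv (G x) = ?H" by simp
qed

lemma smooth_frame: "smooth_on V (\<lambda>x. e x $ i)"
  by (intro smooth_intros smooth_e open_V)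

section \<open>The Levi-Civita connection as a bilinear map\<close>

abbreviation DG :: "vec4 \<Rightarrow> vec4 \<Rightarrow> mat4" where
  "DG x \<equiv> frechet_derivative G (at x)"

lemma DG: "x \<in> V \<Longrightarrow> (G has_derivative DG x) (at x)"
  by (rule smooth_on_has_derivative[OF open_V smooth_G])

lemma DG_sym:
  assumes "x \<in> V"
  shows "bil (DG x u) v w = bil (DG x u) w v"
proof -
  have d: "((\<lambda>y. bil (G y) v w) has_derivative (\<lambda>u. bil (DG x u) v w)) (at x)" for v w
    using has_derivative_bil[OF DG[OF assms] has_derivative_const has_derivative_const, of v w]
    by (simp add: bil_linear)
  have "(\<lambda>u. bil (DG x u) v w) = (\<lambda>u. bil (DG x u) w v)"
    by (rule has_derivative_unique[OF has_derivative_transform_within_open[OF d open_V assms g_sym] d])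
  then show ?thesis by (rule fun_cong)
qed

lemma partial_G: "x \<in> V \<Longrightarrow> partial i (\<lambda>y. G y $ j $ l) x = DG x (axis i 1) $ j $ l"
  unfolding partial_def
  by (subst frechet_derivative_eqI[OF bounded_linear.has_derivative[OF bounded_linear_vec_nth
          bounded_linear.has_derivative[OF bounded_linear_vec_nth DG]]]) auto

text \<open>Koszul's formula for vector fields with constant coefficients, whose brackets vanish.
  Together with \<open>g_nondegenerate\<close> it characterises \<open>gamma_op\<close> without
  index sums.\<close>

lemma Koszul:
  assumes "x \<in> V"
  shows "bil (G x) w (gamma_op G x u v)
    = (bil (DG x u) v w + bil (DG x v) u w - bil (DG x w) u v) / 2"
proof -
  let ?A = "\<lambda>i j l. DG x (axis i 1) $ j $ l"
  \<comment> \<open>The covector of Christoffel symbols of the first kind contracted with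
    \<open>u\<close> and \<open>v\<close>; raising its index gives \<open>gamma_op\<close>.\<close>
  define \<kappa> :: vec4 where
    "\<kappa> = (\<chi> l. (1/2) * (\<Sum>i\<in>UNIV. \<Sum>j\<in>UNIV. u $ i * v $ j * (?A i j l + ?A j i l - ?A l i j)))"
  have "gamma_op G x u v = matrix_inv (G x) *v \<kappa>"
    unfolding gamma_op_def christoffel_def partial_G[OF assms] matrix_vector_mult_def \<kappa>_def vec_eq_iff
    by (simp add: sum_4 algebra_simps)
  then have "bil (G x) w (gamma_op G x u v) = w \<bullet> \<kappa>"
    by (simp add: bil_def matrix_vector_mul_assoc G_inverse(3) assms)
  moreover have D: "bil (DG x u) v w = (\<Sum>i\<in>UNIV. \<Sum>j\<in>UNIV. \<Sum>l\<in>UNIV. u $ i * v $ j * w $ l * ?A i j l)" for u v w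
  proof -
    interpret linear "DG x" using DG[OF assms] by (rule has_derivative_linear)
    have "DG x u = (\<Sum>i\<in>UNIV. u $ i *\<^sub>R DG x (axis i 1))"
      by (subst vec_axis_sum[of u]) (simp add: sum scale)
    then show ?thesis by (simp add: bil_sum sum_4 algebra_simps)
  qed
  moreover have "w \<bullet> \<kappa> = (bil (DG x u) v w + bil (DG x v) u w - bil (DG x w) u v) / 2"
  proof -
    have "2 * (w \<bullet> \<kappa>) = (\<Sum>l\<in>UNIV. \<Sum>i\<in>UNIV. \<Sum>j\<in>UNIV. u $ i * v $ j * w $ l * ?A i j l)
      + (\<Sum>l\<in>UNIV. \<Sum>i\<in>UNIV. \<Sum>j\<in>UNIV. v $ j * u $ i * w $ l * ?A j i l)
      - (\<Sum>l\<in>UNIV. \<Sum>i\<in>UNIV. \<Sum>j\<in>UNIV. w $ l * u $ i * v $ j * ?A l i j)"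
      by (simp add: \<kappa>_def inner_vec_def sum_distrib_left sum.distrib sum_subtractf algebra_simps)
    also have "(\<Sum>l\<in>UNIV. \<Sum>i\<in>UNIV. \<Sum>j\<in>UNIV. u $ i * v $ j * w $ l * ?A i j l) = bil (DG x u) v w"
      unfolding D by (subst sum.swap, rule sum.cong[OF refl], rule sum.swap)
    also have "(\<Sum>l\<in>UNIV. \<Sum>i\<in>UNIV. \<Sum>j\<in>UNIV. v $ j * u $ i * w $ l * ?A j i l) = bil (DG x v) u w"
      unfolding D by (subst (2) sum.swap, subst sum.swap, rule sum.cong[OF refl], rule sum.swap)
    also have "(\<Sum>l\<in>UNIV. \<Sum>i\<in>UNIV. \<Sum>j\<in>UNIV. w $ l * u $ i * v $ j * ?A l i j) = bil (DG x w) u v"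
      unfolding D by (rule refl)
    finally show ?thesis by simp
  qed
  ultimately show ?thesis by simp
qed

lemma gamma_linear:
  "gamma_op G x (u + u') v = gamma_op G x u v + gamma_op G x u' v"
  "gamma_op G x v (u + u') = gamma_op G x v u + gamma_op G x v u'"
  "gamma_op G x (r *\<^sub>R u) v = r *\<^sub>R gamma_op G x u v"
  "gamma_op G x v (r *\<^sub>R u) = r *\<^sub>R gamma_op G x v u"
  by (simp_all add: gamma_op_def vec_eq_iff sum.distrib sum_distrib_left algebra_simps)

lemma gamma_linear':
  "gamma_op G x (- u) v = - gamma_op G x u v" "gamma_op G x v (- u) = - gamma_op G x v u"
  "gamma_op G x (u - u') v = gamma_op G x u v - gamma_op G x u' v"
  "gamma_op G x v (u - u') = gamma_op G x v u - gamma_op G x v u'"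
  "gamma_op G x 0 v = 0" "gamma_op G x v 0 = 0"
proof -
  show m: "gamma_op G x (- u) v = - gamma_op G x u v" "gamma_op G x v (- u) = - gamma_op G x v u" for u v
    using gamma_linear(3)[of x "-1" u v] gamma_linear(4)[of x v "-1" u] by simp_all
  show "gamma_op G x (u - u') v = gamma_op G x u v - gamma_op G x u' v"
    using gamma_linear(1)[of x u "-u'" v] m(1)[of u' v] by simp
  show "gamma_op G x v (u - u') = gamma_op G x v u - gamma_op G x v u'"
    using gamma_linear(2)[of x v u "-u'"] m(2)[of v u'] by simp
  show "gamma_op G x 0 v = 0" "gamma_op G x v 0 = 0"
    using gamma_linear(3)[of x 0 0 v] gamma_linear(4)[of x v 0 0] by simp_all
qed

lemma gamma_sym: "x \<in> V \<Longrightarrow> gamma_op G x u v = gamma_op G x v u"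
proof (rule g_nondegenerate)
  fix w assume x: "x \<in> V"
  show "bil (G x) w (gamma_op G x u v) = bil (G x) w (gamma_op G x v u)"
    unfolding Koszul[OF x] DG_sym[OF x, of w v u] by simp
qed

lemma metric_compatible:
  assumes "x \<in> V"
  shows "bil (DG x u) v w = bil (G x) (gamma_op G x u v) w + bil (G x) v (gamma_op G x u w)"
proof -
  have "bil (G x) (gamma_op G x u v) w = (bil (DG x u) v w + bil (DG x v) u w - bil (DG x w) u v) / 2"
    unfolding g_sym[OF assms, of _ w] by (rule Koszul[OF assms])
  moreover have "bil (G x) v (gamma_op G x u w) = (bil (DG x u) v w + bil (DG x w) u v - bil (DG x v) u w) / 2"
    unfolding Koszul[OF assms] DG_sym[OF assms, of u w v] by (rule refl)
  ultimately show ?thesis by simp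
qed

lemma smooth_christoffel [smooth_intros]: "smooth_on V (\<lambda>x. christoffel G x k i j)"
proof -
  have "smooth_on V (\<lambda>x. (1/2) * (\<Sum>l\<in>UNIV. (e x $ 1 $ k * e x $ 3 $ l + e x $ 3 $ k * e x $ 1 $ l
      + e x $ 2 $ k * e x $ 4 $ l + e x $ 4 $ k * e x $ 2 $ l) *
     (DG x (axis i 1) $ j $ l + DG x (axis j 1) $ i $ l - DG x (axis l 1) $ i $ j)))"
    by (intro smooth_intros smooth_on_deriv smooth_G smooth_e open_V)
  then show ?thesis
    by (rule smooth_on_cong[OF open_V, THEN iffD1, rotated])
      (simp add: christoffel_def partial_G G_inverse)
qed

lemma smooth_gamma [smooth_intros]:
  "smooth_on V u \<Longrightarrow> smooth_on V v \<Longrightarrow> smooth_on V (\<lambda>x. gamma_op G x (u x) (v x))"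
  unfolding gamma_op_def by (intro smooth_intros open_V)

definition DGam :: "vec4 \<Rightarrow> vec4 \<Rightarrow> vec4 \<Rightarrow> vec4 \<Rightarrow> vec4" where
  "DGam x a u v = frechet_derivative (\<lambda>y. gamma_op G y u v) (at x) a"

lemma DGam: "x \<in> V \<Longrightarrow> ((\<lambda>y. gamma_op G y u v) has_derivative (\<lambda>a. DGam x a u v)) (at x)"
  unfolding DGam_def by (intro smooth_on_has_derivative[OF open_V] smooth_gamma smooth_on_const)

lemma gamma_expand:
  "gamma_op G x u v = (\<Sum>i\<in>UNIV. \<Sum>j\<in>UNIV. (u $ i * v $ j) *\<^sub>R gamma_op G x (axis i 1) (axis j 1))"
  by (subst vec_axis_sum[of u], subst vec_axis_sum[of v]) (simp add: sum_4 gamma_linear scaleR_add_right ac_simps)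

lemma DGam_expand:
  assumes "x \<in> V"
  shows "DGam x a u v = (\<Sum>i\<in>UNIV. \<Sum>j\<in>UNIV. (u $ i * v $ j) *\<^sub>R DGam x a (axis i 1) (axis j 1))"
proof -
  have "((\<lambda>y. \<Sum>i\<in>UNIV. \<Sum>j\<in>UNIV. (u $ i * v $ j) *\<^sub>R gamma_op G y (axis i 1) (axis j 1)) has_derivative
      (\<lambda>a. \<Sum>i\<in>UNIV. \<Sum>j\<in>UNIV. (u $ i * v $ j) *\<^sub>R DGam x a (axis i 1) (axis j 1))) (at x)"
    by (intro has_derivative_sum has_derivative_scaleR_right DGam assms)
  then show ?thesis
    unfolding gamma_expand[symmetric]
    by (rule has_derivative_unique[OF DGam[OF assms], THEN fun_cong])
qed

lemma DGam_sym: "x \<in> V \<Longrightarrow> DGam x a u v = DGam x a v u"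
proof -
  assume x: "x \<in> V"
  have "(\<lambda>a. DGam x a u v) = (\<lambda>a. DGam x a v u)"
    by (rule has_derivative_unique[OF has_derivative_transform_within_open[OF DGam[OF x] open_V x gamma_sym] DGam[OF x]])
  then show ?thesis by (rule fun_cong)
qed

lemma gamma_has_derivative:
  fixes u v :: "vec4 \<times> real \<Rightarrow> vec4"
  assumes "fst z \<in> V" "(u has_derivative u') (at z)" "(v has_derivative v') (at z)"
  shows "((\<lambda>z. gamma_op G (fst z) (u z) (v z)) has_derivative
    (\<lambda>h. DGam (fst z) (fst h) (u z) (v z) + gamma_op G (fst z) (u' h) (v z)
       + gamma_op G (fst z) (u z) (v' h))) (at z)"
proof -
  have nth: "((\<lambda>z. f z $ i) has_derivative (\<lambda>h. f' h $ i)) (at z)"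
    if "(f has_derivative f') (at z)" for f :: "vec4 \<times> real \<Rightarrow> vec4" and f' i
    using bounded_linear.has_derivative[OF bounded_linear_vec_nth that] .
  have c: "((\<lambda>z. gamma_op G (fst z) p q) has_derivative (\<lambda>h. DGam (fst z) (fst h) p q)) (at z)" for p q
    using has_derivative_compose[OF bounded_linear_imp_has_derivative[OF bounded_linear_fst] DGam[OF assms(1)]] .
  have "((\<lambda>z. \<Sum>i\<in>UNIV. \<Sum>j\<in>UNIV. (u z $ i * v z $ j) *\<^sub>R gamma_op G (fst z) (axis i 1) (axis j 1)) has_derivative
    (\<lambda>h. \<Sum>i\<in>UNIV. \<Sum>j\<in>UNIV. (u z $ i * v z $ j) *\<^sub>R DGam (fst z) (fst h) (axis i 1) (axis j 1)
        + (u z $ i * v' h $ j + u' h $ i * v z $ j) *\<^sub>R gamma_op G (fst z) (axis i 1) (axis j 1))) (at z)"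
    by (intro has_derivative_sum has_derivative_scaleR has_derivative_mult nth assms c)
  moreover have "(\<Sum>i\<in>UNIV. \<Sum>j\<in>UNIV. (u z $ i * v z $ j) *\<^sub>R DGam (fst z) (fst h) (axis i 1) (axis j 1)
        + (u z $ i * v' h $ j + u' h $ i * v z $ j) *\<^sub>R gamma_op G (fst z) (axis i 1) (axis j 1))
    = DGam (fst z) (fst h) (u z) (v z) + gamma_op G (fst z) (u' h) (v z) + gamma_op G (fst z) (u z) (v' h)" for h
    unfolding DGam_expand[OF assms(1), of _ "u z"] gamma_expand[of _ "u' h"] gamma_expand[of _ "u z"]
    by (simp add: sum.distrib scaleR_add_left)
  ultimately show ?thesis
    unfolding gamma_expand[symmetric] by simp
qed

section \<open>Curvature of the pulled-back connection\<close>

definition Rm :: "vec4 \<Rightarrow> vec4 \<Rightarrow> vec4 \<Rightarrow> vec4 \<Rightarrow> vec4" where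
  "Rm x u v w = DGam x u v w - DGam x v u w
     + gamma_op G x u (gamma_op G x v w) - gamma_op G x v (gamma_op G x u w)"

text \<open>The covariant derivative on the pull-back of the tangent bundle along
  \<open>V \<times> UNIV \<rightarrow> V\<close>. The fibre coordinate is differentiated flatly: the
  connection term sees only the base component of the direction.\<close>

definition cov :: "(vec4 \<times> real \<Rightarrow> vec4) \<Rightarrow> vec4 \<times> real \<Rightarrow> vec4 \<times> real \<Rightarrow> vec4" where
  "cov s z \<xi> = frechet_derivative s (at z) \<xi> + gamma_op G (fst z) (fst \<xi>) (s z)"

lemma cov_zero: "s differentiable (at z) \<Longrightarrow> cov s z 0 = 0"
  by (simp add: cov_def gamma_linear' linear_0 linear_frechet_derivative)

lemma open_W: "open (V \<times> (UNIV :: real set))"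
  by (simp add: open_Times open_V)

lemma g_has_derivative:
  assumes "fst z \<in> V" "a differentiable (at z)" "b differentiable (at z)"
  shows "((\<lambda>y. bil (G (fst y)) (a y) (b y)) has_derivative
    (\<lambda>\<xi>. bil (G (fst z)) (cov a z \<xi>) (b z) + bil (G (fst z)) (a z) (cov b z \<xi>))) (at z)"
proof -
  have "((\<lambda>y. G (fst y)) has_derivative (\<lambda>h. DG (fst z) (fst h))) (at z)"
    using has_derivative_compose[OF bounded_linear_imp_has_derivative[OF bounded_linear_fst] DG[OF assms(1)]] .
  from has_derivative_bil[OF this assms(2,3)[unfolded frechet_derivative_works]]
  show ?thesis
    by (simp add: cov_def metric_compatible[OF assms(1)] bil_linear algebra_simps)
qed

lemma cov_has_derivative:
  assumes "smooth_on (V \<times> UNIV) s" "fst z \<in> V" "(Y has_derivative Y') (at z)"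
  shows "((\<lambda>y. cov s y (Y y)) has_derivative (\<lambda>h.
      frechet_derivative s (at z) (Y' h)
      + frechet_derivative (\<lambda>y. frechet_derivative s (at y) (Y z)) (at z) h
      + (DGam (fst z) (fst h) (fst (Y z)) (s z) + gamma_op G (fst z) (fst (Y' h)) (s z)
        + gamma_op G (fst z) (fst (Y z)) (frechet_derivative s (at z) h)))) (at z)"
  unfolding cov_def
  using assms(2,3)
  by (intro has_derivative_add has_derivative_deriv_along[OF open_W assms(1)] gamma_has_derivative
      has_derivative_fst smooth_on_has_derivative[OF open_W assms(1)]) (auto simp: mem_Times_iff)

text \<open>Ricci identity for the pulled-back connection: the second derivatives of
  \<open>s\<close> cancel by symmetry, the derivatives of \<open>X\<close> and \<open>Y\<close>
  assemble into the bracket, and the curvature term depends on base components alone.\<close>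

lemma curvature:
  assumes "smooth_on (V \<times> UNIV) s" "fst z \<in> V" "X differentiable (at z)" "Y differentiable (at z)"
  shows "cov (\<lambda>y. cov s y (Y y)) z (X z) - cov (\<lambda>y. cov s y (X y)) z (Y z)
    = cov s z (lie_bracket X Y z) + Rm (fst z) (fst (X z)) (fst (Y z)) (s z)"
proof -
  have z: "z \<in> V \<times> UNIV" using assms(2) by (simp add: mem_Times_iff)
  note X = assms(3)[unfolded frechet_derivative_works] and Y = assms(4)[unfolded frechet_derivative_works]
  interpret s: linear "frechet_derivative s (at z)"
    using linear_frechet_derivative[OF smooth_on_imp_differentiable[OF open_W assms(1) z]] .
  show ?thesis
    unfolding cov_def[of "\<lambda>y. cov s y (Y y)"] cov_def[of "\<lambda>y. cov s y (X y)"]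
      frechet_derivative_eqI[OF cov_has_derivative[OF assms(1,2) X]]
      frechet_derivative_eqI[OF cov_has_derivative[OF assms(1,2) Y]]
      Schwarz[OF open_W assms(1) z, of "X z" "Y z"]
    by (simp add: cov_def Rm_def lie_bracket_def s.diff gamma_linear gamma_linear' algebra_simps)
qed

lemma DGam_linear:
  assumes "x \<in> V"
  shows "DGam x (a + b) u v = DGam x a u v + DGam x b u v"
    "DGam x a (u + w) v = DGam x a u v + DGam x a w v"
    "DGam x a u (v + w) = DGam x a u v + DGam x a u w"
    "DGam x (r *\<^sub>R a) u v = r *\<^sub>R DGam x a u v"
    "DGam x a (r *\<^sub>R u) v = r *\<^sub>R DGam x a u v"
    "DGam x a u (r *\<^sub>R v) = r *\<^sub>R DGam x a u v"
proof -
  interpret linear "\<lambda>a. DGam x a u v" using DGam[OF assms] by (rule has_derivative_linear)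
  show "DGam x (a + b) u v = DGam x a u v + DGam x b u v" "DGam x (r *\<^sub>R a) u v = r *\<^sub>R DGam x a u v"
    by (simp_all add: add scale)
qed (unfold DGam_expand[OF assms, of a "_ + _"] DGam_expand[OF assms, of a _ "_ + _"] DGam_expand[OF assms, of a u v]
    DGam_expand[OF assms, of a u w] DGam_expand[OF assms, of a w v]
    DGam_expand[OF assms, of a "_ *\<^sub>R _"] DGam_expand[OF assms, of a _ "_ *\<^sub>R _"],
    simp_all add: algebra_simps sum.distrib scaleR_sum_right)

lemma Rm_linear:
  assumes "x \<in> V"
  shows "Rm x (a + b) u v = Rm x a u v + Rm x b u v"
    "Rm x a (u + w) v = Rm x a u v + Rm x a w v"
    "Rm x a u (v + w) = Rm x a u v + Rm x a u w"
    "Rm x (r *\<^sub>R a) u v = r *\<^sub>R Rm x a u v"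
    "Rm x a (r *\<^sub>R u) v = r *\<^sub>R Rm x a u v"
    "Rm x a u (r *\<^sub>R v) = r *\<^sub>R Rm x a u v"
  by (simp_all add: Rm_def DGam_linear[OF assms] gamma_linear algebra_simps)

lemma Rm_antisym: "Rm x v u w = - Rm x u v w"
  by (simp add: Rm_def)

lemma Bianchi:
  assumes "x \<in> V"
  shows "Rm x u v w + Rm x v w u + Rm x w u v = 0"
  using DGam_sym[OF assms, of u v w] DGam_sym[OF assms, of v u w] DGam_sym[OF assms, of w u v]
    gamma_sym[OF assms, of u v] gamma_sym[OF assms, of u w] gamma_sym[OF assms, of v w]
  by (simp add: Rm_def)

text \<open>For constant \<open>w\<close>, \<open>p\<close> the second derivatives of
  \<open>g(w, p)\<close> commute. Metric compatibility expands them twice; the products of first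
  covariant derivatives cancel on antisymmetrising, and since constant fields have zero bracket, the
  rest is curvature.\<close>

lemma Rm_skew:
  assumes "x \<in> V"
  shows "bil (G x) (Rm x u v w) p + bil (G x) w (Rm x u v p) = 0"
proof -
  define z where "z = (x, 0::real)"
  have z: "fst z \<in> V" "z \<in> V \<times> UNIV" using assms by (simp_all add: z_def)
  let ?c = "\<lambda>q b y. cov (\<lambda>_. q) y (b, 0)"
  let ?f = "\<lambda>y::vec4 \<times> real. bil (G (fst y)) w p"
  have sm: "smooth_on (V \<times> UNIV) (\<lambda>y::vec4 \<times> real. q)" for q :: vec4 by (rule smooth_on_const)
  have dc: "?c q b differentiable (at z)" for q b
    using cov_has_derivative[OF sm z(1) has_derivative_const] differentiable_def by blast
  have smf: "smooth_on (V \<times> UNIV) ?f"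
    by (intro smooth_intros open_W smooth_on_compose_linear[OF open_V open_W bounded_linear_fst _ smooth_G]) auto
  have f1: "frechet_derivative ?f (at y) (b, 0) = bil (G (fst y)) (?c w b y) p + bil (G (fst y)) w (?c p b y)"
    if "y \<in> V \<times> UNIV" for y b
    using that by (subst frechet_derivative_eqI[OF g_has_derivative]) auto
  have f2: "frechet_derivative (\<lambda>y. frechet_derivative ?f (at y) (b, 0)) (at z) (a, 0)
      = bil (G x) (cov (?c w b) z (a, 0)) p + bil (G x) (?c w b z) (?c p a z)
      + (bil (G x) (?c w a z) (?c p b z) + bil (G x) w (cov (?c p b) z (a, 0)))" for a b
  proof -
    have "((\<lambda>y. bil (G (fst y)) (?c w b y) p + bil (G (fst y)) w (?c p b y)) has_derivative
      (\<lambda>\<xi>. (bil (G (fst z)) (cov (?c w b) z \<xi>) p + bil (G (fst z)) (?c w b z) (cov (\<lambda>_. p) z \<xi>))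
         + (bil (G (fst z)) (cov (\<lambda>_. w) z \<xi>) (?c p b z) + bil (G (fst z)) w (cov (?c p b) z \<xi>)))) (at z)"
      by (intro has_derivative_add g_has_derivative z dc) simp_all
    from has_derivative_transform_within_open[OF this open_W z(2) f1[symmetric]]
    show ?thesis by (subst frechet_derivative_eqI) (auto simp: z_def)
  qed
  have lb: "lie_bracket (\<lambda>_. X) (\<lambda>_. Y) z = 0" for X Y :: "vec4 \<times> real"
    by (simp add: lie_bracket_def)
  have cu: "cov (?c q b) z (a, 0) - cov (?c q a) z (b, 0) = Rm x a b q" for q a b
    using curvature[OF sm z(1), of "\<lambda>_. (a, 0)" "\<lambda>_. (b, 0)" q]
    unfolding lb cov_zero[OF differentiable_const] by (simp add: z_def)
  have "bil (G x) (cov (?c w v) z (u, 0)) p + bil (G x) w (cov (?c p v) z (u, 0))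
      = bil (G x) (cov (?c w u) z (v, 0)) p + bil (G x) w (cov (?c p u) z (v, 0))"
    using Schwarz[OF open_W smf z(2), of "(u, 0)" "(v, 0)"] unfolding f2 by linarith
  then show ?thesis unfolding cu[symmetric] bil_linear by linarith
qed

text \<open>Differentiating the two vanishing pairings crosswise and inserting
  \<open>curvature\<close>. The sections are kept general because both the pair
  \<open>l_minus\<close>, \<open>l_plus\<close> and the pair \<open>e\<^sub>3\<close>,
  \<open>e\<^sub>4\<close> are needed.\<close>

lemma connection_form_curvature:
  assumes s: "smooth_on (V \<times> UNIV) s" and t: "smooth_on (V \<times> UNIV) t"
    and U: "open U" "U \<subseteq> V \<times> UNIV" "z \<in> U"
    and X: "X differentiable (at z)" and Y: "Y differentiable (at z)"
    and 0: "\<And>y. y \<in> U \<Longrightarrow> bil (G (fst y)) (cov s y (X y)) (t y) = 0"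
      "\<And>y. y \<in> U \<Longrightarrow> bil (G (fst y)) (cov s y (Y y)) (t y) = 0"
  shows "bil (G (fst z)) (cov s z (lie_bracket X Y z)) (t z)
      + bil (G (fst z)) (Rm (fst z) (fst (X z)) (fst (Y z)) (s z)) (t z)
    = bil (G (fst z)) (cov s z (X z)) (cov t z (Y z)) - bil (G (fst z)) (cov s z (Y z)) (cov t z (X z))"
proof -
  have z: "fst z \<in> V" "z \<in> V \<times> UNIV" using U by (auto simp: mem_Times_iff)
  have *: "bil (G (fst z)) (cov (\<lambda>y. cov s y (Z y)) z \<xi>) (t z) + bil (G (fst z)) (cov s z (Z z)) (cov t z \<xi>) = 0"
    if Z: "Z differentiable (at z)" and 0: "\<And>y. y \<in> U \<Longrightarrow> bil (G (fst y)) (cov s y (Z y)) (t y) = 0" for Z \<xi>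
  proof -
    have "(\<lambda>y. cov s y (Z y)) differentiable (at z)"
      using cov_has_derivative[OF s z(1) Z[unfolded frechet_derivative_works]] differentiable_def by blast
    from g_has_derivative[OF z(1) this smooth_on_imp_differentiable[OF open_W t z(2)]]
    have "((\<lambda>y. bil (G (fst y)) (cov s y (Z y)) (t y)) has_derivative
      (\<lambda>\<xi>. bil (G (fst z)) (cov (\<lambda>y. cov s y (Z y)) z \<xi>) (t z) + bil (G (fst z)) (cov s z (Z z)) (cov t z \<xi>))) (at z)" .
    from has_derivative_transform_within_open[OF this U(1,3) 0]
    have "((\<lambda>y. 0) has_derivative
      (\<lambda>\<xi>. bil (G (fst z)) (cov (\<lambda>y. cov s y (Z y)) z \<xi>) (t z) + bil (G (fst z)) (cov s z (Z z)) (cov t z \<xi>))) (at z)" .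
    from has_derivative_unique[OF this has_derivative_const] show ?thesis by (rule fun_cong)
  qed
  from *[OF X 0(1), of "Y z"] *[OF Y 0(2), of "X z"] show ?thesis
    using arg_cong[OF curvature[OF s z(1) X Y], of "\<lambda>w. bil (G (fst z)) w (t z)"]
    by (simp add: bil_linear)
qed

text \<open>Torsion-freeness writes the base component of the bracket as a difference of covariant
  derivatives of base components. Orthogonality to \<open>t\<close> on the open set \<open>U\<close>
  then moves these derivatives onto \<open>t\<close>.\<close>

lemma section_bracket:
  assumes t: "t differentiable (at z)"
    and U: "open U" "U \<subseteq> V \<times> UNIV" "z \<in> U"
    and X: "X differentiable (at z)" and Y: "Y differentiable (at z)"
    and 0: "\<And>y. y \<in> U \<Longrightarrow> bil (G (fst y)) (fst (X y)) (t y) = 0"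
      "\<And>y. y \<in> U \<Longrightarrow> bil (G (fst y)) (fst (Y y)) (t y) = 0"
  shows "bil (G (fst z)) (fst (lie_bracket X Y z)) (t z)
    = bil (G (fst z)) (fst (X z)) (cov t z (Y z)) - bil (G (fst z)) (fst (Y z)) (cov t z (X z))"
proof -
  have z: "fst z \<in> V" using U by (auto simp: mem_Times_iff)
  have *: "bil (G (fst z)) (cov (\<lambda>y. fst (Z y)) z \<xi>) (t z) + bil (G (fst z)) (fst (Z z)) (cov t z \<xi>) = 0"
    and **: "frechet_derivative (\<lambda>y. fst (Z y)) (at z) \<xi> = fst (frechet_derivative Z (at z) \<xi>)"
    if Z: "Z differentiable (at z)" and 0: "\<And>y. y \<in> U \<Longrightarrow> bil (G (fst y)) (fst (Z y)) (t y) = 0" for Z :: "vec4 \<times> real \<Rightarrow> vec4 \<times> real" and \<xi>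
  proof -
    have d: "((\<lambda>y. fst (Z y)) has_derivative (\<lambda>\<xi>. fst (frechet_derivative Z (at z) \<xi>))) (at z)"
      using Z by (intro has_derivative_fst) (simp flip: frechet_derivative_works)
    then have "(\<lambda>y. fst (Z y)) differentiable (at z)" by (auto simp: differentiable_def)
    from has_derivative_transform_within_open[OF g_has_derivative[OF z this t] U(1,3) 0]
    have "((\<lambda>y. 0) has_derivative
      (\<lambda>\<xi>. bil (G (fst z)) (cov (\<lambda>y. fst (Z y)) z \<xi>) (t z) + bil (G (fst z)) (fst (Z z)) (cov t z \<xi>))) (at z)" .
    from has_derivative_unique[OF this has_derivative_const]
    show "bil (G (fst z)) (cov (\<lambda>y. fst (Z y)) z \<xi>) (t z) + bil (G (fst z)) (fst (Z z)) (cov t z \<xi>) = 0"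
      by (rule fun_cong)
    show "frechet_derivative (\<lambda>y. fst (Z y)) (at z) \<xi> = fst (frechet_derivative Z (at z) \<xi>)"
      by (simp add: frechet_derivative_eqI[OF d])
  qed
  have dX: "frechet_derivative (\<lambda>y. fst (X y)) (at z) \<xi> = fst (frechet_derivative X (at z) \<xi>)" for \<xi>
    by (rule **[OF X 0(1)])
  have dY: "frechet_derivative (\<lambda>y. fst (Y y)) (at z) \<xi> = fst (frechet_derivative Y (at z) \<xi>)" for \<xi>
    by (rule **[OF Y 0(2)])
  show ?thesis
    using *[OF X 0(1), of "Y z"] *[OF Y 0(2), of "X z"]
    unfolding cov_def[of "\<lambda>y. fst (X y)"] cov_def[of "\<lambda>y. fst (Y y)"] dX dY
      gamma_sym[OF z, of "fst (Y z)" "fst (X z)"]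
    by (simp add: lie_bracket_def bil_linear)
qed

section \<open>Covariant derivatives of the frame and the obstruction on
  \<open>L\<^sub>+\<close>\<close>

definition cov_e :: "vec4 \<Rightarrow> 4 \<Rightarrow> vec4 \<Rightarrow> vec4" where
  "cov_e x i u = frechet_derivative (\<lambda>y. e y $ i) (at x) u + gamma_op G x u (e x $ i)"

lemma frame_has_derivative:
  "x \<in> V \<Longrightarrow> ((\<lambda>y. e y $ i) has_derivative frechet_derivative (\<lambda>y. e y $ i) (at x)) (at x)"
  by (rule smooth_on_has_derivative[OF open_V smooth_frame])

lemma frame_fst_has_derivative:
  "fst z \<in> V \<Longrightarrow> ((\<lambda>y. e (fst y) $ i) has_derivative
     (\<lambda>\<xi>. frechet_derivative (\<lambda>y. e y $ i) (at (fst z)) (fst \<xi>))) (at z)"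
  using has_derivative_compose[OF bounded_linear_imp_has_derivative[OF bounded_linear_fst] frame_has_derivative] .

lemma frame_fst_differentiable:
  "fst z \<in> V \<Longrightarrow> (\<lambda>y. e (fst y) $ i) differentiable (at z)"
  using frame_fst_has_derivative differentiable_def by blast

lemma smooth_frame_fst: "smooth_on (V \<times> UNIV) (\<lambda>y::vec4 \<times> real. e (fst y) $ i)"
  by (rule smooth_on_compose_linear[OF open_V open_W bounded_linear_fst _ smooth_frame]) auto

lemma cov_frame: "fst z \<in> V \<Longrightarrow> cov (\<lambda>y. e (fst y) $ i) z \<xi> = cov_e (fst z) i (fst \<xi>)"
  by (simp add: cov_def cov_e_def frechet_derivative_eqI[OF frame_fst_has_derivative])

lemma cov_e_linear:
  assumes "x \<in> V"
  shows "cov_e x i (u + v) = cov_e x i u + cov_e x i v" "cov_e x i (r *\<^sub>R u) = r *\<^sub>R cov_e x i u"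
proof -
  interpret linear "frechet_derivative (\<lambda>y. e y $ i) (at x)"
    using frame_has_derivative[OF assms] by (rule has_derivative_linear)
  show "cov_e x i (u + v) = cov_e x i u + cov_e x i v" "cov_e x i (r *\<^sub>R u) = r *\<^sub>R cov_e x i u"
    by (simp_all add: cov_e_def add scale gamma_linear scaleR_add_right)
qed

text \<open>The products \<open>g(e\<^sub>i, e\<^sub>j)\<close> are constant on \<open>V\<close>, so
  the matrix of connection forms is skew with respect to \<open>g\<close>.\<close>

lemma cov_e_skew:
  assumes "x \<in> V"
  shows "bil (G x) (cov_e x i u) (e x $ j) + bil (G x) (e x $ i) (cov_e x j u) = 0"
proof -
  let ?z = "(x, 0::real)"
  have z: "fst ?z \<in> V" "?z \<in> V \<times> UNIV" using assms by auto
  have "bil (G y) (e y $ i) (e y $ j) = bil (G x) (e x $ i) (e x $ j)" if "y \<in> V" for y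
    using that assms by (simp add: g_om om_e)
  then have "bil (G (fst y)) (e (fst y) $ i) (e (fst y) $ j) = bil (G x) (e x $ i) (e x $ j)"
    if "y \<in> V \<times> UNIV" for y :: "vec4 \<times> real" using that by (auto simp: mem_Times_iff)
  from has_derivative_transform_within_open[OF
      g_has_derivative[OF z(1) frame_fst_differentiable[OF z(1)] frame_fst_differentiable[OF z(1)]] open_W z(2) this]
  have "((\<lambda>y. bil (G x) (e x $ i) (e x $ j)) has_derivative
    (\<lambda>\<xi>. bil (G (fst ?z)) (cov (\<lambda>y. e (fst y) $ i) ?z \<xi>) (e (fst ?z) $ j)
     + bil (G (fst ?z)) (e (fst ?z) $ i) (cov (\<lambda>y. e (fst y) $ j) ?z \<xi>))) (at ?z)" .
  from fun_cong[OF has_derivative_unique[OF this has_derivative_const], of "(u, 0)"]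
  show ?thesis using cov_frame[OF z(1)] by simp
qed

text \<open>The connection coefficient measuring to what extent \<open>L\<^sub>+\<close> fails to be parallel.\<close>

definition tau_form :: "vec4 \<Rightarrow> vec4 \<Rightarrow> real" where
  "tau_form x u = bil (G x) (cov_e x 3 u) (e x $ 4)"

lemma tau_form_linear:
  assumes "x \<in> V"
  shows "tau_form x (u + v) = tau_form x u + tau_form x v" "tau_form x (r *\<^sub>R u) = r * tau_form x u"
  by (simp_all add: tau_form_def cov_e_linear[OF assms] bil_linear)

text \<open>Pairing with \<open>L\<^sub>+\<close> reads off the \<open>L\<^sub>-\<close> part of
  \<nabla> on \<open>L\<^sub>+\<close>. By skewness this is a skew 2 by 2 matrix of forms, so
  \<open>tau_form\<close> is its only entry.\<close>

lemma cov_e_L_plus: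
  assumes "x \<in> V"
  shows "bil (G x) (cov_e x 3 u) (e x $ 3) = 0" "bil (G x) (cov_e x 4 u) (e x $ 4) = 0"
    "bil (G x) (cov_e x 4 u) (e x $ 3) = - tau_form x u"
  using cov_e_skew[OF assms, of 3 u 3] cov_e_skew[OF assms, of 4 u 4] cov_e_skew[OF assms, of 3 u 4]
    g_sym[OF assms, of "e x $ 3" "cov_e x 3 u"] g_sym[OF assms, of "e x $ 4" "cov_e x 4 u"]
    g_sym[OF assms, of "e x $ 3" "cov_e x 4 u"]
  by (simp_all add: tau_form_def)

text \<open>This is \<open>\<Omega>(u, v) = g(u, J v)\<close> on the eigenvectors of
  \<open>J\<close>.\<close>

lemma Om_g:
  assumes "x \<in> V"
  shows "bil (Om x) u (e x $ 1) = - bil (G x) u (e x $ 1)" "bil (Om x) u (e x $ 2) = - bil (G x) u (e x $ 2)"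
    "bil (Om x) u (e x $ 3) = bil (G x) u (e x $ 3)" "bil (Om x) u (e x $ 4) = bil (G x) u (e x $ 4)"
  by (simp_all add: g_om[OF assms] Om_om[OF assms] om_e[OF assms])

text \<open>Closedness is evaluated on \<open>e\<^sub>k, e\<^sub>3, e\<^sub>4\<close>, with ordinary
  derivatives exchanged for covariant ones. The eigenvalues of \<open>J\<close> turn \<Omega> into
  \<open>g\<close> up to sign; the terms differentiated along \<open>e\<^sub>3\<close> and
  \<open>e\<^sub>4\<close> cancel by skewness, and twice \<open>tau_form x (e x $ k)\<close> is
  left.\<close>

lemma tau_form_L_minus:
  assumes x: "x \<in> V" and k: "k = 1 \<or> k = 2"
  shows "tau_form x (e x $ k) = 0"
proof -
  let ?E = "\<lambda>i. e x $ i" and ?D = "\<lambda>u. frechet_derivative Om (at x) u"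
  have D: "bil (?D u) (?E i) (?E j) = bil (Om x) (gamma_op G x u (?E i)) (?E j)
      + bil (Om x) (?E i) (gamma_op G x u (?E j))
      - bil (Om x) (cov_e x i u) (?E j) - bil (Om x) (?E i) (cov_e x j u)" for u i j
  proof -
    have "bil (Om y) (e y $ i) (e y $ j) = bil (Om x) (?E i) (?E j)" if "y \<in> V" for y
      using that x by (simp add: Om_om om_e)
    from has_derivative_transform_within_open[OF
      has_derivative_bil[OF smooth_on_has_derivative[OF open_V smooth_Om x] frame_has_derivative[OF x]
        frame_has_derivative[OF x]] open_V x this]
    have "((\<lambda>y. bil (Om x) (?E i) (?E j)) has_derivative (\<lambda>u. bil (?D u) (?E i) (?E j)
       + bil (Om x) (frechet_derivative (\<lambda>y. e y $ i) (at x) u) (?E j)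
       + bil (Om x) (?E i) (frechet_derivative (\<lambda>y. e y $ j) (at x) u))) (at x)" .
    from fun_cong[OF has_derivative_unique[OF this has_derivative_const], of u]
    show ?thesis by (simp add: cov_e_def bil_linear)
  qed
  have "bil (?D (?E k)) (?E 3) (?E 4) + bil (?D (?E 3)) (?E 4) (?E k) + bil (?D (?E 4)) (?E k) (?E 3) = 0"
    using closed_Om x unfolding closed_form2_def by blast
  \<comment> \<open>The connection terms drop out of the cyclic sum because \<open>gamma_op\<close>
    is symmetric and \<open>Om\<close> antisymmetric.\<close>
  then have "bil (Om x) (cov_e x 3 (?E k)) (?E 4) + bil (Om x) (?E 3) (cov_e x 4 (?E k))
     + bil (Om x) (cov_e x 4 (?E 3)) (?E k) + bil (Om x) (?E 4) (cov_e x k (?E 3))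
     + bil (Om x) (cov_e x k (?E 4)) (?E 3) + bil (Om x) (?E k) (cov_e x 3 (?E 4)) = 0"
    unfolding D
    using gamma_sym[OF x, of "?E k" "?E 3"] gamma_sym[OF x, of "?E k" "?E 4"] gamma_sym[OF x, of "?E 3" "?E 4"]
      Om_antisym[OF x, of "?E 3" "gamma_op G x (?E k) (?E 4)"]
      Om_antisym[OF x, of "?E 4" "gamma_op G x (?E k) (?E 3)"]
      Om_antisym[OF x, of "?E k" "gamma_op G x (?E 3) (?E 4)"]
    by simp
  moreover have "bil (Om x) w (?E k) = - bil (G x) w (?E k)" for w
    using Om_g[OF x] k by auto
  ultimately show ?thesis
    using cov_e_L_plus(3)[OF x, of "?E k"] cov_e_skew[OF x, of 4 "?E 3" k] cov_e_skew[OF x, of k "?E 4" 3]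
      g_sym[OF x, of "?E 4" "cov_e x k (?E 3)"] g_sym[OF x, of "?E k" "cov_e x 3 (?E 4)"]
    unfolding Om_antisym[OF x, of "?E 3" "cov_e x _ _"] Om_antisym[OF x, of "?E 4" "cov_e x _ _"]
      Om_antisym[OF x, of "?E k" "cov_e x _ _"] Om_g[OF x]
    by (simp add: tau_form_def)
qed

text \<open>As \<open>\<omega>\<^sup>1 = g(\<cdot>, e\<^sub>3)\<close> and
  \<open>\<omega>\<^sup>2 = g(\<cdot>, e\<^sub>4)\<close>, torsion-freeness expresses the exterior
  derivative by covariant derivatives of \<open>e\<^sub>3\<close> or \<open>e\<^sub>4\<close>. On
  \<open>(e\<^sub>3, e\<^sub>4)\<close> one of the two resulting terms vanishes by skewness.\<close>

lemma t_minus_tau_form: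
  assumes x: "x \<in> V"
  shows "t_minus e x 1 = tau_form x (e x $ 3)" "t_minus e x 2 = tau_form x (e x $ 4)"
proof -
  have d: "frechet_derivative (\<lambda>y. om e y i v) (at x) u
      = bil (G x) (gamma_op G x u v) (e x $ j) + bil (G x) v (cov_e x j u)"
    if "i = 1 \<and> j = 3 \<or> i = 2 \<and> j = 4" for i j u v
  proof -
    have "bil (G y) v (e y $ j) = om e y i v" if "y \<in> V" for y
      using \<open>i = 1 \<and> j = 3 \<or> i = 2 \<and> j = 4\<close> om_g[OF that] by auto
    from has_derivative_transform_within_open[OF
      has_derivative_bil[OF DG[OF x] has_derivative_const frame_has_derivative[OF x]] open_V x this]
    have "((\<lambda>y. om e y i v) has_derivative (\<lambda>u. bil (DG x u) v (e x $ j) + bil (G x) 0 (e x $ j)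
      + bil (G x) v (frechet_derivative (\<lambda>y. e y $ j) (at x) u))) (at x)" .
    then show ?thesis
      by (simp add: frechet_derivative_eqI cov_e_def metric_compatible[OF x] bil_linear)
  qed
  have "d_om e x i u v = bil (G x) v (cov_e x j u) - bil (G x) u (cov_e x j v)"
    if "i = 1 \<and> j = 3 \<or> i = 2 \<and> j = 4" for i j u v
    unfolding d_om_def d[OF that] by (simp add: gamma_sym[OF x, of u v])
  from this[of 1 3] this[of 2 4]
  show "t_minus e x 1 = tau_form x (e x $ 3)" "t_minus e x 2 = tau_form x (e x $ 4)"
    using cov_e_L_plus[OF x] g_sym[OF x, of "e x $ 4"] g_sym[OF x, of "e x $ 3"]
    by (simp_all add: t_minus_def tau_form_def)
qed

text \<open>\<open>tau_minus\<close> sees \<open>tau_form\<close> on \<open>e\<^sub>3\<close> and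
  \<open>e\<^sub>4\<close>; the values on \<open>L\<^sub>-\<close> are zero by closedness.\<close>

lemma tau_form_zero_iff:
  assumes x: "x \<in> V"
  shows "(\<forall>u v. tau_minus e x u v = 0) \<longleftrightarrow> (\<forall>u. tau_form x u = 0)"
proof
  assume "\<forall>u v. tau_minus e x u v = 0"
  then have "tau_minus e x (e x $ 3) (e x $ 4) = 0" by blast
  then have 0: "tau_form x (e x $ 3) *\<^sub>R e x $ 1 + tau_form x (e x $ 4) *\<^sub>R e x $ 2 = 0"
    by (simp add: tau_minus_def om_e[OF x] t_minus_tau_form[OF x])
  have "tau_form x (e x $ 3) = 0" "tau_form x (e x $ 4) = 0"
    using arg_cong[OF 0, of "\<lambda>w. bil (G x) w (e x $ 3)"] arg_cong[OF 0, of "\<lambda>w. bil (G x) w (e x $ 4)"]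
    by (simp_all add: bil_linear g_frame[OF x])
  then show "\<forall>u. tau_form x u = 0"
    using tau_form_L_minus[OF x] by (subst expand[OF x]) (simp add: tau_form_linear[OF x])
qed (simp add: tau_minus_def t_minus_tau_form[OF x])

lemma L_plus_null:
  assumes x: "x \<in> V" and "bil (G x) u (e x $ 3) = 0" "bil (G x) u (e x $ 4) = 0"
    "bil (G x) v (e x $ 3) = 0" "bil (G x) v (e x $ 4) = 0"
  shows "bil (G x) u v = 0"
  using assms by (simp add: g_om om_e)

text \<open>Curvature preserves a parallel plane. With constant fields the bracket term is absent,
  and the quadratic terms pair two vectors of the null plane \<open>L\<^sub>+\<close>.\<close>

lemma L_plus_parallel_curvature:
  assumes tau_form: "\<And>x u. x \<in> V \<Longrightarrow> tau_form x u = 0" and x: "x \<in> V"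
  shows "bil (G x) (Rm x u v (e x $ 3)) (e x $ 4) = 0"
proof -
  let ?z = "(x, 0::real)"
  have z: "fst ?z \<in> V" "?z \<in> V \<times> UNIV" using x by auto
  have lb: "lie_bracket (\<lambda>_. X) (\<lambda>_. Y) ?z = 0" for X Y :: "vec4 \<times> real"
    by (simp add: lie_bracket_def)
  have "bil (G (fst y)) (cov (\<lambda>y. e (fst y) $ 3) y (w, 0)) (e (fst y) $ 4) = 0" if "y \<in> V \<times> UNIV" for y w
    using that tau_form[of "fst y"] cov_frame[of y] by (auto simp: tau_form_def)
  from connection_form_curvature[OF smooth_frame_fst smooth_frame_fst open_W order_refl z(2)
      differentiable_const differentiable_const this this, of u v]
  have "bil (G x) (Rm x u v (e x $ 3)) (e x $ 4)
    = bil (G x) (cov_e x 3 u) (cov_e x 4 v) - bil (G x) (cov_e x 3 v) (cov_e x 4 u)"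
    unfolding lb cov_zero[OF frame_fst_differentiable[OF z(1)]] cov_frame[OF z(1)]
    using cov_e_linear(2)[OF x, of 3 0 0] by (simp add: bil_linear)
  also have "\<dots> = 0"
    using L_plus_null[OF x, of "cov_e x 3 _" "cov_e x 4 _"] cov_e_L_plus[OF x] tau_form[OF x] by (simp add: tau_form_def)
  finally show ?thesis .
qed

section \<open>Horizontal lifts and their brackets\<close>

definition l_minus :: "vec4 \<times> real \<Rightarrow> vec4" where
  "l_minus z = e (fst z) $ 1 + snd z *\<^sub>R e (fst z) $ 2"

definition l_plus :: "vec4 \<times> real \<Rightarrow> vec4" where
  "l_plus z = snd z *\<^sub>R e (fst z) $ 3 - e (fst z) $ 4"

lemma snd_alpha_param: "snd (alpha_param e z) = span {l_minus z, l_plus z}"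
  and fst_alpha_param: "fst (alpha_param e z) = fst z"
  by (simp_all add: alpha_param_def l_minus_def l_plus_def split: prod.split)

lemma smooth_snd: "smooth_on S (snd :: vec4 \<times> real \<Rightarrow> real)"
  by (rule smooth_on_bounded_linear[OF bounded_linear_snd])

lemma smooth_l_minus: "smooth_on (V \<times> UNIV) l_minus" and smooth_l_plus: "smooth_on (V \<times> UNIV) l_plus"
  unfolding l_minus_def[abs_def] l_plus_def[abs_def]
  by (intro smooth_intros open_W smooth_frame_fst smooth_snd)+

lemma l_minus_plus_differentiable:
  assumes "fst z \<in> V"
  shows "l_minus differentiable (at z)" "l_plus differentiable (at z)"
  using smooth_on_imp_differentiable[OF open_W smooth_l_minus] smooth_on_imp_differentiable[OF open_W smooth_l_plus]
    assms by (auto simp: mem_Times_iff)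

lemma g_l_minus_plus:
  assumes "fst z \<in> V"
  shows "bil (G (fst z)) (l_minus z) (l_minus z) = 0" "bil (G (fst z)) (l_minus z) (l_plus z) = 0"
    "bil (G (fst z)) (l_plus z) (l_minus z) = 0" "bil (G (fst z)) (l_plus z) (l_plus z) = 0"
  by (simp_all add: l_minus_def l_plus_def bil_linear g_frame[OF assms])

section \<open>The null \<alpha>-planes and the scalar test for horizontality\<close>

definition alpha_plane :: "vec4 \<times> real \<Rightarrow> vec4 set" where
  "alpha_plane z = span {l_minus z, l_plus z}"

lemma alpha_plane_iff:
  assumes "fst z \<in> V"
  shows "w \<in> alpha_plane z \<longleftrightarrow> bil (G (fst z)) w (l_minus z) = 0 \<and> bil (G (fst z)) w (l_plus z) = 0"
proof
  assume "w \<in> alpha_plane z"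
  then show "bil (G (fst z)) w (l_minus z) = 0 \<and> bil (G (fst z)) w (l_plus z) = 0"
    unfolding alpha_plane_def
    by (induction rule: span_induct_alt) (auto simp: bil_linear g_l_minus_plus[OF assms])
next
  let ?b = "\<lambda>i. bil (G (fst z)) w (e (fst z) $ i)"
  assume "bil (G (fst z)) w (l_minus z) = 0 \<and> bil (G (fst z)) w (l_plus z) = 0"
  then have "?b 1 = - snd z * ?b 2" "?b 4 = snd z * ?b 3"
    by (simp_all add: l_minus_def l_plus_def bil_linear)
  then have "w = ?b 3 *\<^sub>R l_minus z - ?b 2 *\<^sub>R l_plus z"
    by (subst expand[OF assms, of w]) (simp add: l_minus_def l_plus_def algebra_simps)
  also have "\<dots> \<in> alpha_plane z"
    unfolding alpha_plane_def by (intro span_diff span_scale span_base) simp_all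
  finally show "w \<in> alpha_plane z" .
qed

lemma alpha_plane_expand:
  assumes "fst z \<in> V" "w \<in> alpha_plane z"
  shows "w = bil (G (fst z)) w (e (fst z) $ 3) *\<^sub>R l_minus z - bil (G (fst z)) w (e (fst z) $ 2) *\<^sub>R l_plus z"
proof -
  let ?b = "\<lambda>i. bil (G (fst z)) w (e (fst z) $ i)"
  have "?b 1 = - snd z * ?b 2" "?b 4 = snd z * ?b 3"
    using assms(2)[unfolded alpha_plane_iff[OF assms(1)]] by (simp_all add: l_minus_def l_plus_def bil_linear)
  then show ?thesis
    by (subst (1) expand[OF assms(1), of w]) (simp add: l_minus_def l_plus_def algebra_simps)
qed

lemma alpha_plane_null:
  assumes "fst z \<in> V" "u \<in> alpha_plane z" "v \<in> alpha_plane z"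
  shows "bil (G (fst z)) u v = 0"
  using assms(2,3)[unfolded alpha_plane_iff[OF assms(1)]]
  by (subst alpha_plane_expand[OF assms(1,3)]) (simp add: bil_linear)

lemma l_minus_plus_in: "l_minus z \<in> alpha_plane z" "l_plus z \<in> alpha_plane z"
  by (auto simp: alpha_plane_def intro: span_base)

definition conn_form :: "vec4 \<times> real \<Rightarrow> vec4 \<times> real \<Rightarrow> real" where
  "conn_form z \<xi> = bil (G (fst z)) (cov l_minus z \<xi>) (l_plus z)"

lemma cov_null:
  assumes z: "fst z \<in> V" and "s differentiable (at z)" "t differentiable (at z)"
    and 0: "\<And>y. y \<in> V \<times> UNIV \<Longrightarrow> bil (G (fst y)) (s y) (t y) = 0"
  shows "bil (G (fst z)) (cov s z \<xi>) (t z) + bil (G (fst z)) (s z) (cov t z \<xi>) = 0"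
proof -
  have "z \<in> V \<times> UNIV" using z by (simp add: mem_Times_iff)
  from has_derivative_transform_within_open[OF g_has_derivative[OF assms(1-3)] open_W this 0]
  have "((\<lambda>y. 0) has_derivative
      (\<lambda>\<xi>. bil (G (fst z)) (cov s z \<xi>) (t z) + bil (G (fst z)) (s z) (cov t z \<xi>))) (at z)" .
  from fun_cong[OF has_derivative_unique[OF this has_derivative_const]] show ?thesis .
qed

text \<open>Differentiating the null relations among \<open>l_minus\<close> and
  \<open>l_plus\<close> kills the pairing of each derivative with its own section and makes the two
  mixed pairings opposite. So \<open>conn_form\<close> is the only obstruction.\<close>

lemma cov_in_alpha_plane:
  assumes z: "fst z \<in> V" and "conn_form z \<xi> = 0"
  shows "cov l_minus z \<xi> \<in> alpha_plane z" "cov l_plus z \<xi> \<in> alpha_plane z"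
proof -
  note d = l_minus_plus_differentiable[OF z]
  have g: "bil (G (fst y)) (l_minus y) (l_minus y) = 0" "bil (G (fst y)) (l_minus y) (l_plus y) = 0"
    "bil (G (fst y)) (l_plus y) (l_plus y) = 0" if "y \<in> V \<times> UNIV" for y
    using that g_l_minus_plus[of y] by auto
  show "cov l_minus z \<xi> \<in> alpha_plane z" "cov l_plus z \<xi> \<in> alpha_plane z"
    using cov_null[OF z d(1,1) g(1), of \<xi>] cov_null[OF z d(1,2) g(2), of \<xi>] cov_null[OF z d(2,2) g(3), of \<xi>]
      g_sym[OF z, of "l_minus z"] g_sym[OF z, of "l_plus z" "cov l_plus z \<xi>"] assms(2)
    by (simp_all add: alpha_plane_iff[OF z] conn_form_def)
qed

text \<open>Necessity tests the section \<open>l_minus\<close>. For sufficiency an arbitrary section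
  \<open>s\<close> is orthogonal to \<open>l_minus\<close> and \<open>l_plus\<close>, and
  differentiating these relations moves the derivative from \<open>s\<close> to the two spanning
  sections; no regularity of coefficients of \<open>s\<close> enters.\<close>

lemma horizontal_iff:
  assumes z: "fst z \<in> V"
  shows "horizontal_vec G (V \<times> UNIV) (alpha_param e) z \<xi> \<longleftrightarrow> conn_form z \<xi> = 0"
proof
  have P: "snd (alpha_param e y) = alpha_plane y" for y
    by (simp add: snd_alpha_param alpha_plane_def)
  show "conn_form z \<xi> = 0" if "horizontal_vec G (V \<times> UNIV) (alpha_param e) z \<xi>"
  proof -
    have "cov l_minus z \<xi> \<in> alpha_plane z"
      using that l_minus_plus_in l_minus_plus_differentiable[OF z]
      unfolding horizontal_vec_def P fst_alpha_param cov_def by blast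
    then show ?thesis by (simp add: alpha_plane_iff[OF z] conn_form_def)
  qed
  assume c: "conn_form z \<xi> = 0"
  show "horizontal_vec G (V \<times> UNIV) (alpha_param e) z \<xi>"
    unfolding horizontal_vec_def P fst_alpha_param
  proof (intro allI impI)
    fix s assume s: "(\<forall>y\<in>V \<times> UNIV. s y \<in> alpha_plane y) \<and> s differentiable at z"
    have g: "bil (G (fst y)) (s y) (l_minus y) = 0" "bil (G (fst y)) (s y) (l_plus y) = 0" if "y \<in> V \<times> UNIV" for y
      using s that alpha_plane_iff[of y "s y"] by auto
    have "s z \<in> alpha_plane z" using s z by (cases z) auto
    then have "bil (G (fst z)) (s z) (cov l_minus z \<xi>) = 0" "bil (G (fst z)) (s z) (cov l_plus z \<xi>) = 0"
      using alpha_plane_null[OF z] cov_in_alpha_plane[OF z c] by auto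
    then have "cov s z \<xi> \<in> alpha_plane z"
      using cov_null[OF z _ l_minus_plus_differentiable(1)[OF z] g(1), of \<xi>]
        cov_null[OF z _ l_minus_plus_differentiable(2)[OF z] g(2), of \<xi>] s
      by (simp add: alpha_plane_iff[OF z])
    then show "frechet_derivative s (at z) \<xi> + gamma_op G (fst z) (fst \<xi>) (s z) \<in> alpha_plane z"
      by (simp add: cov_def)
  qed
qed

lemma cov_l_minus_plus:
  assumes z: "fst z \<in> V"
  shows "cov l_minus z \<xi> = cov_e (fst z) 1 (fst \<xi>) + snd z *\<^sub>R cov_e (fst z) 2 (fst \<xi>) + snd \<xi> *\<^sub>R e (fst z) $ 2"
    and "cov l_plus z \<xi> = snd z *\<^sub>R cov_e (fst z) 3 (fst \<xi>) - cov_e (fst z) 4 (fst \<xi>) + snd \<xi> *\<^sub>R e (fst z) $ 3"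
proof -
  let ?D = "\<lambda>i \<xi>. frechet_derivative (\<lambda>y. e y $ i) (at (fst z)) (fst \<xi>)"
  have "(l_minus has_derivative (\<lambda>\<xi>. ?D 1 \<xi> + (snd z *\<^sub>R ?D 2 \<xi> + snd \<xi> *\<^sub>R e (fst z) $ 2))) (at z)"
    "(l_plus has_derivative (\<lambda>\<xi>. (snd z *\<^sub>R ?D 3 \<xi> + snd \<xi> *\<^sub>R e (fst z) $ 3) - ?D 4 \<xi>)) (at z)"
    unfolding l_minus_def[abs_def] l_plus_def[abs_def]
    by (intro has_derivative_add has_derivative_diff has_derivative_scaleR frame_fst_has_derivative[OF z]
        has_derivative_snd has_derivative_ident)+
  then show "cov l_minus z \<xi> = cov_e (fst z) 1 (fst \<xi>) + snd z *\<^sub>R cov_e (fst z) 2 (fst \<xi>) + snd \<xi> *\<^sub>R e (fst z) $ 2"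
    "cov l_plus z \<xi> = snd z *\<^sub>R cov_e (fst z) 3 (fst \<xi>) - cov_e (fst z) 4 (fst \<xi>) + snd \<xi> *\<^sub>R e (fst z) $ 3"
    by (simp_all add: cov_def frechet_derivative_eqI cov_e_def l_minus_def l_plus_def gamma_linear gamma_linear' algebra_simps)
qed

text \<open>The horizontal lift of \<open>u\<close>. Since \<open>l_minus\<close> has
  \<lambda>-derivative \<open>e\<^sub>2\<close> and \<open>g(e\<^sub>2, n) = -1\<close>, the fibre
  component enters \<open>conn_form\<close> with coefficient -1; the value cancelling the rest is
  \<open>conn_form\<close> at \<open>(u z, 0)\<close>.\<close>

definition lift :: "(vec4 \<times> real \<Rightarrow> vec4) \<Rightarrow> vec4 \<times> real \<Rightarrow> vec4 \<times> real" where
  "lift u z = (u z, bil (G (fst z)) (cov l_minus z (u z, 0)) (l_plus z))"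

lemma fst_lift [simp]: "fst (lift u z) = u z"
  by (simp add: lift_def)

lemma conn_form_lift: "fst z \<in> V \<Longrightarrow> conn_form z (lift u z) = 0"
  by (simp add: conn_form_def lift_def cov_l_minus_plus bil_linear l_plus_def g_frame)

lemma smooth_gamma_fst:
  assumes "smooth_on (V \<times> UNIV) u" "smooth_on (V \<times> UNIV) v"
  shows "smooth_on (V \<times> UNIV) (\<lambda>z::vec4 \<times> real. gamma_op G (fst z) (u z) (v z))"
proof -
  have "smooth_on (V \<times> UNIV) (\<lambda>z::vec4 \<times> real. christoffel G (fst z) k i j)" for k i j
    by (rule smooth_on_compose_linear[OF open_V open_W bounded_linear_fst _ smooth_christoffel]) auto
  then show ?thesis unfolding gamma_op_def by (intro smooth_intros open_W assms)
qed

lemma smooth_lift: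
  assumes "smooth_on (V \<times> UNIV) u"
  shows "smooth_on (V \<times> UNIV) (lift u)"
proof -
  have "smooth_on (V \<times> UNIV) (\<lambda>z::vec4 \<times> real. G (fst z))"
    by (rule smooth_on_compose_linear[OF open_V open_W bounded_linear_fst _ smooth_G]) auto
  moreover have "smooth_on (V \<times> UNIV) (\<lambda>z. cov l_minus z (u z, 0))"
    unfolding cov_def fst_conv
    by (intro smooth_on_add smooth_on_deriv_along smooth_gamma_fst open_W smooth_l_minus smooth_intros assms)
  ultimately show ?thesis
    unfolding lift_def[abs_def] by (intro smooth_on_Pair smooth_on_bil open_W assms smooth_l_plus)
qed

text \<open>The quadratic terms of \<open>connection_form_curvature\<close> pair vectors of the
  \<alpha>-plane with each other and vanish, so curvature alone remains.\<close>

lemma conn_form_bracket: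
  assumes U: "open U" "U \<subseteq> V \<times> UNIV" "z \<in> U" and X: "smooth_on U X" and Y: "smooth_on U Y"
    and 0: "\<And>y. y \<in> U \<Longrightarrow> conn_form y (X y) = 0" "\<And>y. y \<in> U \<Longrightarrow> conn_form y (Y y) = 0"
  shows "conn_form z (lie_bracket X Y z) = - bil (G (fst z)) (l_plus z) (Rm (fst z) (fst (X z)) (fst (Y z)) (l_minus z))"
proof -
  have z: "fst z \<in> V" using U by auto
  have "bil (G (fst z)) (cov l_minus z (X z)) (cov l_plus z (Y z)) = 0" "bil (G (fst z)) (cov l_minus z (Y z)) (cov l_plus z (X z)) = 0"
    using alpha_plane_null[OF z] cov_in_alpha_plane[OF z] 0[OF U(3)] by auto
  then show ?thesis
    using connection_form_curvature[OF smooth_l_minus smooth_l_plus U smooth_on_imp_differentiable[OF U(1) X U(3)]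
        smooth_on_imp_differentiable[OF U(1) Y U(3)] 0[unfolded conn_form_def]]
    unfolding g_sym[OF z, of "l_plus z"] conn_form_def by simp
qed

text \<open>Along horizontal directions the derivative of \<open>l_plus\<close> stays in the
  \<alpha>-plane. A vector orthogonal to \<open>l_plus\<close> sees just its \<open>l_minus\<close>
  coefficient, which is the pairing with \<open>e\<^sub>3\<close>, namely
  \<open>tau_form\<close>.\<close>

lemma l_plus_bracket:
  assumes U: "open U" "U \<subseteq> V \<times> UNIV" "z \<in> U" and X: "smooth_on U X" and Y: "smooth_on U Y"
    and 0: "\<And>y. y \<in> U \<Longrightarrow> conn_form y (X y) = 0" "\<And>y. y \<in> U \<Longrightarrow> conn_form y (Y y) = 0"
    and n: "\<And>y. y \<in> U \<Longrightarrow> bil (G (fst y)) (fst (X y)) (l_plus y) = 0"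
      "\<And>y. y \<in> U \<Longrightarrow> bil (G (fst y)) (fst (Y y)) (l_plus y) = 0"
  shows "bil (G (fst z)) (fst (lie_bracket X Y z)) (l_plus z)
    = tau_form (fst z) (fst (Y z)) * bil (G (fst z)) (fst (X z)) (l_minus z)
    - tau_form (fst z) (fst (X z)) * bil (G (fst z)) (fst (Y z)) (l_minus z)"
proof -
  have z: "fst z \<in> V" using U by auto
  have t: "bil (G (fst z)) (cov l_plus z \<xi>) (e (fst z) $ 3) = tau_form (fst z) (fst \<xi>)" for \<xi>
    by (simp add: cov_l_minus_plus[OF z] bil_linear g_frame[OF z] cov_e_L_plus[OF z])
  have *: "bil (G (fst z)) w (cov l_plus z \<xi>) = tau_form (fst z) (fst \<xi>) * bil (G (fst z)) w (l_minus z)"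
    if "bil (G (fst z)) w (l_plus z) = 0" "conn_form z \<xi> = 0" for w \<xi>
    using that(1) by (subst alpha_plane_expand[OF z cov_in_alpha_plane(2)[OF z that(2)]]) (simp add: t bil_linear)
  have "bil (G (fst z)) (fst (lie_bracket X Y z)) (l_plus z)
    = bil (G (fst z)) (fst (X z)) (cov l_plus z (Y z)) - bil (G (fst z)) (fst (Y z)) (cov l_plus z (X z))"
    by (rule section_bracket[OF l_minus_plus_differentiable(2)[OF z] U smooth_on_imp_differentiable[OF U(1) X U(3)]
        smooth_on_imp_differentiable[OF U(1) Y U(3)] n])
  then show ?thesis
    using * n[OF U(3)] 0[OF U(3)] by simp
qed

section \<open>Integrability criteria in terms of the curvature operator\<close>

abbreviation "Lift E \<equiv> horizontal_lift G (V \<times> UNIV) (alpha_param e) E"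

lemma Lift_iff: "fst z \<in> V \<Longrightarrow> \<xi> \<in> Lift E z \<longleftrightarrow> conn_form z \<xi> = 0 \<and> fst \<xi> \<in> E (alpha_param e z)"
  by (simp add: horizontal_lift_def horizontal_iff)

lemma LiftD:
  assumes "\<forall>p\<in>U. X p \<in> Lift E p \<and> Y p \<in> Lift E p" "U \<subseteq> V \<times> UNIV" "y \<in> U"
  shows "fst y \<in> V" "conn_form y (X y) = 0" "conn_form y (Y y) = 0"
    "fst (X y) \<in> E (alpha_param e y)" "fst (Y y) \<in> E (alpha_param e y)"
proof -
  show y: "fst y \<in> V" using assms(2,3) by auto
  have "X y \<in> Lift E y" "Y y \<in> Lift E y" using assms(1,3) by auto
  then show "conn_form y (X y) = 0" "conn_form y (Y y) = 0"
    "fst (X y) \<in> E (alpha_param e y)" "fst (Y y) \<in> E (alpha_param e y)"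
    unfolding Lift_iff[OF y] by auto
qed

text \<open>The necessity half shared by all three distributions: integrability is applied to the
  lifts of two sections of the base distribution, and the fibre and base components of the bracket
  give the two conclusions.\<close>

lemma Lift_bracket_lift:
  assumes F: "frobenius_integrable_on (V \<times> UNIV) (Lift E)"
    and u: "smooth_on (V \<times> UNIV) u" and v: "smooth_on (V \<times> UNIV) v"
    and E: "\<And>z. fst z \<in> V \<Longrightarrow> u z \<in> E (alpha_param e z)" "\<And>z. fst z \<in> V \<Longrightarrow> v z \<in> E (alpha_param e z)"
    and z: "fst z \<in> V"
  shows "bil (G (fst z)) (l_plus z) (Rm (fst z) (u z) (v z) (l_minus z)) = 0"
    and "fst (lie_bracket (lift u) (lift v) z) \<in> E (alpha_param e z)"
proof -
  have zW: "z \<in> V \<times> UNIV" using z by (simp add: mem_Times_iff)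
  have L: "lift w y \<in> Lift E y" if "y \<in> V \<times> UNIV" "w y \<in> E (alpha_param e y)" for w y
  proof -
    have "fst y \<in> V" using that by auto
    then show ?thesis using that by (simp add: Lift_iff conn_form_lift)
  qed
  have "\<forall>p\<in>V \<times> UNIV. lie_bracket (lift u) (lift v) p \<in> Lift E p"
    using F[unfolded frobenius_integrable_on_def, rule_format, of "V \<times> UNIV" "lift u" "lift v"]
      open_W smooth_lift[OF u] smooth_lift[OF v] L E by (auto simp: mem_Times_iff)
  then have "lie_bracket (lift u) (lift v) z \<in> Lift E z" using zW by blast
  then have *: "conn_form z (lie_bracket (lift u) (lift v) z) = 0"
    "fst (lie_bracket (lift u) (lift v) z) \<in> E (alpha_param e z)"
    by (simp_all add: Lift_iff[OF z])
  have c: "conn_form y (lift w y) = 0" if "y \<in> V \<times> UNIV" for y w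
    using that conn_form_lift[of y] by auto
  show "bil (G (fst z)) (l_plus z) (Rm (fst z) (u z) (v z) (l_minus z)) = 0"
    using conn_form_bracket[OF open_W order_refl zW smooth_lift[OF u] smooth_lift[OF v] c c] *(1)
    by simp
  show "fst (lie_bracket (lift u) (lift v) z) \<in> E (alpha_param e z)" by (fact *(2))
qed

lemma Pi4_iff:
  "frobenius_integrable_on (V \<times> UNIV) (Lift (Pi4_base G Om)) \<longleftrightarrow>
    (\<forall>z u v. fst z \<in> V \<longrightarrow> bil (G (fst z)) (l_plus z) (Rm (fst z) u v (l_minus z)) = 0)" (is "?F \<longleftrightarrow> ?R")
proof
  have E: "w \<in> Pi4_base G Om p" for w p by (simp add: Pi4_base_def split: prod.split)
  assume ?F
  from Lift_bracket_lift(1)[OF this smooth_on_const smooth_on_const E E] show ?R by blast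
next
  assume R: ?R
  have E: "w \<in> Pi4_base G Om p" for w p by (simp add: Pi4_base_def split: prod.split)
  show ?F unfolding frobenius_integrable_on_def
  proof (intro allI impI ballI, elim conjE)
    fix U X Y z assume A: "open U" "U \<subseteq> V \<times> UNIV" "z \<in> U" "smooth_on U X" "smooth_on U Y"
      and L: "\<forall>p\<in>U. X p \<in> Lift (Pi4_base G Om) p \<and> Y p \<in> Lift (Pi4_base G Om) p"
    from conn_form_bracket[OF A LiftD(2,3)[OF L A(2)]] show "lie_bracket X Y z \<in> Lift (Pi4_base G Om) z"
      using R A(2,3) by (subst Lift_iff) (auto simp: E)
  qed
qed

lemma Pi2_base_iff: "w \<in> Pi2_base G Om (alpha_param e z) \<longleftrightarrow> w \<in> alpha_plane z"
  by (simp add: Pi2_base_def alpha_plane_def case_prod_unfold snd_alpha_param)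

text \<open>The base component imposes no condition: horizontal derivatives keep
  \<open>l_minus\<close> and \<open>l_plus\<close> in their plane, which is null. As the plane is
  two-dimensional, \<open>R(X, Y)\<close> is a multiple of \<open>R(m, n)\<close>.\<close>

lemma Pi2_iff:
  "frobenius_integrable_on (V \<times> UNIV) (Lift (Pi2_base G Om)) \<longleftrightarrow>
    (\<forall>z. fst z \<in> V \<longrightarrow> bil (G (fst z)) (l_plus z) (Rm (fst z) (l_minus z) (l_plus z) (l_minus z)) = 0)" (is "?F \<longleftrightarrow> ?R")
proof
  assume ?F
  from Lift_bracket_lift(1)[OF this smooth_l_minus smooth_l_plus] show ?R
    by (simp add: Pi2_base_iff l_minus_plus_in)
next
  assume R: ?R
  show ?F unfolding frobenius_integrable_on_def
  proof (intro allI impI ballI, elim conjE)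
    fix U X Y z assume A: "open U" "U \<subseteq> V \<times> UNIV" "z \<in> U" "smooth_on U X" "smooth_on U Y"
      and L: "\<forall>p\<in>U. X p \<in> Lift (Pi2_base G Om) p \<and> Y p \<in> Lift (Pi2_base G Om) p"
    have z: "fst z \<in> V" using A by auto
    have *: "conn_form y (X y) = 0" "conn_form y (Y y) = 0" "fst (X y) \<in> alpha_plane y" "fst (Y y) \<in> alpha_plane y"
      if "y \<in> U" for y
      using LiftD[OF L A(2) that] by (simp_all add: Pi2_base_iff)
    have g: "bil (G (fst y)) (fst (X y)) (l_minus y) = 0" "bil (G (fst y)) (fst (Y y)) (l_minus y) = 0"
      "bil (G (fst y)) (fst (X y)) (l_plus y) = 0" "bil (G (fst y)) (fst (Y y)) (l_plus y) = 0" if "y \<in> U" for y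
      using *[OF that] by (simp_all add: alpha_plane_iff[OF LiftD(1)[OF L A(2) that]])
    note d = smooth_on_imp_differentiable[OF A(1) A(4) A(3)] smooth_on_imp_differentiable[OF A(1) A(5) A(3)]
    have c: "bil (G (fst z)) w (cov s z \<xi>) = 0" if "w \<in> alpha_plane z" "conn_form z \<xi> = 0" "s = l_minus \<or> s = l_plus" for w s \<xi>
      using that(3) alpha_plane_null[OF z that(1)] cov_in_alpha_plane[OF z that(2)] by auto
    have "bil (G (fst z)) (fst (lie_bracket X Y z)) (l_minus z)
        = bil (G (fst z)) (fst (X z)) (cov l_minus z (Y z)) - bil (G (fst z)) (fst (Y z)) (cov l_minus z (X z))"
      by (rule section_bracket[OF l_minus_plus_differentiable(1)[OF z] A(1-3) d g(1,2)])
    moreover have "bil (G (fst z)) (fst (lie_bracket X Y z)) (l_plus z)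
        = bil (G (fst z)) (fst (X z)) (cov l_plus z (Y z)) - bil (G (fst z)) (fst (Y z)) (cov l_plus z (X z))"
      by (rule section_bracket[OF l_minus_plus_differentiable(2)[OF z] A(1-3) d g(3,4)])
    ultimately have "fst (lie_bracket X Y z) \<in> alpha_plane z"
      using c *[OF A(3)] by (simp add: alpha_plane_iff[OF z])
    moreover
    obtain a b where a: "fst (X z) = a *\<^sub>R l_minus z - b *\<^sub>R l_plus z" using alpha_plane_expand[OF z *(3)[OF A(3)]] by blast
    obtain a' b' where a': "fst (Y z) = a' *\<^sub>R l_minus z - b' *\<^sub>R l_plus z" using alpha_plane_expand[OF z *(4)[OF A(3)]] by blast
    have "Rm (fst z) (fst (X z)) (fst (Y z)) (l_minus z) = (b * a' - a * b') *\<^sub>R Rm (fst z) (l_minus z) (l_plus z) (l_minus z)"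
    proof -
      have l: "Rm (fst z) (p *\<^sub>R u - q *\<^sub>R v) w y = p *\<^sub>R Rm (fst z) u w y - q *\<^sub>R Rm (fst z) v w y"
        "Rm (fst z) w (p *\<^sub>R u - q *\<^sub>R v) y = p *\<^sub>R Rm (fst z) w u y - q *\<^sub>R Rm (fst z) w v y" for p q u v w y
        using Rm_linear(1)[OF z, of "p *\<^sub>R u" "(-q) *\<^sub>R v" w y] Rm_linear(2)[OF z, of w "p *\<^sub>R u" "(-q) *\<^sub>R v" y]
        by (simp_all only: Rm_linear(4,5)[OF z]) simp_all
      have "Rm (fst z) u u w = 0" for u w by (simp add: Rm_def)
      then show ?thesis
        unfolding a a' l using Rm_antisym[of "fst z" "l_plus z" "l_minus z" "l_minus z"] by (simp add: algebra_simps)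
    qed
    then have "conn_form z (lie_bracket X Y z) = 0"
      using conn_form_bracket[OF A *(1,2)] R z by (simp add: bil_linear)
    ultimately show "lie_bracket X Y z \<in> Lift (Pi2_base G Om) z"
      by (simp add: Lift_iff[OF z] Pi2_base_iff)
  qed
qed

lemma Pi3_base_iff:
  assumes z: "fst z \<in> V"
  shows "w \<in> Pi3_base G Om (alpha_param e z) \<longleftrightarrow> bil (G (fst z)) w (l_plus z) = 0"
proof -
  have P: "w \<in> Pi3_base G Om (alpha_param e z) \<longleftrightarrow>
      (\<exists>u v. w = u + v \<and> u \<in> alpha_plane z \<and> u \<in> L_minus (G (fst z)) (Om (fst z)) \<and> v \<in> L_plus (G (fst z)) (Om (fst z)))"
    by (auto simp: Pi3_base_def alpha_plane_def case_prod_unfold snd_alpha_param fst_alpha_param)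
  note L = L_adapted[OF adapted z] om_g[OF z]
  show ?thesis unfolding P
  proof
    assume "\<exists>u v. w = u + v \<and> u \<in> alpha_plane z \<and> u \<in> L_minus (G (fst z)) (Om (fst z)) \<and> v \<in> L_plus (G (fst z)) (Om (fst z))"
    then obtain u v where w: "w = u + v" and "u \<in> alpha_plane z" "v \<in> L_plus (G (fst z)) (Om (fst z))" by blast
    then show "bil (G (fst z)) w (l_plus z) = 0"
      by (simp add: L alpha_plane_iff[OF z] bil_linear l_plus_def)
  next
    assume "bil (G (fst z)) w (l_plus z) = 0"
    let ?b = "\<lambda>i. bil (G (fst z)) w (e (fst z) $ i)"
    \<comment> \<open>The coefficients of \<open>w\<close> along \<open>e\<^sub>2\<close> and
      \<open>e\<^sub>1\<close> have ratio \<lambda>, so the \<open>L\<^sub>-\<close> part of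
      \<open>w\<close> is a multiple of \<open>l_minus\<close>.\<close>
    have "?b 4 = snd z * ?b 3" using \<open>bil (G (fst z)) w (l_plus z) = 0\<close> by (simp add: l_plus_def bil_linear)
    then have "w = ?b 3 *\<^sub>R l_minus z + (?b 1 *\<^sub>R e (fst z) $ 3 + ?b 2 *\<^sub>R e (fst z) $ 4)"
      by (subst expand[OF z, of w]) (simp add: l_minus_def algebra_simps)
    moreover have "?b 3 *\<^sub>R l_minus z \<in> alpha_plane z"
      using g_l_minus_plus[OF z] by (simp add: alpha_plane_iff[OF z] bil_linear)
    moreover have "?b 3 *\<^sub>R l_minus z \<in> L_minus (G (fst z)) (Om (fst z))"
      "?b 1 *\<^sub>R e (fst z) $ 3 + ?b 2 *\<^sub>R e (fst z) $ 4 \<in> L_plus (G (fst z)) (Om (fst z))"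
      by (simp_all add: L l_minus_def bil_linear g_frame[OF z])
    ultimately show "\<exists>u v. w = u + v \<and> u \<in> alpha_plane z \<and> u \<in> L_minus (G (fst z)) (Om (fst z)) \<and> v \<in> L_plus (G (fst z)) (Om (fst z))"
      by blast
  qed
qed

text \<open>The complement of \<open>l_plus\<close> is spanned by \<open>l_minus\<close>,
  \<open>e\<^sub>3\<close>, \<open>e\<^sub>4\<close>, so three pairs of spanning vectors decide the
  condition.\<close>

lemma l_plus_perp_curvature:
  assumes z: "fst z \<in> V"
    and 0: "bil (G (fst z)) (l_plus z) (Rm (fst z) (l_minus z) (e (fst z) $ 3) (l_minus z)) = 0"
      "bil (G (fst z)) (l_plus z) (Rm (fst z) (l_minus z) (e (fst z) $ 4) (l_minus z)) = 0"
      "bil (G (fst z)) (l_plus z) (Rm (fst z) (e (fst z) $ 3) (e (fst z) $ 4) (l_minus z)) = 0"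
    and u: "bil (G (fst z)) u (l_plus z) = 0" and v: "bil (G (fst z)) v (l_plus z) = 0"
  shows "bil (G (fst z)) (l_plus z) (Rm (fst z) u v (l_minus z)) = 0"
proof -
  let ?e = "\<lambda>i z. e (fst z) $ i"
  have ex: "\<exists>a b c. w = a *\<^sub>R l_minus z + b *\<^sub>R ?e 3 z + c *\<^sub>R ?e 4 z" if "bil (G (fst z)) w (l_plus z) = 0" for w
  proof -
    let ?b = "\<lambda>i. bil (G (fst z)) w (e (fst z) $ i)"
    have "?b 4 = snd z * ?b 3" using that by (simp add: l_plus_def bil_linear)
    then have "w = ?b 3 *\<^sub>R l_minus z + ?b 1 *\<^sub>R e (fst z) $ 3 + ?b 2 *\<^sub>R e (fst z) $ 4"
      by (subst expand[OF z, of w]) (simp add: l_minus_def algebra_simps)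
    then show ?thesis by blast
  qed
  obtain a b c a' b' c' where uv: "u = a *\<^sub>R l_minus z + b *\<^sub>R ?e 3 z + c *\<^sub>R ?e 4 z"
    "v = a' *\<^sub>R l_minus z + b' *\<^sub>R ?e 3 z + c' *\<^sub>R ?e 4 z"
    using ex[OF u] ex[OF v] by blast
  have "Rm (fst z) u u w = 0" for u w by (simp add: Rm_def)
  then show ?thesis
    using 0 Rm_antisym[of "fst z" "?e 3 z" "l_minus z" "l_minus z"] Rm_antisym[of "fst z" "?e 4 z" "l_minus z" "l_minus z"]
      Rm_antisym[of "fst z" "?e 4 z" "?e 3 z" "l_minus z"]
    unfolding uv by (simp add: Rm_linear[OF z] bil_linear)
qed

lemma Pi3_iff:
  "frobenius_integrable_on (V \<times> UNIV) (Lift (Pi3_base G Om)) \<longleftrightarrow>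
    (\<forall>x\<in>V. \<forall>u. tau_form x u = 0) \<and>
    (\<forall>z u v. fst z \<in> V \<longrightarrow> bil (G (fst z)) u (l_plus z) = 0 \<longrightarrow> bil (G (fst z)) v (l_plus z) = 0 \<longrightarrow>
      bil (G (fst z)) (l_plus z) (Rm (fst z) u v (l_minus z)) = 0)" (is "?F \<longleftrightarrow> ?T \<and> ?R")
proof
  assume F: ?F
  let ?e = "\<lambda>i z. e (fst z) $ i"
  have E: "l_minus z \<in> Pi3_base G Om (alpha_param e z)" "?e 3 z \<in> Pi3_base G Om (alpha_param e z)"
      "?e 4 z \<in> Pi3_base G Om (alpha_param e z)" if "fst z \<in> V" for z
    using g_l_minus_plus[OF that] by (simp_all add: Pi3_base_iff[OF that] l_plus_def bil_linear g_frame[OF that])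
  have m3: "bil (G (fst z)) (l_plus z) (Rm (fst z) (l_minus z) (?e 3 z) (l_minus z)) = 0" if "fst z \<in> V" for z
    by (rule Lift_bracket_lift(1)[OF F smooth_l_minus smooth_frame_fst E(1,2)]) (simp_all add: that)
  have m4: "bil (G (fst z)) (l_plus z) (Rm (fst z) (l_minus z) (?e 4 z) (l_minus z)) = 0" if "fst z \<in> V" for z
    by (rule Lift_bracket_lift(1)[OF F smooth_l_minus smooth_frame_fst E(1,3)]) (simp_all add: that)
  have e34: "bil (G (fst z)) (l_plus z) (Rm (fst z) (?e 3 z) (?e 4 z) (l_minus z)) = 0" if "fst z \<in> V" for z
    by (rule Lift_bracket_lift(1)[OF F smooth_frame_fst smooth_frame_fst E(2,3)]) (simp_all add: that)
  have e34': "fst (lie_bracket (lift (?e 3)) (lift (?e 4)) z) \<in> Pi3_base G Om (alpha_param e z)" if "fst z \<in> V" for z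
    by (rule Lift_bracket_lift(2)[OF F smooth_frame_fst smooth_frame_fst E(2,3)]) (simp_all add: that)
  show "?T \<and> ?R"
  proof
    \<comment> \<open>The bracket of the lifts of \<open>e\<^sub>3\<close> and
      \<open>e\<^sub>4\<close> is tested on the whole fibre over \<open>x\<close>. Its pairing with
      \<open>l_plus\<close> is affine in \<lambda>, so the values 0 and 1 of \<lambda>
      suffice.\<close>
    have "tau_form x (e x $ 4) = l * tau_form x (e x $ 3)" if x: "x \<in> V" for x and l :: real
    proof -
      let ?z = "(x, l)"
      have z: "fst ?z \<in> V" "?z \<in> V \<times> UNIV" using x by auto
      have c: "conn_form y (lift w y) = 0" if "y \<in> V \<times> UNIV" for y w
        using that conn_form_lift[of y] by auto
      have n: "bil (G (fst y)) (fst (lift (?e i) y)) (l_plus y) = 0" if "y \<in> V \<times> UNIV" "i = 3 \<or> i = 4" for y i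
        using that g_frame[of "fst y"] by (auto simp: l_plus_def bil_linear)
      have "bil (G x) (fst (lie_bracket (lift (?e 3)) (lift (?e 4)) ?z)) (l_plus ?z) = 0"
        using e34'[OF z(1)] by (simp add: Pi3_base_iff[OF z(1)])
      then show ?thesis
        using l_plus_bracket[OF open_W order_refl z(2) smooth_lift[OF smooth_frame_fst] smooth_lift[OF smooth_frame_fst]
            c c n n, of 3 4]
        by (simp add: l_minus_def bil_linear g_frame[OF x])
    qed
    from this[of _ 0] this[of _ 1] have "tau_form x (e x $ 3) = 0" "tau_form x (e x $ 4) = 0" if "x \<in> V" for x
      using that by fastforce+
    then have "tau_form x u = 0" if "x \<in> V" for x u
      using that tau_form_L_minus[OF that] by (subst expand[OF that, of u]) (simp add: tau_form_linear[OF that])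
    then show ?T by blast
    show ?R
      using l_plus_perp_curvature m3 m4 e34 by blast
  qed
next
  assume TR: "?T \<and> ?R"
  show ?F unfolding frobenius_integrable_on_def
  proof (intro allI impI ballI, elim conjE)
    fix U X Y z assume A: "open U" "U \<subseteq> V \<times> UNIV" "z \<in> U" "smooth_on U X" "smooth_on U Y"
      and L: "\<forall>p\<in>U. X p \<in> Lift (Pi3_base G Om) p \<and> Y p \<in> Lift (Pi3_base G Om) p"
    have z: "fst z \<in> V" using A by auto
    have *: "conn_form y (X y) = 0" "conn_form y (Y y) = 0" "bil (G (fst y)) (fst (X y)) (l_plus y) = 0"
       "bil (G (fst y)) (fst (Y y)) (l_plus y) = 0"
      if "y \<in> U" for y
      using LiftD[OF L A(2) that] by (simp_all add: Pi3_base_iff)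
    have "bil (G (fst z)) (fst (lie_bracket X Y z)) (l_plus z) = 0"
      using l_plus_bracket[OF A *] TR z by simp
    moreover have "conn_form z (lie_bracket X Y z) = 0"
      using conn_form_bracket[OF A *(1,2)] TR *(3,4)[OF A(3)] z by simp
    ultimately show "lie_bracket X Y z \<in> Lift (Pi3_base G Om) z"
      by (simp add: Lift_iff[OF z] Pi3_base_iff[OF z])
  qed
qed

end

section \<open>Curvature tensors in a null frame\<close>

text \<open>The indices refer to a null frame with \<open>g(e\<^sub>1, e\<^sub>3) = g(e\<^sub>2, e\<^sub>4) = 1\<close>.\<close>

definition null_metric :: "4 \<Rightarrow> 4 \<Rightarrow> real" where
  "null_metric i j = (if i = 1 \<and> j = 3 \<or> i = 3 \<and> j = 1 \<or> i = 2 \<and> j = 4 \<or> i = 4 \<and> j = 2 then 1 else 0)"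

lemma null_metric_simps: "null_metric 1 1 = 0" "null_metric 1 2 = 0" "null_metric 1 3 = 1" "null_metric 1 4 = 0" "null_metric 2 1 = 0" "null_metric 2 2 = 0" "null_metric 2 3 = 0" "null_metric 2 4 = 1"
  "null_metric 3 1 = 1" "null_metric 3 2 = 0" "null_metric 3 3 = 0" "null_metric 3 4 = 0" "null_metric 4 1 = 0" "null_metric 4 2 = 1" "null_metric 4 3 = 0" "null_metric 4 4 = 0"
  by (simp_all add: null_metric_def)

text \<open>Algebraic curvature tensors on a single tangent space. Component identities become
  linear relations between numbers, within reach of simplification and linear arithmetic.\<close>

locale null_frame_curvature =
  fixes r :: "4 \<Rightarrow> 4 \<Rightarrow> 4 \<Rightarrow> 4 \<Rightarrow> real"
  assumes antisym_left: "r j i k l = - r i j k l"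
    and antisym_right: "r i j l k = - r i j k l"
    and cyclic: "r i j k l + r i k l j + r i l j k = 0"
begin

text \<open>The classical octahedron argument: four cyclic identities combined with both
  antisymmetries.\<close>

lemma pair_sym: "r k l i j = r i j k l"
proof -
  have c: "r i j k l + r i k l j + r i l j k = 0" for i j k l by (rule cyclic)
  show ?thesis
    using c[of i j k l] c[of j k l i] c[of k l i j] c[of l i j k]
      antisym_left[of i j k l] antisym_left[of k l i j] antisym_left[of i k l j] antisym_left[of j l k i]
      antisym_left[of i l j k] antisym_left[of j k i l]
      antisym_right[of k i l j] antisym_right[of i k l j] antisym_right[of j l i k] antisym_right[of l i j k] antisym_right[of i l j k] antisym_right[of j k l i]
      antisym_right[of i j k l] antisym_right[of l k i j] antisym_right[of j i k l] antisym_right[of k l i j]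
      antisym_left[of k l j i] antisym_left[of i j l k] antisym_left[of i k j l] antisym_left[of j l i k]
      antisym_left[of i l k j] antisym_left[of j k l i]
    by linarith
qed

lemma diagonal: "r i i k l = 0" "r i j k k = 0"
  using antisym_left[of i i k l] antisym_right[of i j k k] by auto

text \<open>Rewrite rules towards components with increasing index pairs, the first pair not after
  the second in the order 12, 13, 14, 23, 24, 34. This leaves 21 components;
  \<open>cyclic_1423\<close> removes one more, leaving the 20 independent ones.\<close>

lemmas canonical = diagonal
  antisym_left[of 2 1] antisym_left[of 3 1] antisym_left[of 4 1] antisym_left[of 3 2]
  antisym_left[of 4 2] antisym_left[of 4 3]
  antisym_right[of _ _ 2 1] antisym_right[of _ _ 3 1] antisym_right[of _ _ 4 1] antisym_right[of _ _ 3 2]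
  antisym_right[of _ _ 4 2] antisym_right[of _ _ 4 3]
  pair_sym[of 1 3 1 2] pair_sym[of 1 4 1 2] pair_sym[of 2 3 1 2] pair_sym[of 2 4 1 2] pair_sym[of 3 4 1 2]
  pair_sym[of 1 4 1 3] pair_sym[of 2 3 1 3] pair_sym[of 2 4 1 3] pair_sym[of 3 4 1 3]
  pair_sym[of 2 3 1 4] pair_sym[of 2 4 1 4] pair_sym[of 3 4 1 4]
  pair_sym[of 2 4 2 3] pair_sym[of 3 4 2 3] pair_sym[of 3 4 2 4]

lemma cyclic_1423: "r 1 4 2 3 = r 1 3 2 4 - r 1 2 3 4"
  using cyclic[of 1 2 3 4] by (simp add: canonical)

section \<open>Ricci, Schouten and anti-self-dual Weyl components\<close>

definition ric :: "4 \<Rightarrow> 4 \<Rightarrow> real" where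
  "ric j l = r 3 j 1 l + r 1 j 3 l + r 4 j 2 l + r 2 j 4 l"

definition scal :: real where
  "scal = ric 1 3 + ric 3 1 + ric 2 4 + ric 4 2"

definition sch :: "4 \<Rightarrow> 4 \<Rightarrow> real" where
  "sch i j = (ric i j - scal / 6 * null_metric i j) / 2"

definition w :: "4 \<Rightarrow> 4 \<Rightarrow> 4 \<Rightarrow> 4 \<Rightarrow> real" where
  "w i j k l = r i j k l - (null_metric i k * sch j l - null_metric i l * sch j k + null_metric j l * sch i k - null_metric j k * sch i l)"

text \<open>The bivector of an \<alpha>-plane is \<open>\<lambda>(e\<^sub>1\<and>e\<^sub>3 -
  e\<^sub>2\<and>e\<^sub>4) - e\<^sub>1\<and>e\<^sub>4 + \<lambda>\<^sup>2
  e\<^sub>2\<and>e\<^sub>3\<close>. The three bivectors in it span the anti-self-dual ones, and the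
  Weyl tensor is required to annihilate each.\<close>

definition asd_vanishes :: bool where
  "asd_vanishes \<longleftrightarrow> (\<forall>k l. w 1 4 k l = 0 \<and> w 2 3 k l = 0 \<and> w 1 3 k l = w 2 4 k l)"

text \<open>The anti-self-dual Weyl part is a trace-free symmetric form on a three-dimensional
  space, whence five independent equations; passing from Weyl to Riemann components leaves just
  these.\<close>

lemma asd_vanishes_iff:
  "asd_vanishes \<longleftrightarrow> r 1 4 1 4 = 0 \<and> r 1 3 1 4 = r 1 4 2 4 \<and>
    r 1 3 1 3 + r 2 4 2 4 = 2 * r 1 3 2 4 + 2 * r 1 4 2 3 \<and> r 1 3 2 3 = r 2 3 2 4 \<and> r 2 3 2 3 = 0"
  unfolding asd_vanishes_def forall_4
  by (simp add: w_def sch_def scal_def ric_def null_metric_simps canonical cyclic_1423; argo)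

text \<open>The polynomial is \<open>R(m, n, m, n)\<close> at \<lambda> = \<open>t\<close>.\<close>

lemma asd_vanishes_quartic:
  "asd_vanishes \<longleftrightarrow> (\<forall>t. r 1 4 1 4 - 2 * t * (r 1 3 1 4 - r 1 4 2 4)
     + t^2 * (r 1 3 1 3 + r 2 4 2 4 - 2 * r 1 3 2 4 - 2 * r 1 4 2 3)
     + 2 * t^3 * (r 1 3 2 3 - r 2 3 2 4) + t^4 * r 2 3 2 3 = 0)" (is "_ \<longleftrightarrow> (\<forall>t. ?q t = 0)")
proof
  assume "asd_vanishes"
  then show "\<forall>t. ?q t = 0" unfolding asd_vanishes_iff by simp
next
  assume "\<forall>t. ?q t = 0"
  \<comment> \<open>Five values determine the five coefficients of a quartic.\<close>
  then have "?q 0 = 0" "?q 1 = 0" "?q (-1) = 0" "?q 2 = 0" "?q (-2) = 0" by blast+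
  then show "asd_vanishes" unfolding asd_vanishes_iff by simp
qed

lemma asd_ricci_flat:
  assumes "asd_vanishes" "\<And>i j. ric i j = 0"
  shows "r 1 4 k l = 0" "r 2 3 k l = 0" "r 1 3 k l = r 2 4 k l"
proof -
  have "sch i j = 0" for i j using assms(2) by (simp add: sch_def scal_def)
  then have "w i j k l = r i j k l" for i j k l by (simp add: w_def)
  then show "r 1 4 k l = 0" "r 2 3 k l = 0" "r 1 3 k l = r 2 4 k l"
    using assms(1) by (simp_all add: asd_vanishes_def)
qed

text \<open>On anti-self-dual bivectors the curvature operator consists of the anti-self-dual Weyl
  part, a multiple of the scalar curvature, and, as the component into self-dual bivectors, the
  trace-free Ricci tensor. Annihilating them therefore removes the whole Ricci tensor.\<close>

lemma ricci_flatI: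
  assumes "\<And>k l. r 1 4 k l = 0" "\<And>k l. r 2 3 k l = 0" "\<And>k l. r 1 3 k l = r 2 4 k l"
  shows "ric i j = 0"
proof -
  have "\<forall>i j. ric i j = 0"
    unfolding forall_4 ric_def
    using assms(1)[of 1 2] assms(1)[of 1 3] assms(1)[of 1 4] assms(1)[of 2 3] assms(1)[of 2 4] assms(1)[of 3 4]
      assms(2)[of 1 2] assms(2)[of 1 3] assms(2)[of 1 4] assms(2)[of 2 3] assms(2)[of 2 4] assms(2)[of 3 4]
      assms(3)[of 1 2] assms(3)[of 1 3] assms(3)[of 1 4] assms(3)[of 2 3] assms(3)[of 2 4] assms(3)[of 3 4] cyclic_1423
    by (simp add: canonical)
  then show ?thesis by blast
qed

text \<open>Up to sign the left sides are \<open>R(n, m, m, e\<^sub>3)\<close> and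
  \<open>R(n, m, m, e\<^sub>4)\<close> at \<lambda> = \<open>t\<close>. The Weyl tensor annihilates
  \<open>m \<and> n\<close>, and in the Schouten part nullity leaves
  \<open>g(m, e\<^sub>k) P(m, n)\<close> with \<open>g(m, e\<^sub>3) = 1\<close> and
  \<open>g(m, e\<^sub>4) = \<lambda>\<close>; hence the extra factor \<open>t\<close>.\<close>

lemma asd_mixed:
  assumes "asd_vanishes"
  shows "t * (r 1 3 1 3 - r 1 3 2 4) - r 1 3 1 4 + t^2 * r 1 3 2 3
      + t * (t * (r 1 3 2 3 - r 2 3 2 4) - r 1 4 2 3 + t^2 * r 2 3 2 3)
      = - (t * sch 1 3 - sch 1 4 + t^2 * sch 2 3 - t * sch 2 4)"
    and "t * (r 1 3 1 4 - r 1 4 2 4) - r 1 4 1 4 + t^2 * r 1 4 2 3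
      + t * (t * (r 1 3 2 4 - r 2 4 2 4) - r 1 4 2 4 + t^2 * r 2 3 2 4)
      = - t * (t * sch 1 3 - sch 1 4 + t^2 * sch 2 3 - t * sch 2 4)"
proof -
  have a: "r 1 4 1 4 = 0" "r 1 3 1 4 = r 1 4 2 4" "r 1 3 1 3 + r 2 4 2 4 = 2 * r 1 3 2 4 + 2 * r 1 4 2 3"
    "r 1 3 2 3 = r 2 3 2 4" "r 2 3 2 3 = 0"
    using assms unfolding asd_vanishes_iff by blast+
  have "sch 1 3 - sch 2 4 = (r 2 4 2 4 - r 1 3 1 3) / 2"
    by (simp add: sch_def scal_def ric_def null_metric_simps canonical cyclic_1423 field_simps)
  then have s: "sch 1 3 - sch 2 4 = r 1 4 2 3 - (r 1 3 1 3 - r 1 3 2 4)"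
    using a(3) by (simp add: field_simps)
  have s': "sch 1 4 = - r 1 3 1 4" "sch 2 3 = - r 1 3 2 3"
    using a by (simp_all add: sch_def scal_def ric_def null_metric_simps canonical)
  have p: "r 2 4 2 4 = 2 * r 1 3 2 4 + 2 * r 1 4 2 3 - r 1 3 1 3" "sch 1 3 = r 1 4 2 3 - (r 1 3 1 3 - r 1 3 2 4) + sch 2 4"
    using a(3) s by simp_all
  show "t * (r 1 3 1 3 - r 1 3 2 4) - r 1 3 1 4 + t^2 * r 1 3 2 3
      + t * (t * (r 1 3 2 3 - r 2 3 2 4) - r 1 4 2 3 + t^2 * r 2 3 2 3)
      = - (t * sch 1 3 - sch 1 4 + t^2 * sch 2 3 - t * sch 2 4)"
    unfolding a(1,2,4,5) p s' by (simp add: power2_eq_square algebra_simps)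
  show "t * (r 1 3 1 4 - r 1 4 2 4) - r 1 4 1 4 + t^2 * r 1 4 2 3
      + t * (t * (r 1 3 2 4 - r 2 4 2 4) - r 1 4 2 4 + t^2 * r 2 3 2 4)
      = - t * (t * sch 1 3 - sch 1 4 + t^2 * sch 2 3 - t * sch 2 4)"
    unfolding a(1,2,4,5) p s' by (simp add: power2_eq_square algebra_simps)
qed

end

section \<open>Frame components of the curvature\<close>

lemma sum_swap_pairs:
  "(\<Sum>p\<in>A. \<Sum>q\<in>B. \<Sum>i\<in>C. \<Sum>j\<in>D. f p q i j) = (\<Sum>i\<in>C. \<Sum>j\<in>D. \<Sum>p\<in>A. \<Sum>q\<in>B. f p q i j)"
proof -
  have "(\<Sum>q\<in>B. \<Sum>i\<in>C. \<Sum>j\<in>D. f p q i j) = (\<Sum>i\<in>C. \<Sum>j\<in>D. \<Sum>q\<in>B. f p q i j)" for p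
    by (subst sum.swap, rule sum.cong[OF refl], rule sum.swap)
  then have "(\<Sum>p\<in>A. \<Sum>q\<in>B. \<Sum>i\<in>C. \<Sum>j\<in>D. f p q i j) = (\<Sum>p\<in>A. \<Sum>i\<in>C. \<Sum>j\<in>D. \<Sum>q\<in>B. f p q i j)"
    by simp
  also have "\<dots> = (\<Sum>i\<in>C. \<Sum>j\<in>D. \<Sum>p\<in>A. \<Sum>q\<in>B. f p q i j)"
    by (subst sum.swap, rule sum.cong[OF refl], rule sum.swap)
  finally show ?thesis .
qed

lemma bil_axis: "bil M (axis a 1) (axis b 1) = M $ a $ b"
  by (simp add: bil_def matrix_vector_mult_basis column_def inner_axis' )

lemma bilinear_axis_sum:
  fixes B :: "vec4 \<Rightarrow> vec4 \<Rightarrow> real"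
  assumes B: "\<And>u u' v. B (u + u') v = B u v + B u' v" "\<And>c u v. B (c *\<^sub>R u) v = c * B u v"
    "\<And>u v v'. B u (v + v') = B u v + B u v'" "\<And>c u v. B u (c *\<^sub>R v) = c * B u v"
  shows "(\<Sum>i\<in>UNIV. \<Sum>j\<in>UNIV. u $ i * B (axis i 1) (axis j 1) * v $ j) = B u v"
proof -
  have "B u v = B (\<Sum>i\<in>UNIV. u $ i *\<^sub>R axis i 1) (\<Sum>j\<in>UNIV. v $ j *\<^sub>R axis j 1)"
    by (simp only: vec_axis_sum[symmetric])
  then show ?thesis by (simp add: sum_4 B algebra_simps)
qed

lemma bil_matrix_linear:
  "bil (M + N) u v = bil M u v + bil N u v" "bil (M - N) u v = bil M u v - bil N u v"
  "bil (c *\<^sub>R M) u v = c * bil M u v" "bil 0 u v = 0"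
  by (simp_all add: bil_sum sum.distrib sum_subtractf sum_distrib_left algebra_simps)

context adapted_chart
begin

lemma matrix_eq_frame:
  assumes x: "x \<in> V"
  shows "M = N \<longleftrightarrow> (\<forall>i j. bil M (e x $ i) (e x $ j) = bil N (e x $ i) (e x $ j))"
proof
  assume *: "\<forall>i j. bil M (e x $ i) (e x $ j) = bil N (e x $ i) (e x $ j)"
  have "bil M u v = bil N u v" for u v
    by (subst (1 2) expand[OF x, of u], subst (1 2) expand[OF x, of v]) (simp add: bil_linear *)
  then show "M = N" unfolding vec_eq_iff bil_axis[symmetric] by blast
qed simp

text \<open>Identifies the coordinate curvature with \<open>Rm\<close>, whose multilinearity and
  symmetries are known; this opens the passage to frame components.\<close>

lemma Rm_axis:
  assumes x: "x \<in> V"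
  shows "Rm x (axis c 1) (axis d 1) (axis b 1) $ a = riemann_up G x a b c d"
proof -
  have g: "gamma_op G y (axis i 1) (axis j 1) $ k = christoffel G y k i j" for y i j k
    using exhaust_4[of i] exhaust_4[of j] by (auto simp: gamma_op_def axis_def sum_4)
  have D: "DGam x (axis i 1) (axis j 1) (axis l 1) $ k = partial i (\<lambda>y. christoffel G y k j l) x" for i j k l
    using frechet_derivative_eqI[OF bounded_linear.has_derivative[OF bounded_linear_vec_nth DGam[OF x, of "axis j 1" "axis l 1"]], of k]
    by (simp add: partial_def g)
  have gg: "gamma_op G x (axis i 1) v $ k = (\<Sum>m\<in>UNIV. christoffel G x k i m * v $ m)" for i v k
    using exhaust_4[of i] by (auto simp: gamma_op_def axis_def sum_4)
  show ?thesis
    by (simp add: Rm_def riemann_up_def D gg g sum_subtractf)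
qed

lemma riemann_eq:
  "x \<in> V \<Longrightarrow> riemann G x a b c d = bil (G x) (axis a 1) (Rm x (axis c 1) (axis d 1) (axis b 1))"
  by (simp add: riemann_def Rm_axis[symmetric] bil_def inner_axis' matrix_vector_mult_def)

lemma Rm_expand:
  assumes x: "x \<in> V"
  shows "Rm x u v w = (\<Sum>d\<in>UNIV. \<Sum>b\<in>UNIV. (v $ d * w $ b) *\<^sub>R Rm x u (axis d 1) (axis b 1))"
  by (subst vec_axis_sum[of v], subst vec_axis_sum[of w])
    (simp add: sum_4 Rm_linear[OF x] scaleR_add_right ac_simps)

text \<open>A trace evaluated in the frame and its \<open>g\<close>-dual frame
  \<open>e\<^sub>3, e\<^sub>4, e\<^sub>1, e\<^sub>2\<close>.\<close>

lemma frame_trace: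
  assumes x: "x \<in> V" and T: "linear T"
  shows "(\<Sum>a\<in>UNIV. T (axis a 1) $ a) = bil (G x) (T (e x $ 1)) (e x $ 3) + bil (G x) (T (e x $ 2)) (e x $ 4)
     + bil (G x) (T (e x $ 3)) (e x $ 1) + bil (G x) (T (e x $ 4)) (e x $ 2)"
proof -
  interpret linear T by (rule T)
  have "T (axis a 1) = bil (G x) (axis a 1) (e x $ 3) *\<^sub>R T (e x $ 1) + bil (G x) (axis a 1) (e x $ 4) *\<^sub>R T (e x $ 2)
    + bil (G x) (axis a 1) (e x $ 1) *\<^sub>R T (e x $ 3) + bil (G x) (axis a 1) (e x $ 2) *\<^sub>R T (e x $ 4)" for a
    by (subst expand[OF x, of "axis a 1"]) (simp add: add scale)
  moreover have "(\<Sum>a\<in>UNIV. bil (G x) (axis a 1) w * u $ a) = bil (G x) u w" for u w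
    by (subst (2) vec_axis_sum[of u]) (simp add: sum_4 bil_linear)
  ultimately show ?thesis
    by (simp add: sum.distrib)
qed

lemma ricci_eq:
  assumes x: "x \<in> V"
  shows "bil (ricci G x) w v = bil (G x) (e x $ 3) (Rm x (e x $ 1) v w) + bil (G x) (e x $ 1) (Rm x (e x $ 3) v w)
     + bil (G x) (e x $ 4) (Rm x (e x $ 2) v w) + bil (G x) (e x $ 2) (Rm x (e x $ 4) v w)"
proof -
  have "linear (\<lambda>u. Rm x u v w)"
    by (rule linearI) (simp_all add: Rm_linear[OF x])
  note tr = frame_trace[OF x this]
  have "bil (ricci G x) w v = (\<Sum>b\<in>UNIV. \<Sum>d\<in>UNIV. \<Sum>a\<in>UNIV. v $ d * w $ b * Rm x (axis a 1) (axis d 1) (axis b 1) $ a)"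
    by (simp add: bil_sum ricci_def Rm_axis[OF x] sum_distrib_left sum_distrib_right mult_ac)
  also have "\<dots> = (\<Sum>a\<in>UNIV. \<Sum>d\<in>UNIV. \<Sum>b\<in>UNIV. v $ d * w $ b * Rm x (axis a 1) (axis d 1) (axis b 1) $ a)"
    by (subst (2) sum.swap, subst sum.swap, rule sum.cong[OF refl], rule sum.swap)
  also have "\<dots> = (\<Sum>a\<in>UNIV. Rm x (axis a 1) v w $ a)"
    by (subst (2) Rm_expand[OF x]) simp
  finally show ?thesis
    unfolding tr by (simp add: g_sym[OF x, of _ "Rm x _ _ _"])
qed

definition rc :: "vec4 \<Rightarrow> 4 \<Rightarrow> 4 \<Rightarrow> 4 \<Rightarrow> 4 \<Rightarrow> real" where
  "rc x i j k l = bil (G x) (e x $ i) (Rm x (e x $ k) (e x $ l) (e x $ j))"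

lemma null_frame_curvature_rc:
  assumes x: "x \<in> V"
  shows "null_frame_curvature (rc x)"
proof
  fix i j k l :: 4
  show "rc x j i k l = - rc x i j k l"
    using Rm_skew[OF x, of "e x $ k" "e x $ l" "e x $ i" "e x $ j"]
    by (simp add: rc_def g_sym[OF x, of "Rm x _ _ _" "e x $ j"])
  show "rc x i j l k = - rc x i j k l"
    by (simp add: rc_def Rm_antisym[of x "e x $ l" "e x $ k"] bil_linear)
  show "rc x i j k l + rc x i k l j + rc x i l j k = 0"
    using arg_cong[OF Bianchi[OF x, of "e x $ k" "e x $ l" "e x $ j"], of "bil (G x) (e x $ i)"]
    by (simp add: rc_def bil_linear add_ac)
qed

abbreviation "asd x \<equiv> null_frame_curvature.asd_vanishes (rc x)"

lemma ricci_frame: "x \<in> V \<Longrightarrow> bil (ricci G x) (e x $ i) (e x $ j) = null_frame_curvature.ric (rc x) i j"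
  by (simp add: ricci_eq null_frame_curvature.ric_def[OF null_frame_curvature_rc] rc_def)

lemma scalar_frame:
  assumes x: "x \<in> V"
  shows "scalar_curv G x = null_frame_curvature.scal (rc x)"
proof -
  have "scalar_curv G x = bil (ricci G x) (e x $ 1) (e x $ 3) + bil (ricci G x) (e x $ 3) (e x $ 1)
    + bil (ricci G x) (e x $ 2) (e x $ 4) + bil (ricci G x) (e x $ 4) (e x $ 2)"
    by (simp add: scalar_curv_def G_inverse(1)[OF x] bil_sum sum.distrib algebra_simps)
  then show ?thesis
    by (simp add: ricci_frame[OF x] null_frame_curvature.scal_def[OF null_frame_curvature_rc[OF x]])
qed

lemma g_frame_h: "x \<in> V \<Longrightarrow> bil (G x) (e x $ i) (e x $ j) = null_metric i j"
  using exhaust_4[of i] exhaust_4[of j]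
  by (auto simp: g_frame null_metric_simps)

lemma schouten_frame:
  assumes x: "x \<in> V"
  shows "bil (schouten G x) (e x $ i) (e x $ j) = null_frame_curvature.sch (rc x) i j"
  by (simp add: schouten_def bil_matrix_linear ricci_frame[OF x] scalar_frame[OF x] g_frame_h[OF x]
      null_frame_curvature.sch_def[OF null_frame_curvature_rc[OF x]])

text \<open>The Weyl tensor as a multilinear map, so that coordinate and frame vectors can be mixed
  in its arguments.\<close>

definition W4 :: "vec4 \<Rightarrow> vec4 \<Rightarrow> vec4 \<Rightarrow> vec4 \<Rightarrow> vec4 \<Rightarrow> real" where
  "W4 x p q u v = bil (G x) p (Rm x u v q)
     - (bil (G x) p u * bil (schouten G x) q v - bil (G x) p v * bil (schouten G x) q u
      + bil (G x) q v * bil (schouten G x) p u - bil (G x) q u * bil (schouten G x) p v)"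

lemma weyl_axis:
  "x \<in> V \<Longrightarrow> weyl G x a b c d = W4 x (axis a 1) (axis b 1) (axis c 1) (axis d 1)"
  by (simp add: weyl_def W4_def riemann_eq bil_axis)

lemma W4_frame:
  "x \<in> V \<Longrightarrow> W4 x (e x $ i) (e x $ j) (e x $ k) (e x $ l) = null_frame_curvature.w (rc x) i j k l"
  by (simp add: W4_def null_frame_curvature.w_def[OF null_frame_curvature_rc] g_frame_h schouten_frame
      rc_def)

lemma W4_linear:
  assumes x: "x \<in> V"
  shows "W4 x (p + p') q u v = W4 x p q u v + W4 x p' q u v" "W4 x (r *\<^sub>R p) q u v = r * W4 x p q u v"
    "W4 x p (q + q') u v = W4 x p q u v + W4 x p q' u v" "W4 x p (r *\<^sub>R q) u v = r * W4 x p q u v"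
    "W4 x p q (u + u') v = W4 x p q u v + W4 x p q u' v" "W4 x p q (r *\<^sub>R u) v = r * W4 x p q u v"
    "W4 x p q u (v + v') = W4 x p q u v + W4 x p q u v'" "W4 x p q u (r *\<^sub>R v) = r * W4 x p q u v"
  by (simp_all add: W4_def bil_linear Rm_linear[OF x] algebra_simps)

lemma W4_antisym:
  assumes x: "x \<in> V"
  shows "W4 x q p u v = - W4 x p q u v"
  using Rm_skew[OF x, of u v p q] by (simp add: W4_def g_sym[OF x, of "Rm x _ _ _" q] algebra_simps)

section \<open>The Hodge star in an adapted frame\<close>

definition dual_index :: "4 \<Rightarrow> 4" where
  "dual_index i = (if i = 1 then 3 else if i = 2 then 4 else if i = 3 then 1 else 2)"

lemma dual_index_simps: "dual_index 1 = 3" "dual_index 2 = 4" "dual_index 3 = 1" "dual_index 4 = 2"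
  by (simp_all add: dual_index_def)

text \<open>Raising an index replaces \<open>e\<^sub>i\<close> by its metric partner, the frame
  vector numbered \<open>dual_index i\<close>. The volume form contributes its three products of
  \<open>Om\<close>, so the star is evaluated on vectors without coordinates.\<close>

lemma hodge_bil:
  fixes F :: mat4
  assumes x: "x \<in> V"
  shows "bil (\<chi> a b. hodge (G x) (Om x) (\<lambda>r s. F $ r $ s) a b) u v
    = (1/2) * (\<Sum>i\<in>UNIV. \<Sum>j\<in>UNIV. bil F (e x $ dual_index i) (e x $ dual_index j) *
       - (bil (Om x) u v * bil (Om x) (e x $ i) (e x $ j) - bil (Om x) u (e x $ i) * bil (Om x) v (e x $ j)
          + bil (Om x) u (e x $ j) * bil (Om x) v (e x $ i)))"
proof -
  let ?H = "matrix_inv (G x)" and ?O = "Om x" and ?E = "\<lambda>i. e x $ i"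
  have H: "?H $ p $ r = (\<Sum>i\<in>UNIV. ?E i $ p * ?E (dual_index i) $ r)" for p r
    by (simp add: G_inverse(1)[OF x] sum_4 dual_index_simps)
  have HH: "(\<Sum>r\<in>UNIV. \<Sum>s\<in>UNIV. ?H $ p $ r * ?H $ q $ s * F $ r $ s)
      = (\<Sum>i\<in>UNIV. \<Sum>j\<in>UNIV. ?E i $ p * ?E j $ q * bil F (?E (dual_index i)) (?E (dual_index j)))" for p q
  proof -
    have "(\<Sum>r\<in>UNIV. \<Sum>s\<in>UNIV. ?H $ p $ r * ?H $ q $ s * F $ r $ s) = bil F (?H $ p) (?H $ q)"
      by (simp add: bil_sum mult_ac)
    moreover have "?H $ p = (\<Sum>i\<in>UNIV. ?E i $ p *\<^sub>R ?E (dual_index i))" for p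
      by (simp add: vec_eq_iff H)
    ultimately show ?thesis
      by (simp add: sum_4 bil_linear algebra_simps)
  qed
  have vol: "(\<Sum>p\<in>UNIV. \<Sum>q\<in>UNIV. vol ?O a b p q * (y $ p * z $ q))
      = - (?O $ a $ b * bil ?O y z - (?O *v y) $ a * (?O *v z) $ b + (?O *v z) $ a * (?O *v y) $ b)" for a b y z
  proof -
    have "(\<Sum>p\<in>UNIV. \<Sum>q\<in>UNIV. ?O $ a $ q * ?O $ b $ p * (y $ p * z $ q)) = (?O *v z) $ a * (?O *v y) $ b"
      unfolding matrix_vector_mult_def vec_lambda_beta sum_product by (subst sum.swap) (simp add: mult_ac)
    moreover have "(\<Sum>p\<in>UNIV. \<Sum>q\<in>UNIV. ?O $ a $ p * ?O $ b $ q * (y $ p * z $ q)) = (?O *v y) $ a * (?O *v z) $ b"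
      by (simp add: matrix_vector_mult_def sum_product mult_ac)
    moreover have "(\<Sum>p\<in>UNIV. \<Sum>q\<in>UNIV. ?O $ a $ b * ?O $ p $ q * (y $ p * z $ q)) = ?O $ a $ b * bil ?O y z"
      by (simp add: bil_sum sum_distrib_left mult_ac)
    ultimately show ?thesis
      by (simp add: vol_def sum.distrib sum_subtractf algebra_simps sum_negf)
  qed
  have ho: "hodge (G x) ?O (\<lambda>r s. F $ r $ s) a b
      = (1/2) * (\<Sum>i\<in>UNIV. \<Sum>j\<in>UNIV. bil F (?E (dual_index i)) (?E (dual_index j)) *
        - (?O $ a $ b * bil ?O (?E i) (?E j) - (?O *v ?E i) $ a * (?O *v ?E j) $ b + (?O *v ?E j) $ a * (?O *v ?E i) $ b))" for a b
  proof -
    have "hodge (G x) ?O (\<lambda>r s. F $ r $ s) a b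
      = (1/2) * (\<Sum>p\<in>UNIV. \<Sum>q\<in>UNIV. vol ?O a b p q * (\<Sum>r\<in>UNIV. \<Sum>s\<in>UNIV. ?H $ p $ r * ?H $ q $ s * F $ r $ s))"
      by (simp add: hodge_def sum_distrib_left mult.assoc)
    also have "\<dots> = (1/2) * (\<Sum>p\<in>UNIV. \<Sum>q\<in>UNIV. \<Sum>i\<in>UNIV. \<Sum>j\<in>UNIV.
        bil F (?E (dual_index i)) (?E (dual_index j)) * (vol ?O a b p q * (?E i $ p * ?E j $ q)))"
      unfolding HH by (simp add: sum_distrib_left mult_ac)
    also have "(\<Sum>p\<in>UNIV. \<Sum>q\<in>UNIV. \<Sum>i\<in>UNIV. \<Sum>j\<in>UNIV.
        bil F (?E (dual_index i)) (?E (dual_index j)) * (vol ?O a b p q * (?E i $ p * ?E j $ q)))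
      = (\<Sum>i\<in>UNIV. \<Sum>j\<in>UNIV. \<Sum>p\<in>UNIV. \<Sum>q\<in>UNIV.
        bil F (?E (dual_index i)) (?E (dual_index j)) * (vol ?O a b p q * (?E i $ p * ?E j $ q)))"
      by (rule sum_swap_pairs)
    also have "\<dots> = (\<Sum>i\<in>UNIV. \<Sum>j\<in>UNIV. bil F (?E (dual_index i)) (?E (dual_index j)) *
        (\<Sum>p\<in>UNIV. \<Sum>q\<in>UNIV. vol ?O a b p q * (?E i $ p * ?E j $ q)))"
      by (simp only: sum_distrib_left)
    finally show ?thesis unfolding vol .
  qed
  have con: "(\<Sum>a\<in>UNIV. \<Sum>b\<in>UNIV. u $ a * - (?O $ a $ b * c - (?O *v y) $ a * (?O *v z) $ b + (?O *v z) $ a * (?O *v y) $ b) * v $ b)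
      = - (bil ?O u v * c - bil ?O u y * bil ?O v z + bil ?O u z * bil ?O v y)" for c y z
  proof -
    have p: "(\<Sum>a\<in>UNIV. \<Sum>b\<in>UNIV. (u $ a * (?O *v y) $ a) * (v $ b * (?O *v z) $ b)) = bil ?O u y * bil ?O v z" for y z
      by (simp add: bil_def inner_vec_def sum_product)
    have "(\<Sum>a\<in>UNIV. \<Sum>b\<in>UNIV. u $ a * - (?O $ a $ b * c - (?O *v y) $ a * (?O *v z) $ b + (?O *v z) $ a * (?O *v y) $ b) * v $ b)
      = (\<Sum>a\<in>UNIV. \<Sum>b\<in>UNIV. (u $ a * (?O *v y) $ a) * (v $ b * (?O *v z) $ b)
          - (u $ a * (?O *v z) $ a) * (v $ b * (?O *v y) $ b) - u $ a * ?O $ a $ b * v $ b * c)"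
      by (simp add: algebra_simps)
    also have "\<dots> = bil ?O u y * bil ?O v z - bil ?O u z * bil ?O v y - bil ?O u v * c"
      unfolding sum_subtractf p bil_sum[of ?O u v] sum_distrib_right by (rule refl)
    finally show ?thesis by simp
  qed
  have "bil (\<chi> a b. hodge (G x) ?O (\<lambda>r s. F $ r $ s) a b) u v
    = (1/2) * (\<Sum>a\<in>UNIV. \<Sum>b\<in>UNIV. \<Sum>i\<in>UNIV. \<Sum>j\<in>UNIV. bil F (?E (dual_index i)) (?E (dual_index j)) *
       (u $ a * - (?O $ a $ b * bil ?O (?E i) (?E j) - (?O *v ?E i) $ a * (?O *v ?E j) $ b + (?O *v ?E j) $ a * (?O *v ?E i) $ b) * v $ b))"
    unfolding bil_sum[of "\<chi> a b. _ a b"] vec_lambda_beta ho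
    by (simp only: sum_distrib_left sum_distrib_right mult_ac)
  also have "(\<Sum>a\<in>UNIV. \<Sum>b\<in>UNIV. \<Sum>i\<in>UNIV. \<Sum>j\<in>UNIV. bil F (?E (dual_index i)) (?E (dual_index j)) *
       (u $ a * - (?O $ a $ b * bil ?O (?E i) (?E j) - (?O *v ?E i) $ a * (?O *v ?E j) $ b + (?O *v ?E j) $ a * (?O *v ?E i) $ b) * v $ b))
    = (\<Sum>i\<in>UNIV. \<Sum>j\<in>UNIV. \<Sum>a\<in>UNIV. \<Sum>b\<in>UNIV. bil F (?E (dual_index i)) (?E (dual_index j)) *
       (u $ a * - (?O $ a $ b * bil ?O (?E i) (?E j) - (?O *v ?E i) $ a * (?O *v ?E j) $ b + (?O *v ?E j) $ a * (?O *v ?E i) $ b) * v $ b))"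
    by (rule sum_swap_pairs)
  finally show ?thesis
    unfolding sum_distrib_left[symmetric] con .
qed

text \<open>A 2-form is fixed by the star exactly when it annihilates the anti-self-dual bivectors,
  spanned by \<open>e\<^sub>1\<and>e\<^sub>4\<close>, \<open>e\<^sub>2\<and>e\<^sub>3\<close> and
  \<open>e\<^sub>1\<and>e\<^sub>3 - e\<^sub>2\<and>e\<^sub>4\<close>.\<close>

lemma hodge_fixed_iff:
  fixes F :: mat4
  assumes x: "x \<in> V" and F: "\<And>u v. bil F v u = - bil F u v"
  shows "(\<forall>a b. F $ a $ b = hodge (G x) (Om x) (\<lambda>r s. F $ r $ s) a b) \<longleftrightarrow>
    bil F (e x $ 1) (e x $ 4) = 0 \<and> bil F (e x $ 2) (e x $ 3) = 0 \<and>
    bil F (e x $ 1) (e x $ 3) = bil F (e x $ 2) (e x $ 4)"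
proof -
  let ?E = "\<lambda>i. e x $ i"
  have d: "bil F u u = 0" for u using F[of u u] by simp
  have a: "bil F (?E 2) (?E 1) = - bil F (?E 1) (?E 2)" "bil F (?E 3) (?E 1) = - bil F (?E 1) (?E 3)"
    "bil F (?E 4) (?E 1) = - bil F (?E 1) (?E 4)" "bil F (?E 3) (?E 2) = - bil F (?E 2) (?E 3)"
    "bil F (?E 4) (?E 2) = - bil F (?E 2) (?E 4)" "bil F (?E 4) (?E 3) = - bil F (?E 3) (?E 4)"
    by (rule F)+
  have "(\<forall>a b. F $ a $ b = hodge (G x) (Om x) (\<lambda>r s. F $ r $ s) a b) \<longleftrightarrow>
      F = (\<chi> a b. hodge (G x) (Om x) (\<lambda>r s. F $ r $ s) a b)"
    by (simp add: vec_eq_iff)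
  also have "\<dots> \<longleftrightarrow> (\<forall>i j. bil F (?E i) (?E j) = bil (\<chi> a b. hodge (G x) (Om x) (\<lambda>r s. F $ r $ s) a b) (?E i) (?E j))"
    by (rule matrix_eq_frame[OF x])
  also have "\<dots> \<longleftrightarrow> bil F (?E 1) (?E 4) = 0 \<and> bil F (?E 2) (?E 3) = 0 \<and> bil F (?E 1) (?E 3) = bil F (?E 2) (?E 4)"
    unfolding hodge_bil[OF x] forall_4 sum_4 dual_index_simps
    by (simp add: Om_om[OF x] om_e[OF x] a d; argo)
  finally show ?thesis .
qed

lemma weyl_asd_iff:
  assumes x: "x \<in> V"
  shows "(\<forall>a b c d. weyl_asd G Om x a b c d = 0) \<longleftrightarrow> asd x"
proof -
  interpret null_frame_curvature "rc x" by (rule null_frame_curvature_rc[OF x])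
  let ?E = "\<lambda>i. e x $ i" and ?A = "\<lambda>i. axis i 1 :: vec4"
  define F where "F = (\<lambda>c d. (\<chi> a b. weyl G x a b c d) :: mat4)"
  have F: "bil (F c d) u v = W4 x u v (?A c) (?A d)" for c d u v
    unfolding F_def bil_sum vec_lambda_beta weyl_axis[OF x]
    by (rule bilinear_axis_sum) (simp_all add: W4_linear[OF x])
  have e: "(\<forall>c d. W4 x p q (?A c) (?A d) = W4 x p' q' (?A c) (?A d)) \<longleftrightarrow>
      (\<forall>k l. W4 x p q (?E k) (?E l) = W4 x p' q' (?E k) (?E l))" for p q p' q'
  proof -
    have M: "bil (\<chi> c d. W4 x p q (?A c) (?A d)) u v = W4 x p q u v" for p q u v
      unfolding bil_sum vec_lambda_beta
      by (rule bilinear_axis_sum) (simp_all add: W4_linear[OF x])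
    show ?thesis
      using matrix_eq_frame[OF x, of "\<chi> c d. W4 x p q (?A c) (?A d)" "\<chi> c d. W4 x p' q' (?A c) (?A d)"]
      unfolding M by (simp add: vec_eq_iff)
  qed
  \<comment> \<open>Writing zero as \<open>W4 x 0 0\<close> gives all three conditions the shape of
    \<open>e\<close>, which changes the last two slots from coordinate to frame vectors.\<close>
  have z: "W4 x 0 0 u v = 0" for u v by (simp add: W4_def bil_linear)
  have "(\<forall>a b c d. weyl_asd G Om x a b c d = 0) \<longleftrightarrow>
      (\<forall>c d. \<forall>a b. F c d $ a $ b = hodge (G x) (Om x) (\<lambda>r s. F c d $ r $ s) a b)"
    unfolding weyl_asd_def F_def vec_lambda_beta by auto
  also have "\<dots> \<longleftrightarrow> (\<forall>c d. W4 x (?E 1) (?E 4) (?A c) (?A d) = W4 x 0 0 (?A c) (?A d)) \<and>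
      (\<forall>c d. W4 x (?E 2) (?E 3) (?A c) (?A d) = W4 x 0 0 (?A c) (?A d)) \<and>
      (\<forall>c d. W4 x (?E 1) (?E 3) (?A c) (?A d) = W4 x (?E 2) (?E 4) (?A c) (?A d))"
    by (subst hodge_fixed_iff[OF x]) (auto simp: F z intro: W4_antisym[OF x])
  also have "\<dots> \<longleftrightarrow> asd x"
    unfolding e unfolding z W4_frame[OF x] asd_vanishes_def by blast
  finally show ?thesis .
qed

section \<open>Integrability in terms of the curvature\<close>

text \<open>The pairing \<open>g(n, R(e\<^sub>k, e\<^sub>l) m)\<close> as a quadratic in \<lambda> =
  \<open>t\<close>, with the curvature on the three anti-self-dual bivectors as
  coefficients.\<close>

definition alpha_curvature :: "vec4 \<Rightarrow> real \<Rightarrow> 4 \<Rightarrow> 4 \<Rightarrow> real" where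
  "alpha_curvature x t k l = - t * (rc x 1 3 k l - rc x 2 4 k l) + rc x 1 4 k l - t^2 * rc x 2 3 k l"

lemma alpha_curvature_eq:
  assumes x: "x \<in> V"
  shows "bil (G x) (l_plus (x, t)) (Rm x (e x $ k) (e x $ l) (l_minus (x, t))) = alpha_curvature x t k l"
proof -
  have a: "rc x j i k l = - rc x i j k l" for i j
    by (rule null_frame_curvature.antisym_left[OF null_frame_curvature_rc[OF x]])
  have "bil (G x) (l_plus (x, t)) (Rm x (e x $ k) (e x $ l) (l_minus (x, t)))
      = t * rc x 3 1 k l + t * (t * rc x 3 2 k l) - rc x 4 1 k l - t * rc x 4 2 k l"
    by (simp add: l_minus_def l_plus_def Rm_linear[OF x] bil_linear rc_def algebra_simps)
  then show ?thesis
    unfolding a[of 3 1] a[of 3 2] a[of 4 1] a[of 4 2] alpha_curvature_def by (simp add: algebra_simps power2_eq_square)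
qed

lemma Pi2_iff_asd:
  "frobenius_integrable_on (V \<times> UNIV) (Lift (Pi2_base G Om)) \<longleftrightarrow> (\<forall>x\<in>V. asd x)"
proof -
  define Q where "Q = (\<lambda>x t. rc x 1 4 1 4 - 2 * t * (rc x 1 3 1 4 - rc x 1 4 2 4)
     + t^2 * (rc x 1 3 1 3 + rc x 2 4 2 4 - 2 * rc x 1 3 2 4 - 2 * rc x 1 4 2 3)
     + 2 * t^3 * (rc x 1 3 2 3 - rc x 2 3 2 4) + t^4 * rc x 2 3 2 3)"
  have Q: "bil (G x) (l_plus (x, t)) (Rm x (l_minus (x, t)) (l_plus (x, t)) (l_minus (x, t))) = - Q x t" if x: "x \<in> V" for x t
  proof -
    interpret null_frame_curvature "rc x" by (rule null_frame_curvature_rc[OF x])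
    have d: "Rm x u (v - w) y = Rm x u v y - Rm x u w y" for u v w y
      using Rm_linear(2)[OF x, of u v "(-1) *\<^sub>R w" y] by (simp only: Rm_linear(5)[OF x]) simp
    have *: "bil (G x) (l_plus (x, t)) (Rm x (l_minus (x, t)) (l_plus (x, t)) y)
       = t * bil (G x) (l_plus (x, t)) (Rm x (e x $ 1) (e x $ 3) y) - bil (G x) (l_plus (x, t)) (Rm x (e x $ 1) (e x $ 4) y)
       + t * (t * bil (G x) (l_plus (x, t)) (Rm x (e x $ 2) (e x $ 3) y))
       - t * bil (G x) (l_plus (x, t)) (Rm x (e x $ 2) (e x $ 4) y)" for y
      unfolding l_minus_def[of "(x, t)"] l_plus_def[of "(x, t)"] fst_conv snd_conv
      by (simp add: Rm_linear[OF x] d bil_linear algebra_simps)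
    show ?thesis
      unfolding *[of "l_minus (x, t)"]
      by (simp add: Q_def alpha_curvature_eq[OF x] alpha_curvature_def canonical power2_eq_square power3_eq_cube power4_eq_xxxx algebra_simps)
  qed
  have asd: "asd x \<longleftrightarrow> (\<forall>t. Q x t = 0)" if "x \<in> V" for x
    unfolding Q_def by (rule null_frame_curvature.asd_vanishes_quartic[OF null_frame_curvature_rc[OF that]])
  show ?thesis
    unfolding Pi2_iff split_paired_All fst_conv using Q asd by auto
qed

lemma Pi3_iff_invariants:
  assumes asd: "\<forall>x\<in>V. asd x"
  shows "frobenius_integrable_on (V \<times> UNIV) (Lift (Pi3_base G Om)) \<longleftrightarrow>
    (\<forall>x\<in>V. \<forall>u v. tau_minus e x u v = 0) \<and> (\<forall>x\<in>V. \<forall>u. S_form G e x u = 0)"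
proof -
  let ?s = "\<lambda>x. null_frame_curvature.sch (rc x)"
  \<comment> \<open>This is \<open>P(m, n)\<close> at \<lambda> = \<open>t\<close>, with
    \<open>P\<close> the Schouten tensor.\<close>
  define q where "q = (\<lambda>x t. t * ?s x 1 3 - ?s x 1 4 + t^2 * ?s x 2 3 - t * ?s x 2 4)"
  have q: "bil (G x) (l_plus (x, t)) (Rm x (l_minus (x, t)) (e x $ 3) (l_minus (x, t))) = q x t"
    "bil (G x) (l_plus (x, t)) (Rm x (l_minus (x, t)) (e x $ 4) (l_minus (x, t))) = t * q x t" if x: "x \<in> V" for x t
  proof -
    interpret null_frame_curvature "rc x" by (rule null_frame_curvature_rc[OF x])
    have "bil (G x) (l_plus (x, t)) (Rm x (l_minus (x, t)) u y)
       = bil (G x) (l_plus (x, t)) (Rm x (e x $ 1) u y) + t * bil (G x) (l_plus (x, t)) (Rm x (e x $ 2) u y)" for u y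
      by (simp add: l_minus_def Rm_linear[OF x] bil_linear)
    then have *: "bil (G x) (l_plus (x, t)) (Rm x (l_minus (x, t)) (e x $ k) (l_minus (x, t))) = alpha_curvature x t 1 k + t * alpha_curvature x t 2 k" for k
      by (simp add: alpha_curvature_eq[OF x])
    show "bil (G x) (l_plus (x, t)) (Rm x (l_minus (x, t)) (e x $ 3) (l_minus (x, t))) = q x t"
      "bil (G x) (l_plus (x, t)) (Rm x (l_minus (x, t)) (e x $ 4) (l_minus (x, t))) = t * q x t"
      unfolding * using asd_mixed[of t] asd x by (simp_all add: alpha_curvature_def canonical q_def algebra_simps)
  qed
  \<comment> \<open>\<open>q x t\<close> is the value of the quadratic form \<open>S\<close> at
    \<open>m\<close>, so both sides state that its three coefficients vanish.\<close>
  have S: "(\<forall>u. S_form G e x u = 0) \<longleftrightarrow> (\<forall>t. q x t = 0)" if x: "x \<in> V" for x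
  proof -
    have Sf: "S_form G e x u = ?s x 2 3 * (om e x 2 u)\<^sup>2
        + (?s x 1 3 - ?s x 2 4) * om e x 1 u * om e x 2 u - ?s x 1 4 * (om e x 1 u)\<^sup>2" for u
      by (simp add: S_form_def schouten_comp_def schouten_frame[OF x] Let_def)
    show ?thesis
    proof
      assume "\<forall>u. S_form G e x u = 0"
      then have "S_form G e x (e x $ 1) = 0" "S_form G e x (e x $ 2) = 0" "S_form G e x (e x $ 1 + e x $ 2) = 0"
        by blast+
      then show "\<forall>t. q x t = 0"
        unfolding Sf om_linear by (simp add: om_e[OF x] q_def)
    next
      assume "\<forall>t. q x t = 0"
      then have "q x 0 = 0" "q x 1 = 0" "q x (-1) = 0" by blast+
      then have "?s x 2 3 = 0" "?s x 1 4 = 0" "?s x 1 3 - ?s x 2 4 = 0" by (simp_all add: q_def)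
      then show "\<forall>u. S_form G e x u = 0" unfolding Sf by simp
    qed
  qed
  have T: "(\<forall>x\<in>V. \<forall>u v. tau_minus e x u v = 0) \<longleftrightarrow> (\<forall>x\<in>V. \<forall>u. tau_form x u = 0)"
    using tau_form_zero_iff by blast
  show ?thesis
    unfolding T Pi3_iff
  proof (intro conj_cong refl iffI)
    assume tau_form: "\<forall>x\<in>V. \<forall>u. tau_form x u = 0" and "\<forall>x\<in>V. \<forall>u. S_form G e x u = 0"
    then have q0: "q x t = 0" if "x \<in> V" for x t using S[OF that] that by blast
    show "\<forall>z u v. fst z \<in> V \<longrightarrow> bil (G (fst z)) u (l_plus z) = 0 \<longrightarrow> bil (G (fst z)) v (l_plus z) = 0 \<longrightarrow>
        bil (G (fst z)) (l_plus z) (Rm (fst z) u v (l_minus z)) = 0"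
    proof (intro allI impI)
      fix z u v assume z: "fst z \<in> V" and uv: "bil (G (fst z)) u (l_plus z) = 0" "bil (G (fst z)) v (l_plus z) = 0"
      obtain x t where zx: "z = (x, t)" by (cases z)
      have x: "x \<in> V" using z zx by simp
      interpret null_frame_curvature "rc x" by (rule null_frame_curvature_rc[OF x])
      have "rc x 4 3 k l = 0" for k l
        using L_plus_parallel_curvature[of x "e x $ k" "e x $ l"] tau_form x
        by (simp add: rc_def g_sym[OF x, of "e x $ 4"])
      then have "rc x 3 4 k l = 0" for k l using antisym_left[of 4 3 k l] by simp
      then have "rc x k l 3 4 = 0" for k l using pair_sym[of 3 4 k l] by simp
      then have "alpha_curvature x t 3 4 = 0" by (simp add: alpha_curvature_def)
      then show "bil (G (fst z)) (l_plus z) (Rm (fst z) u v (l_minus z)) = 0"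
        using l_plus_perp_curvature[OF z _ _ _ uv] unfolding zx fst_conv q[OF x] alpha_curvature_eq[OF x] q0[OF x] by simp
    qed
  next
    assume R: "\<forall>z u v. fst z \<in> V \<longrightarrow> bil (G (fst z)) u (l_plus z) = 0 \<longrightarrow> bil (G (fst z)) v (l_plus z) = 0 \<longrightarrow>
        bil (G (fst z)) (l_plus z) (Rm (fst z) u v (l_minus z)) = 0"
    have "q x t = 0" if x: "x \<in> V" for x t
      using R[rule_format, of "(x, t)" "l_minus (x, t)" "e x $ 3"] q(1)[OF x, of t] g_l_minus_plus[of "(x, t)"] x
      by (simp add: l_plus_def bil_linear g_frame[OF x])
    then show "\<forall>x\<in>V. \<forall>u. S_form G e x u = 0" using S by blast
  qed
qed

lemma Pi4_iff_ricci_flat: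
  assumes asd: "\<forall>x\<in>V. asd x"
  shows "frobenius_integrable_on (V \<times> UNIV) (Lift (Pi4_base G Om)) \<longleftrightarrow> (\<forall>x\<in>V. ricci G x = 0)"
proof -
  have "(\<forall>t u v. bil (G x) (l_plus (x, t)) (Rm x u v (l_minus (x, t))) = 0) \<longleftrightarrow> ricci G x = 0" if x: "x \<in> V" for x
  proof -
    interpret null_frame_curvature "rc x" by (rule null_frame_curvature_rc[OF x])
    have ric: "ricci G x = 0 \<longleftrightarrow> (\<forall>i j. ric i j = 0)"
      unfolding matrix_eq_frame[OF x] ricci_frame[OF x] bil_matrix_linear by (rule refl)
    have K: "(\<forall>t u v. bil (G x) (l_plus (x, t)) (Rm x u v (l_minus (x, t))) = 0) \<longleftrightarrow> (\<forall>t k l. alpha_curvature x t k l = 0)"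
    proof
      assume *: "\<forall>t k l. alpha_curvature x t k l = 0"
      show "\<forall>t u v. bil (G x) (l_plus (x, t)) (Rm x u v (l_minus (x, t))) = 0"
      proof (intro allI)
        fix t u v
        have "bil (G x) (l_plus (x, t)) (Rm x (e x $ k) (e x $ l) (l_minus (x, t))) = 0" for k l
          using * by (simp add: alpha_curvature_eq[OF x])
        then show "bil (G x) (l_plus (x, t)) (Rm x u v (l_minus (x, t))) = 0"
          by (subst expand[OF x, of u], subst expand[OF x, of v]) (simp add: Rm_linear[OF x] bil_linear)
      qed
    qed (simp flip: alpha_curvature_eq[OF x])
    show ?thesis
      unfolding ric K
    proof
      assume *: "\<forall>t k l. alpha_curvature x t k l = 0"
      \<comment> \<open>The quadratic in \<lambda> is evaluated at 0, 1 and -1.\<close>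
      have "rc x 1 4 k l = 0 \<and> rc x 2 3 k l = 0 \<and> rc x 1 3 k l = rc x 2 4 k l" for k l
        using *[rule_format, of 0 k l] *[rule_format, of 1 k l] *[rule_format, of "-1" k l] by (simp add: alpha_curvature_def)
      then show "\<forall>i j. ric i j = 0" using ricci_flatI by blast
    next
      assume "\<forall>i j. ric i j = 0"
      then have "rc x 1 4 k l = 0" "rc x 2 3 k l = 0" "rc x 1 3 k l = rc x 2 4 k l" for k l
        using asd_ricci_flat[of k l] asd x by simp_all
      then show "\<forall>t k l. alpha_curvature x t k l = 0" by (simp add: alpha_curvature_def)
    qed
  qed
  then show ?thesis
    unfolding Pi4_iff by (auto simp: split_paired_All)
qed

end

section \<open>Existence of adapted frames\<close>

text \<open>Supplies a degenerate direction for the metric if the pairing of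
  \<open>L\<^sub>-\<close> with \<open>L\<^sub>+\<close> had rank at most one.\<close>

lemma common_kernel:
  fixes \<phi> \<psi> :: "vec4 \<Rightarrow> real"
  assumes "linear \<phi>" "linear \<psi>"
  obtains w where "w \<noteq> 0" "\<phi> w = 0" "\<psi> w = 0"
proof -
  let ?p = "adjoint \<phi> 1" and ?q = "adjoint \<psi> 1"
  have "dim {?p, ?q} \<le> card {?p, ?q}" by (rule dim_le_card') simp
  also have "\<dots> \<le> 2" by (simp add: card_insert_if)
  finally have "dim {?p, ?q} < DIM(vec4)" by simp
  from orthogonal_to_subspace_exists[OF this] obtain w where w: "w \<noteq> 0"
    "\<And>y. y \<in> span {?p, ?q} \<Longrightarrow> orthogonal w y" by blast
  have "w \<bullet> ?p = 0" "w \<bullet> ?q = 0"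
    using w(2)[OF span_base] by (auto simp: orthogonal_def)
  then have "\<phi> w = 0" "\<psi> w = 0"
    using adjoint_works[OF assms(1), of w 1] adjoint_works[OF assms(2), of w 1] by simp_all
  then show thesis using that w(1) by blast
qed

text \<open>Gram matrix and \<open>J\<close>-eigenvectors determine everything. The Gram matrix is
  its own inverse, which also gives the linear independence of the frame.\<close>

lemma adapted_frameI:
  assumes V: "open V" "smooth_on V e"
    and g: "\<And>x i j. x \<in> V \<Longrightarrow> bil (G x) (e x $ i) (e x $ j) = null_metric i j"
    and Om: "\<And>x i u. x \<in> V \<Longrightarrow> bil (Om x) u (e x $ i) = (if i = 1 \<or> i = 2 then - 1 else 1) * bil (G x) u (e x $ i)"
  shows "adapted_frame G Om V e"
  unfolding adapted_frame_def
proof (intro conjI V ballI allI)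
  fix x assume x: "x \<in> V"
  define H :: mat4 where "H = (\<chi> i j. null_metric i j)"
  have "(e x ** G x ** transpose (e x)) $ i $ j = bil (G x) (e x $ i) (e x $ j)" for i j
    by (simp add: bil_def matrix_matrix_mult_def matrix_vector_mult_def transpose_def inner_vec_def sum_4 algebra_simps)
  then have "e x ** G x ** transpose (e x) = H" by (simp add: vec_eq_iff g[OF x] H_def)
  moreover have "H ** H = mat 1"
    by (simp add: H_def vec_eq_iff forall_4 matrix_matrix_mult_def sum_4 null_metric_simps mat_def)
  ultimately have "e x ** (G x ** transpose (e x) ** H) = mat 1" by (simp add: matrix_mul_assoc)
  then show e: "invertible (e x)" unfolding invertible_right_inverse by blast
  fix u v
  note ex = vec4_expand[where e = e, OF e]
  show "bil (G x) u v = om e x 1 u * om e x 3 v + om e x 3 u * om e x 1 v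
                         + om e x 2 u * om e x 4 v + om e x 4 u * om e x 2 v"
    by (subst (1) ex[of u], subst (1) ex[of v]) (simp add: bil_linear g[OF x] null_metric_simps algebra_simps)
  show "bil (Om x) u v = om e x 1 u * om e x 3 v - om e x 3 u * om e x 1 v
                          + om e x 2 u * om e x 4 v - om e x 4 u * om e x 2 v"
    by (subst (1) ex[of u], subst (1) ex[of v]) (simp add: bil_linear g[OF x] null_metric_simps Om[OF x] algebra_simps)
qed

text \<open>The projections \<open>(1 - J)/2\<close> and \<open>(1 + J)/2\<close>, applied to
  constant vectors, give smooth sections of the eigenspaces. These are null because \<open>J\<close>
  is skew for \<open>g\<close>, so \<open>g\<close> reduces to the pairing \<open>h\<close> between
  them, and a basis of \<open>L\<^sub>-\<close> is completed by its dual basis in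
  \<open>L\<^sub>+\<close>.\<close>

lemma adapted_frame_exists:
  assumes S: "open S" "smooth_on S G" "smooth_on S Om" "x0 \<in> S"
    and G: "\<And>x. x \<in> S \<Longrightarrow> transpose (G x) = G x" "\<And>x. x \<in> S \<Longrightarrow> invertible (G x)"
    and Om: "\<And>x. x \<in> S \<Longrightarrow> transpose (Om x) = - Om x"
    and J: "\<And>x. x \<in> S \<Longrightarrow> J_of (G x) (Om x) ** J_of (G x) (Om x) = mat 1"
  obtains V e where "x0 \<in> V" "V \<subseteq> S" "adapted_frame G Om V e"
proof -
  define J where "J = (\<lambda>x. J_of (G x) (Om x))"
  have smJ: "smooth_on S J"
    unfolding J_def J_of_def by (intro smooth_intros smooth_on_matrix_inv S G)
  have sym: "bil (G x) u v = bil (G x) v u" if "x \<in> S" for x u v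
    unfolding bil_def using dot_lmul_matrix[of u "G x" v] G(1)[OF that]
    by (metis inner_commute transpose_matrix_vector)
  have asym: "bil (Om x) u v = - bil (Om x) v u" if "x \<in> S" for x u v
  proof -
    have O: "Om x $ j $ i = - Om x $ i $ j" for i j
      using arg_cong[OF Om[OF that], of "\<lambda>M. M $ i $ j"] by (simp add: transpose_def)
    have "v $ j * Om x $ j $ i * u $ i = - (u $ i * Om x $ i $ j * v $ j)" for i j
      by (subst O) simp
    then show ?thesis
      unfolding bil_sum by (subst (2) sum.swap) (simp only: sum_negf minus_minus)
  qed
  have GJ: "bil (G x) u (J x *v v) = bil (Om x) u v" if "x \<in> S" for x u v
    by (simp add: bil_def J_def J_of_def matrix_vector_mul_assoc matrix_mul_assoc matrix_inv_inverse(2)[OF G(2)[OF that]])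
  have JJ: "J x *v (J x *v v) = v" if "x \<in> S" for x v
    using J[OF that] by (simp add: J_def matrix_vector_mul_assoc)
  have sk: "bil (G x) (J x *v u) v = - bil (G x) u (J x *v v)" if "x \<in> S" for x u v
    using GJ[OF that] sym[OF that] asym[OF that] by metis
  define A where "A = (\<lambda>a x. (1/2) *\<^sub>R (a - J x *v a))"
  define B where "B = (\<lambda>a x. (1/2) *\<^sub>R (a + J x *v a))"
  have JA: "J x *v A a x = - A a x" and JB: "J x *v B a x = B a x" if "x \<in> S" for a x
    by (simp_all add: A_def B_def matrix_vector_mult_scaleR matrix_vector_mult_diff_distrib
        matrix_vector_right_distrib JJ[OF that] algebra_simps)
  have AB: "A a x + B a x = a" for a x
    by (simp add: A_def B_def scaleR_add_right[symmetric] scaleR_2[symmetric])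
  have AA: "bil (G x) (A a x) (A b x) = 0" and BB: "bil (G x) (B a x) (B b x) = 0" if "x \<in> S" for a b x
    using sk[OF that, of "A a x" "A b x"] sk[OF that, of "B a x" "B b x"] by (simp_all add: JA JB that bil_linear)
  have smA: "smooth_on S (A a)" and smB: "smooth_on S (B a)" for a
    unfolding A_def B_def by (intro smooth_intros smJ S)+
  define h where "h = (\<lambda>a b x. bil (G x) (A a x) (B b x))"
  have hg: "bil (G x) u v = h u v x + h v u x" if "x \<in> S" for u v x
  proof -
    have "bil (G x) u v = bil (G x) (A u x + B u x) (A v x + B v x)" by (simp add: AB)
    then show ?thesis by (simp add: bil_linear AA BB that h_def sym[OF that, of "B u x"])
  qed
  have smh: "smooth_on S (h a b)" for a b
    unfolding h_def by (intro smooth_intros smA smB S)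
  have ABl: "A (a + b) x = A a x + A b x" "A (c *\<^sub>R a) x = c *\<^sub>R A a x"
    "B (a + b) x = B a x + B b x" "B (c *\<^sub>R a) x = c *\<^sub>R B a x" for a b c x
    by (simp_all add: A_def B_def matrix_vector_right_distrib matrix_vector_mult_scaleR algebra_simps)
  have lin: "linear (\<lambda>a. h a b x)" "linear (\<lambda>b. h a b x)" for a b x
    by (rule linearI, simp_all add: h_def ABl bil_linear)+
  have nondeg: "u = 0" if "x \<in> S" "\<And>v. bil (G x) v u = 0" for x u
  proof -
    have "G x *v u = 0" using that(2)[of "G x *v u"] by (simp add: bil_def)
    then show ?thesis using G(2)[OF that(1)] by (metis matrix_inv_inverse(1) matrix_vector_mul_assoc matrix_vector_mul_lid matrix_vector_mult_0_right)
  qed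
  \<comment> \<open>If all 2 by 2 minors of \<open>h\<close> vanished at \<open>x0\<close>, a vector
    killed in both slots against one nonzero entry would be killed in both slots against everything,
    hence be \<open>g\<close>-orthogonal to all vectors.\<close>
  have "\<exists>a1 a2 b1 b2. h a1 b1 x0 * h a2 b2 x0 - h a1 b2 x0 * h a2 b1 x0 \<noteq> 0"
  proof (rule ccontr)
    assume "\<not> ?thesis"
    then have r: "h a1 b1 x0 * h a2 b2 x0 = h a1 b2 x0 * h a2 b1 x0" for a1 a2 b1 b2 by auto
    have "\<exists>a0 b0. h a0 b0 x0 \<noteq> 0"
    proof (rule ccontr)
      assume "\<not> ?thesis"
      then have "(axis 1 1 :: vec4) = 0" using nondeg[OF S(4)] hg[OF S(4)] by simp
      then show False by (simp add: axis_eq_0_iff)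
    qed
    then obtain a0 b0 where 0: "h a0 b0 x0 \<noteq> 0" by blast
    obtain w where w: "w \<noteq> 0" "h w b0 x0 = 0" "h a0 w x0 = 0" by (rule common_kernel[OF lin])
    have "h w b x0 = 0" "h a w x0 = 0" for a b
      using r[of w b a0 b0] r[of a0 b0 a w] 0 w by auto
    then have "w = 0" using nondeg[OF S(4), of w] hg[OF S(4)] by simp
    then show False using w(1) by simp
  qed
  then obtain a1 a2 b1 b2 where d0: "h a1 b1 x0 * h a2 b2 x0 - h a1 b2 x0 * h a2 b1 x0 \<noteq> 0" by blast
  define d where "d = (\<lambda>x. h a1 b1 x * h a2 b2 x - h a1 b2 x * h a2 b1 x)"
  define V where "V = {x \<in> S. d x \<noteq> 0}"
  have smd: "smooth_on S d" unfolding d_def by (intro smooth_intros smh S)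
  have "open (S \<inter> d -` (- {0}))"
    by (rule continuous_open_preimage[OF smooth_on_imp_continuous_on[OF smd] S(1)]) auto
  moreover have "V = S \<inter> d -` (- {0})" by (auto simp: V_def)
  ultimately have oV: "open V" by simp
  have VS: "V \<subseteq> S" and x0: "x0 \<in> V" using S(4) d0 by (auto simp: V_def d_def)
  \<comment> \<open>The inverse of the 2 by 2 matrix of \<open>h\<close> by cofactors;
    \<open>V\<close> is where its determinant \<open>d\<close> is nonzero.\<close>
  define e3 where "e3 = (\<lambda>x. (1 / d x) *\<^sub>R (h a2 b2 x *\<^sub>R B b1 x - h a2 b1 x *\<^sub>R B b2 x))"
  define e4 where "e4 = (\<lambda>x. (1 / d x) *\<^sub>R (h a1 b1 x *\<^sub>R B b2 x - h a1 b2 x *\<^sub>R B b1 x))"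
  define e where "e = (\<lambda>x. (\<chi> i. if i = 1 then A a1 x else if i = 2 then A a2 x else if i = 3 then e3 x else e4 x) :: mat4)"
  have smooth_V: "smooth_on V (h a b)" "smooth_on V (A a)" "smooth_on V (B a)" "smooth_on V d" for a b
    by (rule smooth_on_subset[OF _ VS], rule smh smA smB smd)+
  have "smooth_on V (\<lambda>x. e x $ i)" for i
  proof -
    have sm3: "smooth_on V e3" and sm4: "smooth_on V e4"
      unfolding e3_def e4_def by (intro smooth_intros oV smooth_V; simp add: V_def)+
    show ?thesis using exhaust_4[of i] by (auto simp: e_def sm3 sm4 smooth_V)
  qed
  then have "smooth_on V (\<lambda>x. \<chi> i. e x $ i)" by (rule smooth_on_vec_lambda[OF oV])
  then have sme: "smooth_on V e" by simp
  have E: "e x $ 1 = A a1 x" "e x $ 2 = A a2 x" "e x $ 3 = e3 x" "e x $ 4 = e4 x" for x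
    by (simp_all add: e_def)
  have "adapted_frame G Om V e"
  proof (rule adapted_frameI[OF oV sme])
    fix x i j assume xV: "x \<in> V"
    then have x: "x \<in> S" and d: "d x \<noteq> 0" by (auto simp: V_def)
    have H: "bil (G x) (A a x) (B b x) = h a b x" "bil (G x) (B b x) (A a x) = h a b x" for a b
      using sym[OF x] by (simp_all add: h_def)
    have "bil (G x) (A a1 x) (e3 x) = 1" "bil (G x) (A a1 x) (e4 x) = 0"
      "bil (G x) (A a2 x) (e3 x) = 0" "bil (G x) (A a2 x) (e4 x) = 1"
      using d by (simp_all add: e3_def e4_def bil_linear H) (simp_all add: d_def mult.commute)
    moreover have "bil (G x) (e3 x) (e3 x) = 0" "bil (G x) (e3 x) (e4 x) = 0"
      "bil (G x) (e4 x) (e3 x) = 0" "bil (G x) (e4 x) (e4 x) = 0"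
      by (simp_all add: e3_def e4_def bil_linear BB[OF x])
    ultimately show "bil (G x) (e x $ i) (e x $ j) = null_metric i j"
      using exhaust_4[of i] exhaust_4[of j]
        sym[OF x, of "e3 x" "A a1 x"] sym[OF x, of "e3 x" "A a2 x"]
        sym[OF x, of "e4 x" "A a1 x"] sym[OF x, of "e4 x" "A a2 x"]
      by (elim disjE) (simp_all add: null_metric_simps E AA[OF x])
  next
    fix x i u assume "x \<in> V"
    then have x: "x \<in> S" by (auto simp: V_def)
    have "J x *v e3 x = e3 x" "J x *v e4 x = e4 x"
      by (simp_all add: e3_def e4_def matrix_vector_mult_scaleR matrix_vector_mult_diff_distrib JB[OF x])
    then show "bil (Om x) u (e x $ i) = (if i = 1 \<or> i = 2 then - 1 else 1) * bil (G x) u (e x $ i)"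
      unfolding GJ[OF x, symmetric] using exhaust_4[of i]
      by (elim disjE) (simp_all add: E JA[OF x] bil_linear)
  qed
  then show thesis using that x0 VS by blast
qed

lemma neutral_signature_invertible:
  assumes "neutral_signature M"
  shows "invertible M" "transpose M = M"
proof -
  let ?D = "(\<chi> i j. if i \<noteq> j then 0 else if i = 1 \<or> i = 2 then 1 else - 1) :: mat4"
  obtain B where B: "transpose B ** M ** B = ?D" and "transpose M = M"
    using assms unfolding neutral_signature_def by blast
  then show "transpose M = M" by simp
  have "?D ** ?D = mat 1"
    by (simp add: vec_eq_iff forall_4 matrix_matrix_mult_def sum_4 mat_def)
  from arg_cong[OF this, of det] have "det ?D * det ?D = 1" unfolding det_mul det_I .
  then have "det (transpose B ** M ** B) \<noteq> 0" unfolding B by fastforce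
  then have "det M \<noteq> 0" unfolding det_mul by simp
  then show "invertible M" by (simp add: invertible_det_nz)
qed

text \<open>The right side does not mention frames, so a frame around each point is enough to
  recover it.\<close>

lemma chartwise:
  assumes "\<And>k V e. k \<in> A \<Longrightarrow> V \<subseteq> chart_image k \<Longrightarrow> adapted_frame (g k) (\<Omega> k) V e \<Longrightarrow>
      P k V e \<longleftrightarrow> (\<forall>x\<in>V. Q k x)"
    and "\<And>k x. k \<in> A \<Longrightarrow> x \<in> chart_image k \<Longrightarrow>
      \<exists>V e. x \<in> V \<and> V \<subseteq> chart_image k \<and> adapted_frame (g k) (\<Omega> k) V e"
  shows "(\<forall>k\<in>A. \<forall>V e. V \<subseteq> chart_image k \<and> adapted_frame (g k) (\<Omega> k) V e \<longrightarrow> P k V e) \<longleftrightarrow>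
    (\<forall>k\<in>A. \<forall>x\<in>chart_image k. Q k x)"
  using assms by (meson subsetD)

theorem proposition4p5:
  fixes A :: "'q::{second_countable_topology, t2_space} chart set"
    and g \<Omega> :: "'q tensor2"
  assumes "almost_para_kahler A g \<Omega>"
  shows "(Pi2_integrable A g \<Omega> \<longleftrightarrow> self_dual A g \<Omega>) \<and>
    (self_dual A g \<Omega> \<longrightarrow>
       (Pi3_integrable A g \<Omega> \<longleftrightarrow> tau_minus_vanishes A g \<Omega> \<and> S_vanishes A g \<Omega>)) \<and>
    (Pi2_integrable A g \<Omega> \<and> Pi3_integrable A g \<Omega> \<longrightarrow>
       (Pi4_integrable A g \<Omega> \<longleftrightarrow> ricci_flat A g))"
proof -
  have chart: "open (chart_image k)" "smooth_on (chart_image k) (g k)" "smooth_on (chart_image k) (\<Omega> k)"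
    "closed_form2 (chart_image k) (\<Omega> k)" if "k \<in> A" for k
    using assms that unfolding almost_para_kahler_def smooth_atlas_def tensor2_field_def by blast+
  have pt: "transpose (g k x) = g k x" "invertible (g k x)" "transpose (\<Omega> k x) = - \<Omega> k x"
    "J_of (g k x) (\<Omega> k x) ** J_of (g k x) (\<Omega> k x) = mat 1" if "k \<in> A" "x \<in> chart_image k" for k x
    using assms that neutral_signature_invertible unfolding almost_para_kahler_def by blast+
  have cover: "\<exists>V e. x \<in> V \<and> V \<subseteq> chart_image k \<and> adapted_frame (g k) (\<Omega> k) V e"
    if k: "k \<in> A" and x: "x \<in> chart_image k" for k x
    by (rule adapted_frame_exists[OF chart(1-3)[OF k] x pt[OF k]]) blast+
  have adapted: "adapted_chart (g k) (\<Omega> k) V e"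
    if k: "k \<in> A" and V: "V \<subseteq> chart_image k" and e: "adapted_frame (g k) (\<Omega> k) V e" for k V e
    using smooth_on_subset[OF chart(2)[OF k] V] smooth_on_subset[OF chart(3)[OF k] V] chart(4)[OF k] V e
    by unfold_locales (auto simp: closed_form2_def)
  have asd: "(\<forall>a b c d. weyl_asd (g k) (\<Omega> k) x a b c d = 0) \<longleftrightarrow>
      null_frame_curvature.asd_vanishes (adapted_chart.rc (g k) e x)"
    if "k \<in> A" "V \<subseteq> chart_image k" "adapted_frame (g k) (\<Omega> k) V e" "x \<in> V" for k V e x
    by (rule adapted_chart.weyl_asd_iff[OF adapted[OF that(1-3)] that(4)])
  have sd: "\<forall>x\<in>V. null_frame_curvature.asd_vanishes (adapted_chart.rc (g k) e x)"
    if "self_dual A g \<Omega>" "k \<in> A" "V \<subseteq> chart_image k" "adapted_frame (g k) (\<Omega> k) V e" for k V e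
    using that(1) asd[OF that(2-4)] that(2,3) unfolding self_dual_def by blast
  have 1: "Pi2_integrable A g \<Omega> \<longleftrightarrow> self_dual A g \<Omega>"
    unfolding integrable_lift_def self_dual_def
    by (rule chartwise[OF _ cover]) (simp_all add: adapted_chart.Pi2_iff_asd[OF adapted] asd)
  \<comment> \<open>Both sides range over the same adapted frames and are compared frame by
    frame.\<close>
  have 2: "Pi3_integrable A g \<Omega> \<longleftrightarrow> tau_minus_vanishes A g \<Omega> \<and> S_vanishes A g \<Omega>" if "self_dual A g \<Omega>"
    unfolding integrable_lift_def tau_minus_vanishes_def S_vanishes_def
    by (auto simp: adapted_chart.Pi3_iff_invariants[OF adapted sd[OF that]])
  \<comment> \<open>In the third claim self-duality comes from the integrability of
    \<open>\<Pi>\<^sup>2\<close> through \<open>1\<close>.\<close>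
  have 3: "Pi4_integrable A g \<Omega> \<longleftrightarrow> ricci_flat A g" if "self_dual A g \<Omega>"
    unfolding integrable_lift_def ricci_flat_def
    by (rule chartwise[OF adapted_chart.Pi4_iff_ricci_flat[OF adapted sd[OF that]] cover])
  show ?thesis using 1 2 3 by blast
qed

end
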